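(* Let $W$ be a weight satisfying $(C_1)$, $(C_2)$ and $(C_3)$, let $\{\omega(n)\}_{n\geq 0}$ be its associated moment sequence, and let $\Omega(n)=1/\omega(n)$. For a compact set $E\subset \mathbb{T}$, the following statements are all equivalent: (i) $E$ has zero $\omega$-capacity. (ii) There exists an outer function $f\in C_A(\mathbb{T}) \cap \ell_A^2(\Omega)$ with $f=0$ on $E$, such that $\{f(z)z^n: n=0,1,2,\dots \}$ has a dense linear span in $\ell^2_A(\Omega)$. Moreover, $f$ can be chosen to have an analytic continuation to a neighbourhood of every point of $\mathbb{T} \setminus E$. (iii) For any $h \in \ell_A^2(\Omega)$ and any $g\in C(E)$, there exist analytic polynomials $(Q_n)_n$ such that $$\|Q_n-h\|_{\ell^2(\Omega)} + \sup_{\zeta \in E} |Q_n(\zeta)-g(\zeta)| \to 0 \quad\text{as } n\to\infty.$$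
   Context: $\mathbb{T}$ is the unit circle, $\mathbb{D}$ the unit disc. A weight is a non-negative continuously differentiable function $W$ on $(0,1]$ which is integrable on $[0,1]$ with respect to Lebesgue measure. Its associated moment sequence is $\omega(n)=\int_0^1 r^n W(1-r)\,dr$, $n=0,1,2,\dots$. The conditions on $W$ are: $(C_1)$ $W$ is either monotone non-decreasing or monotone non-increasing; $(C_2)$ $\int_0^1 \frac{W(t)}{t}\,dt=+\infty$; $(C_3)$ there is a constant $0<c<2$, depending only on $W$, such that $W(t)\leq c\,W(t/2)$ for all $0<t<1$. For a positive finite Borel measure $\mu$ on $\mathbb{T}$, its $\omega$-energy is $\mathcal{E}_\omega(\mu)=\sum_{n\in\mathbb{Z}}\omega(|n|)|\widehat\mu(n)|^2\in(0,\infty]$, where $\widehat\mu(n)=\int_{\mathbb{T}}\zeta^{-n}d\mu(\zeta)$. For compact $E\subset\mathbb{T}$, $\operatorname{Cap}_\omega(E)=\sup_\mu 1/\mathcal{E}_\omega(\mu)$, the supremum over probability measures $\mu$ supported on $E$ (with $1/\infty=0$); $E$ has zero $\omega$-capacity if $\operatorname{Cap}_\omega(E)=0$, i.e. every probability measure supported on $E$ has infinite $\omega$-energy. $\ell^2(\Omega)$ is the Hilbert space of $f\in L^2(\mathbb{T})$ with $\|f\|_{\ell^2(\Omega)}^2=\sum_{n\in\mathbb{Z}}|\widehat f(n)|^2\Omega(|n|)<\infty$. $\ell^2_A(\Omega)=\{f\in\ell^2(\Omega):\widehat f(n)=0 \text{ for } n<0\}$, whose elements are identified with their analytic (Poisson)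 extensions to $\mathbb{D}$. $C_A(\mathbb{T})$ is the space of continuous functions on $\mathbb{T}$ whose Poisson extension to $\mathbb{D}$ is analytic. $C(E)$ is the space of continuous complex-valued functions on $E$. Analytic polynomials are polynomials in $z$. *)

theory Defs
  imports
    "HOL-Probability.Probability_Measure"
    "HOL-Computational_Algebra.Polynomial"
    "HOL-Library.Function_Algebras"
begin

section \<open>Weights and moment sequences\<close>

text \<open>A weight lives on \<open>(0,1]\<close>: the values of \<^term>\<open>W :: real \<Rightarrow> real\<close> elsewhere are never used, and
  the derivative at \<open>1\<close> is one-sided.\<close>

definition weight :: "(real \<Rightarrow> real) \<Rightarrow> bool" where
  "weight W \<longleftrightarrow>
     (\<forall>t\<in>{0<..1}. 0 \<le> W t) \<and>
     (\<exists>W'. (\<forall>t\<in>{0<..1}. (W has_real_derivative W' t) (at t within {0<..1})) \<and>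
           continuous_on {0<..1} W') \<and>
     set_integrable lborel {0<..1} W"

definition cond_C1 :: "(real \<Rightarrow> real) \<Rightarrow> bool" where
  "cond_C1 W \<longleftrightarrow> mono_on {0<..1} W \<or> antimono_on {0<..1} W"

definition cond_C2 :: "(real \<Rightarrow> real) \<Rightarrow> bool" where
  "cond_C2 W \<longleftrightarrow> (\<integral>\<^sup>+t\<in>{0<..1}. ennreal (W t / t) \<partial>lborel) = \<infinity>"

definition cond_C3 :: "(real \<Rightarrow> real) \<Rightarrow> bool" where
  "cond_C3 W \<longleftrightarrow> (\<exists>c. 0 < c \<and> c < 2 \<and> (\<forall>t. 0 < t \<and> t < 1 \<longrightarrow> W t \<le> c * W (t / 2)))"

definition moment_seq :: "(real \<Rightarrow> real) \<Rightarrow> nat \<Rightarrow> real" where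
  "moment_seq W n = (LINT r:{0..<1}|lborel. r ^ n * W (1 - r))"


section \<open>Energy and capacity on the unit circle\<close>

abbreviation unit_circle :: "complex set" where
  "unit_circle \<equiv> sphere 0 1"

abbreviation unit_disc :: "complex set" where
  "unit_disc \<equiv> ball 0 1"

text \<open>\<open>E\<close> is compact in all uses, so the closed support of \<open>\<mu>\<close> lies in \<open>E\<close> iff the complement of \<open>E\<close> is
  a null set.\<close>

definition prob_measure_on :: "complex set \<Rightarrow> complex measure \<Rightarrow> bool" where
  "prob_measure_on E \<mu> \<longleftrightarrow>
     prob_space \<mu> \<and> sets \<mu> = sets (restrict_space borel unit_circle) \<and>
     emeasure \<mu> (unit_circle - E) = 0"

definition fourier_measure :: "complex measure \<Rightarrow> int \<Rightarrow> complex" where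
  "fourier_measure \<mu> n = (LINT \<zeta>|\<mu>. \<zeta> powi (- n))"

definition energy :: "(nat \<Rightarrow> real) \<Rightarrow> complex measure \<Rightarrow> ennreal" where
  "energy \<omega> \<mu> = (\<Sum>\<^sub>\<infinity>n::int. ennreal (\<omega> (nat \<bar>n\<bar>) * (cmod (fourier_measure \<mu> n))\<^sup>2))"

text \<open>In \<^typ>\<open>ennreal\<close> one has \<open>1 / \<infinity> = 0\<close>, and the supremum over the empty family (the case
  \<open>E = {}\<close>) is \<open>0\<close>.\<close>

definition capacity :: "(nat \<Rightarrow> real) \<Rightarrow> complex set \<Rightarrow> ennreal" where
  "capacity \<omega> E = (SUP \<mu>\<in>{\<mu>. prob_measure_on E \<mu>}. 1 / energy \<omega> \<mu>)"


section \<open>Function spaces on the unit circle\<close>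

text \<open>Functions on the circle are represented by \<^typ>\<open>complex \<Rightarrow> complex\<close>; only their values on
  the circle matter, and elements of \<open>L\<^sup>2\<close> are given by representatives.
  The following is normalised arc length.\<close>

definition circle_measure :: "complex measure" where
  "circle_measure =
     distr (uniform_measure lborel {0..2 * pi}) (restrict_space borel unit_circle) cis"

definition L2_circle :: "(complex \<Rightarrow> complex) set" where
  "L2_circle = {f. f \<in> borel_measurable circle_measure \<and>
                   integrable circle_measure (\<lambda>\<zeta>. (cmod (f \<zeta>))\<^sup>2)}"

definition fourier_coeff :: "(complex \<Rightarrow> complex) \<Rightarrow> int \<Rightarrow> complex" where
  "fourier_coeff f n = (LINT \<zeta>|circle_measure. \<zeta> powi (- n) * f \<zeta>)"

definition l2 :: "(nat \<Rightarrow> real) \<Rightarrow> (complex \<Rightarrow> complex) set" where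
  "l2 \<Omega> = {f \<in> L2_circle. (\<lambda>n::int. (cmod (fourier_coeff f n))\<^sup>2 * \<Omega> (nat \<bar>n\<bar>)) summable_on UNIV}"

text \<open>Meaningful for \<^term>\<open>f \<in> l2 \<Omega>\<close> only.\<close>

definition l2_norm :: "(nat \<Rightarrow> real) \<Rightarrow> (complex \<Rightarrow> complex) \<Rightarrow> real" where
  "l2_norm \<Omega> f = sqrt (\<Sum>\<^sub>\<infinity>n::int. (cmod (fourier_coeff f n))\<^sup>2 * \<Omega> (nat \<bar>n\<bar>))"

definition l2A :: "(nat \<Rightarrow> real) \<Rightarrow> (complex \<Rightarrow> complex) set" where
  "l2A \<Omega> = {f \<in> l2 \<Omega>. \<forall>n<0. fourier_coeff f n = 0}"

definition poisson :: "(complex \<Rightarrow> complex) \<Rightarrow> complex \<Rightarrow> complex" where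
  "poisson f z =
     (LINT \<zeta>|circle_measure. of_real ((1 - (cmod z)\<^sup>2) / (cmod (\<zeta> - z))\<^sup>2) * f \<zeta>)"

definition CA :: "(complex \<Rightarrow> complex) set" where
  "CA = {f. continuous_on unit_circle f \<and> poisson f holomorphic_on unit_disc}"

definition outer :: "(complex \<Rightarrow> complex) \<Rightarrow> bool" where
  "outer F \<longleftrightarrow>
     (\<exists>c \<phi>. cmod c = 1 \<and> (\<forall>\<zeta>\<in>unit_circle. 0 < \<phi> \<zeta>) \<and>
        \<phi> \<in> borel_measurable circle_measure \<and> integrable circle_measure (\<lambda>\<zeta>. ln (\<phi> \<zeta>)) \<and>
        (\<forall>z\<in>unit_disc.
           F z = c * exp (LINT \<zeta>|circle_measure. (\<zeta> + z) / (\<zeta> - z) * of_real (ln (\<phi> \<zeta>)))))"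

definition dense_in_l2A :: "(nat \<Rightarrow> real) \<Rightarrow> (complex \<Rightarrow> complex) set \<Rightarrow> bool" where
  "dense_in_l2A \<Omega> S \<longleftrightarrow>
     S \<subseteq> l2A \<Omega> \<and> (\<forall>h\<in>l2A \<Omega>. \<forall>\<epsilon>>0. \<exists>s\<in>S. l2_norm \<Omega> (\<lambda>\<zeta>. s \<zeta> - h \<zeta>) < \<epsilon>)"

text \<open>\<open>module.span\<close> needs addition of functions, which is the pointwise one of
  \<^theory>\<open>HOL-Library.Function_Algebras\<close>.\<close>

definition linear_span :: "(complex \<Rightarrow> complex) set \<Rightarrow> (complex \<Rightarrow> complex) set" where
  "linear_span = module.span (\<lambda>a f z. a * f z)"

lemma module_functions: "module (\<lambda>(a::complex) (f :: complex \<Rightarrow> complex) z. a * f z)"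
  by unfold_locales (auto simp: fun_eq_iff algebra_simps)

definition continues_analytically_at :: "(complex \<Rightarrow> complex) \<Rightarrow> complex \<Rightarrow> bool" where
  "continues_analytically_at F \<zeta> \<longleftrightarrow>
     (\<exists>U G. open U \<and> \<zeta> \<in> U \<and> G holomorphic_on U \<and> (\<forall>z\<in>U \<inter> unit_disc. G z = F z))"

end

theory Submission
  imports
    Defs
    "HOL-Complex_Analysis.Complex_Analysis"
    "HOL-Probability.Probability"
begin

text \<open>
  The moment conditions enter only through \<open>\<Omega> (2 n) \<le> C \<Omega> n\<close> with \<open>C < 4\<close>. This makes \<open>\<Omega> n\<close>
  comparable with a positive combination of averages of \<open>\<bar>cis (n t) - 1\<bar>\<^sup>2\<close> over small \<open>t\<close>, so the
  norm of \<open>\<Omega>\<close> is controlled by the differences \<open>h (cis t z) - h z\<close>, and contractions and products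
  of bounded functions operate on it.

  (i) implies (ii): \<open>H z = \<integral> W (1 - r) (1 + r z) / (1 - r z) dr\<close> has Taylor coefficients \<open>2 \<omega> n\<close>
  (and \<open>\<omega> 0\<close>), nonnegative real part on the disc, and extends across \<open>\<complex> - [1, \<infinity>)\<close>. If \<open>E\<close> has
  zero capacity, the energies of probability measures on \<open>E\<close> for the kernels \<open>Re (H (\<rho> z))\<close> tend to
  infinity as \<open>\<rho> \<rightarrow> 1\<close>. The normalised potential of a near-minimiser is a function \<open>F\<close> analytic
  beyond the closed disc, of small norm, with \<open>Re F \<ge> 0\<close>, \<open>Re F \<ge> 1\<close> on \<open>E\<close>, and small near
  points off \<open>E\<close>. Adding such functions \<open>F 0, F 1, \<dots>\<close> with summable norms,
  \<open>f = exp (- (\<Sum>k. F k))\<close> is the required outer function. It is cyclic because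
  \<open>f exp (\<Sum>k<N. F k) = exp (- (\<Sum>k\<ge>N. F k))\<close> tends to \<open>1\<close> in norm.

  (ii) implies (iii): the pairs \<open>(f p, 0)\<close> are limits of pairs \<open>(Q, Q restricted to E)\<close>, so by
  cyclicity every \<open>(h, 0)\<close> is one; polynomials are dense in \<open>C(E)\<close> by Stone--Weierstrass, since
  \<open>f = f 0 + z g\<close> vanishes on \<open>E\<close> and hence \<open>1 / z = - g / f 0\<close> there.

  (iii) implies (i): a probability measure of finite energy pairs continuously with the norm of \<open>\<Omega>\<close>, so
  \<open>Q k \<rightarrow> 0\<close> in norm and \<open>Q k \<rightarrow> 1\<close> uniformly on \<open>E\<close> contradict each other.
\<close>

section \<open>Fourier series on the circle\<close>

text \<open>The potential of a measure has Taylor coefficients of size at most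
  \<open>2 * \<omega> n\<close> times those of the measure, so in the weight
  \<open>1 / \<omega> n\<close> its squared norm is at most a multiple of the energy
  \<open>I\<close>. Dividing by \<open>I\<close> leaves a squared norm of order
  \<open>1 / I\<close>, while the real part stays of order 1 on \<open>E\<close>. No equilibrium
  measure is constructed: for \<open>\<rho> < 1\<close> the kernel is finite on the diagonal, so
  finitely many atoms and near-minimisers suffice, and each potential extends analytically across
  the circle. The obstacle to cyclicity is multiplication: a product is controlled only when both
  factors are also bounded. Hence \<open>exp (\<Sum>k<N. F k)\<close> is approximated by polynomials
  simultaneously in supremum and in weighted norm. The bound 4 on \<open>C\<close> comes from
  \<open>2 - 2 cos (n t)\<close>, which loses a factor 4 when a small \<open>t\<close> is halved,
  against a growth of \<open>\<Omega> n\<close> by at most \<open>C\<close> when \<open>n\<close> is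
  doubled. The substitution \<open>r = x^2\<close> in the moments gives
  \<open>C = 2 * max 1 c\<close>, below 4 because \<open>c < 2\<close>.\<close>

lemma cis_measurable:
  "cis \<in> uniform_measure lborel {0..2 * pi} \<rightarrow>\<^sub>M restrict_space borel unit_circle"
proof (rule measurable_restrict_space2)
  have "cis \<in> borel_measurable borel"
    by (intro borel_measurable_continuous_onI continuous_intros)
  then show "cis \<in> borel_measurable (uniform_measure lborel {0..2 * pi})"
    by (simp cong: measurable_cong_sets)
qed auto

lemma space_circle_measure [simp]: "space circle_measure = unit_circle"
  by (simp add: circle_measure_def)

lemma sets_circle_measure [measurable_cong]:
  "sets circle_measure = sets (restrict_space borel unit_circle)"
  by (simp add: circle_measure_def)

lemma prob_space_circle_measure: "prob_space circle_measure"
  unfolding circle_measure_def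
  by (rule prob_space.prob_space_distr[OF _ cis_measurable], rule prob_space_uniform_measure) auto

interpretation circle: prob_space circle_measure
  by (rule prob_space_circle_measure)

lemma borel_measurable_circle:
  fixes g :: "complex \<Rightarrow> 'a::real_normed_vector"
  assumes "continuous_on unit_circle g"
  shows "g \<in> borel_measurable circle_measure"
  using borel_measurable_continuous_on_restrict[OF assms]
  by (simp cong: measurable_cong_sets add: sets_circle_measure)

lemma bounded_on_circle:
  fixes g :: "complex \<Rightarrow> 'a::real_normed_vector"
  assumes "continuous_on unit_circle g"
  obtains B where "B > 0" "\<And>z. z \<in> unit_circle \<Longrightarrow> norm (g z) \<le> B"
proof -
  have "compact (g ` unit_circle)"
    by (intro compact_continuous_image assms compact_sphere)
  then show ?thesis
    using that by (auto dest!: compact_imp_bounded simp: bounded_pos)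
qed

lemma integrable_circle:
  fixes g :: "complex \<Rightarrow> 'a::{banach,second_countable_topology}"
  assumes "continuous_on unit_circle g"
  shows "integrable circle_measure g"
proof -
  obtain B where "\<And>z. z \<in> unit_circle \<Longrightarrow> norm (g z) \<le> B"
    using bounded_on_circle[OF assms] by metis
  then show ?thesis
    by (intro circle.integrable_const_bound[where B = B] borel_measurable_circle assms) auto
qed

lemma integrable_circle_mult:
  fixes g h :: "complex \<Rightarrow> complex"
  assumes "continuous_on unit_circle h" "integrable circle_measure g"
  shows "integrable circle_measure (\<lambda>\<zeta>. h \<zeta> * g \<zeta>)"
proof -
  obtain B where B: "\<And>z. z \<in> unit_circle \<Longrightarrow> norm (h z) \<le> B"
    using bounded_on_circle[OF assms(1)] by metis
  have [measurable]: "h \<in> borel_measurable circle_measure" "g \<in> borel_measurable circle_measure"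
    using assms by (auto intro: borel_measurable_circle)
  show ?thesis
  proof (rule Bochner_Integration.integrable_bound)
    show "integrable circle_measure (\<lambda>\<zeta>. B * norm (g \<zeta>))"
      using assms by auto
    show "AE \<zeta> in circle_measure. norm (h \<zeta> * g \<zeta>) \<le> norm (B * norm (g \<zeta>))"
      using B by (intro AE_I2) (auto simp: norm_mult intro: order_trans[OF mult_right_mono abs_ge_self])
  qed measurable
qed

lemma continuous_on_powi_circle [continuous_intros]:
  "continuous_on unit_circle (\<lambda>\<zeta>::complex. \<zeta> powi n)"
  by (intro continuous_intros) auto

lemma integral_circle_powi: "(LINT \<zeta>|circle_measure. \<zeta> powi n) = (if n = 0 then 1 else 0)"
proof (cases "n = 0")
  case True
  then show ?thesis using circle.prob_space by simp
next
  case False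
  have "(LINT \<zeta>|circle_measure. \<zeta> powi n) = (LINT t|uniform_measure lborel {0..2*pi}. cis t powi n)"
    unfolding circle_measure_def
    by (intro integral_distr cis_measurable borel_measurable_continuous_on_restrict continuous_intros) auto
  also have "\<dots> = (LINT t|density lborel (\<lambda>t. ennreal (indicator {0..2*pi} t / (2*pi))). cis t powi n)"
    unfolding uniform_measure_def
    by (intro arg_cong2[where f = lebesgue_integral] refl arg_cong2[where f = density] ext)
      (auto split: split_indicator simp flip: ennreal_divide_numeral simp: divide_ennreal[symmetric] ennreal_1[symmetric] simp del: ennreal_1)
  also have "\<dots> = (LINT t|lborel. (indicator {0..2*pi} t / (2*pi)) *\<^sub>R (cis t powi n))"
    unfolding cis_power_int
    by (intro integral_density) (auto intro!: borel_measurable_continuous_onI continuous_intros)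
  also have "\<dots> = (LINT t|lborel. indicator {0..2*pi} t *\<^sub>R (cis (n * t) / (2*pi)))"
    by (auto simp: cis_power_int scaleR_conv_of_real intro!: Bochner_Integration.integral_cong split: split_indicator)
  also have "\<dots> = cis (n * (2*pi)) / (2*pi * \<i> * n) - cis (n * (0::real)) / (2*pi * \<i> * n)"
    using False
    by (intro integral_FTC_atLeastAtMost)
      (auto intro!: derivative_eq_intros continuous_intros
        simp: has_vector_derivative_def fun_eq_iff field_simps scaleR_conv_of_real)
  also have "cis (n * (2*pi)) = 1"
    by (metis cis_multiple_2pi Ints_of_int mult.commute mult.left_commute)
  finally show ?thesis using False by simp
qed

text \<open>An absolutely convergent trigonometric series may be integrated termwise against
  \<open>g\<close>. The exponents \<open>k n\<close> are arbitrary integers, so the Cauchy kernel,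
  its conjugate and Taylor series on a circle are all instances.\<close>

lemma fourier_coeff_sums:
  fixes c :: "nat \<Rightarrow> complex"
  assumes g: "integrable circle_measure g" and c: "summable (\<lambda>n. norm (c n))"
  shows "(\<lambda>n. c n * fourier_coeff g (k n)) sums
    (LINT \<zeta>|circle_measure. (\<Sum>n. c n * \<zeta> powi (- k n)) * g \<zeta>)"
proof -
  have int: "integrable circle_measure (\<lambda>\<zeta>. \<zeta> powi m * g \<zeta>)" for m
    by (intro integrable_circle_mult g continuous_intros)
  have eq: "norm (c n * (\<zeta> powi (- k n) * g \<zeta>)) = norm (c n) * norm (g \<zeta>)" if "\<zeta> \<in> unit_circle" for n \<zeta>
    using that by (simp add: norm_mult norm_power_int)
  have sm: "summable (\<lambda>n. norm (c n * (\<zeta> powi (- k n) * g \<zeta>)))" if "\<zeta> \<in> unit_circle" for \<zeta>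
    using that by (simp only: eq) (intro summable_mult2 c)
  have "(\<lambda>n. LINT \<zeta>|circle_measure. c n * (\<zeta> powi (- k n) * g \<zeta>)) sums
      (LINT \<zeta>|circle_measure. (\<Sum>n. c n * (\<zeta> powi (- k n) * g \<zeta>)))"
  proof (rule sums_integral)
    show "integrable circle_measure (\<lambda>\<zeta>. c n * (\<zeta> powi - k n * g \<zeta>))" for n
      using int by simp
    show "AE \<zeta> in circle_measure. summable (\<lambda>n. norm (c n * (\<zeta> powi (- k n) * g \<zeta>)))"
      by (intro AE_I2) (simp add: sm)
    have "(LINT \<zeta>|circle_measure. norm (c n * (\<zeta> powi (- k n) * g \<zeta>)))
        = norm (c n) * (LINT \<zeta>|circle_measure. norm (g \<zeta>))" for n
      by (subst integral_mult_right_zero[symmetric], rule Bochner_Integration.integral_cong) (auto simp: eq)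
    then show "summable (\<lambda>n. LINT \<zeta>|circle_measure. norm (c n * (\<zeta> powi (- k n) * g \<zeta>)))"
      using c by (simp add: summable_mult2)
  qed
  moreover have "(LINT \<zeta>|circle_measure. (\<Sum>n. c n * (\<zeta> powi (- k n) * g \<zeta>)))
      = (LINT \<zeta>|circle_measure. (\<Sum>n. c n * \<zeta> powi (- k n)) * g \<zeta>)"
  proof (rule Bochner_Integration.integral_cong[OF refl])
    fix \<zeta> assume z: "\<zeta> \<in> space circle_measure"
    have "summable (\<lambda>n. c n * \<zeta> powi (- k n))"
      by (rule summable_norm_cancel) (use z c in \<open>simp add: norm_mult norm_power_int\<close>)
    from suminf_mult2[OF this, of "g \<zeta>"]
    show "(\<Sum>n. c n * (\<zeta> powi (- k n) * g \<zeta>)) = (\<Sum>n. c n * \<zeta> powi (- k n)) * g \<zeta>"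
      by (simp add: mult.assoc)
  qed
  ultimately show ?thesis
    by (simp add: fourier_coeff_def)
qed

lemma fourier_coeff_add:
  assumes "integrable circle_measure f" "integrable circle_measure g"
  shows "fourier_coeff (\<lambda>\<zeta>. f \<zeta> + g \<zeta>) n = fourier_coeff f n + fourier_coeff g n"
  unfolding fourier_coeff_def distrib_left
  by (intro Bochner_Integration.integral_add integrable_circle_mult continuous_intros assms)

lemma fourier_coeff_diff:
  assumes "integrable circle_measure f" "integrable circle_measure g"
  shows "fourier_coeff (\<lambda>\<zeta>. f \<zeta> - g \<zeta>) n = fourier_coeff f n - fourier_coeff g n"
  unfolding fourier_coeff_def right_diff_distrib
  by (intro Bochner_Integration.integral_diff integrable_circle_mult continuous_intros assms)

lemma fourier_coeff_cmult: "fourier_coeff (\<lambda>\<zeta>. c * f \<zeta>) n = c * fourier_coeff f n"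
proof -
  have "fourier_coeff (\<lambda>\<zeta>. c * f \<zeta>) n = (LINT \<zeta>|circle_measure. c * (\<zeta> powi (- n) * f \<zeta>))"
    by (simp add: fourier_coeff_def mult_ac)
  then show ?thesis
    by (simp add: fourier_coeff_def)
qed

lemma fourier_coeff_shift: "fourier_coeff (\<lambda>\<zeta>. \<zeta> * f \<zeta>) n = fourier_coeff f (n - 1)"
  unfolding fourier_coeff_def
proof (rule Bochner_Integration.integral_cong[OF refl])
  fix \<zeta> :: complex assume "\<zeta> \<in> space circle_measure"
  then have "\<zeta> \<noteq> 0" by auto
  then have "\<zeta> powi (- (n - 1)) = \<zeta> powi (- n) * \<zeta>"
    using power_int_add[of \<zeta> "- n" 1] by (simp add: algebra_simps)
  then show "\<zeta> powi - n * (\<zeta> * f \<zeta>) = \<zeta> powi - (n - 1) * f \<zeta>"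
    by simp
qed

lemma fourier_coeff_cnj: "fourier_coeff (\<lambda>\<zeta>. cnj (f \<zeta>)) n = cnj (fourier_coeff f (- n))"
  unfolding fourier_coeff_def Bochner_Integration.integral_cnj[symmetric]
proof (rule Bochner_Integration.integral_cong[OF refl])
  fix \<zeta> :: complex assume "\<zeta> \<in> space circle_measure"
  then have "inverse \<zeta> = cnj \<zeta>"
    by (simp add: inverse_complex_def complex_norm_square[symmetric] complex_eq_iff cmod_def)
  then have "cnj \<zeta> powi n = \<zeta> powi - n"
    by (metis power_int_minus power_int_inverse)
  then show "\<zeta> powi - n * cnj (f \<zeta>) = cnj (\<zeta> powi - (- n) * f \<zeta>)"
    by simp
qed

lemma fourier_coeff_powi: "fourier_coeff (\<lambda>\<zeta>. \<zeta> powi m) n = (if n = m then 1 else 0)"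
proof -
  have "fourier_coeff (\<lambda>\<zeta>. \<zeta> powi m) n = (LINT \<zeta>|circle_measure. \<zeta> powi (m - n))"
    unfolding fourier_coeff_def
  proof (rule Bochner_Integration.integral_cong[OF refl])
    fix \<zeta> :: complex assume "\<zeta> \<in> space circle_measure"
    then have "\<zeta> \<noteq> 0" by auto
    then show "\<zeta> powi - n * \<zeta> powi m = \<zeta> powi (m - n)"
      by (simp add: power_int_diff power_int_minus field_simps)
  qed
  then show ?thesis
    by (simp add: integral_circle_powi)
qed

section \<open>Cauchy and Poisson integrals\<close>

lemma unit_circle_ne: "\<zeta> \<in> unit_circle \<Longrightarrow> cmod z < 1 \<Longrightarrow> \<zeta> - z \<noteq> (0::complex)"
  by auto

lemma Cauchy_kernel_sums:
  assumes "\<zeta> \<in> unit_circle" "cmod z < 1"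
  shows "(\<lambda>n. z ^ n * \<zeta> powi (- int n)) sums (\<zeta> / (\<zeta> - z))"
proof -
  have nz: "\<zeta> \<noteq> 0" "\<zeta> - z \<noteq> 0" using assms unit_circle_ne by auto
  have "(\<lambda>n. (z / \<zeta>) ^ n) sums (1 / (1 - z / \<zeta>))"
    using assms by (intro geometric_sums) (simp add: norm_divide)
  moreover have "1 / (1 - z / \<zeta>) = \<zeta> / (\<zeta> - z)"
    using nz by (simp add: field_simps)
  moreover have "(z / \<zeta>) ^ n = z ^ n * \<zeta> powi (- int n)" for n
    by (simp add: power_divide power_int_minus field_simps)
  ultimately show ?thesis by simp
qed

lemma Cauchy_integral_sums:
  assumes "integrable circle_measure g" "cmod z < 1"
  shows "(\<lambda>n. z ^ n * fourier_coeff g (int n)) sums (LINT \<zeta>|circle_measure. \<zeta> / (\<zeta> - z) * g \<zeta>)"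
proof -
  have "(\<lambda>n. z ^ n * fourier_coeff g (int n)) sums
      (LINT \<zeta>|circle_measure. (\<Sum>n. z ^ n * \<zeta> powi (- int n)) * g \<zeta>)"
    by (rule fourier_coeff_sums) (use assms in \<open>auto simp: norm_power intro: summable_geometric\<close>)
  also have "(LINT \<zeta>|circle_measure. (\<Sum>n. z ^ n * \<zeta> powi (- int n)) * g \<zeta>)
      = (LINT \<zeta>|circle_measure. \<zeta> / (\<zeta> - z) * g \<zeta>)"
    using assms(2) by (intro Bochner_Integration.integral_cong refl arg_cong2[where f = "(*)"] sums_unique[symmetric]
      Cauchy_kernel_sums) auto
  finally show ?thesis .
qed

lemma conj_Cauchy_integral_sums:
  assumes "integrable circle_measure g" "cmod z < 1"
  shows "(\<lambda>n. cnj z ^ Suc n * fourier_coeff g (- int (Suc n))) sums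
    (LINT \<zeta>|circle_measure. cnj z * \<zeta> / (1 - cnj z * \<zeta>) * g \<zeta>)"
proof -
  have "(\<lambda>n. cnj z ^ Suc n * fourier_coeff g (- int (Suc n))) sums
      (LINT \<zeta>|circle_measure. (\<Sum>n. cnj z ^ Suc n * \<zeta> powi (- (- int (Suc n)))) * g \<zeta>)"
    by (rule fourier_coeff_sums[where k = "\<lambda>n. - int (Suc n)"])
      (use assms in \<open>auto simp: norm_power norm_mult intro!: summable_mult summable_geometric\<close>)
  also have "(LINT \<zeta>|circle_measure. (\<Sum>n. cnj z ^ Suc n * \<zeta> powi (- (- int (Suc n)))) * g \<zeta>)
      = (LINT \<zeta>|circle_measure. cnj z * \<zeta> / (1 - cnj z * \<zeta>) * g \<zeta>)"
  proof (intro Bochner_Integration.integral_cong refl arg_cong2[where f = "(*)"] sums_unique[symmetric])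
    fix \<zeta> assume z: "\<zeta> \<in> space circle_measure"
    have "(\<lambda>n. (cnj z * \<zeta>) * (cnj z * \<zeta>) ^ n) sums ((cnj z * \<zeta>) * (1 / (1 - cnj z * \<zeta>)))"
      using assms z by (intro sums_mult geometric_sums) (simp add: norm_mult)
    then show "(\<lambda>n. cnj z ^ Suc n * \<zeta> powi (- (- int (Suc n)))) sums (cnj z * \<zeta> / (1 - cnj z * \<zeta>))"
      by (simp add: power_mult_distrib mult_ac power_int_def nat_add_distrib)
  qed
  finally show ?thesis .
qed

text \<open>On the circle \<open>cnj \<zeta> = 1 / \<zeta>\<close>, which splits the Poisson kernel
  into a part analytic in \<open>z\<close> and an anti-analytic one. The second part meets only
  negative Fourier coefficients.\<close>

lemma Poisson_kernel_eq:
  assumes "\<zeta> \<in> unit_circle" "cmod z < 1"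
  shows "complex_of_real ((1 - (cmod z)\<^sup>2) / (cmod (\<zeta> - z))\<^sup>2) = \<zeta> / (\<zeta> - z) + cnj z * \<zeta> / (1 - cnj z * \<zeta>)"
proof -
  have zz: "\<zeta> * cnj \<zeta> = 1"
    using assms by (simp flip: complex_norm_square)
  have nz: "\<zeta> \<noteq> 0" "\<zeta> - z \<noteq> 0" "cnj \<zeta> - cnj z \<noteq> 0"
    using assms unit_circle_ne[OF assms] by (auto simp flip: complex_cnj_diff)
  have "1 - cnj z * \<zeta> = \<zeta> * (cnj \<zeta> - cnj z)"
    using zz by (simp add: algebra_simps)
  then have "\<zeta> / (\<zeta> - z) + cnj z * \<zeta> / (1 - cnj z * \<zeta>) = \<zeta> / (\<zeta> - z) + cnj z / (cnj \<zeta> - cnj z)"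
    using nz by simp
  also have "\<dots> = (\<zeta> * cnj \<zeta> - z * cnj z) / ((\<zeta> - z) * (cnj \<zeta> - cnj z))"
    using nz by (simp add: add_frac_eq) (simp add: algebra_simps)
  also have "\<dots> = complex_of_real ((1 - (cmod z)\<^sup>2) / (cmod (\<zeta> - z))\<^sup>2)"
    unfolding of_real_divide of_real_diff complex_norm_square zz by simp
  finally show ?thesis ..
qed

lemma continuous_on_Cauchy_kernel:
  "cmod z < 1 \<Longrightarrow> continuous_on unit_circle (\<lambda>\<zeta>. \<zeta> / (\<zeta> - z))"
  "cmod z < 1 \<Longrightarrow> continuous_on unit_circle (\<lambda>\<zeta>. cnj z * \<zeta> / (1 - cnj z * \<zeta>))"
proof -
  assume z: "cmod z < 1"
  show "continuous_on unit_circle (\<lambda>\<zeta>. \<zeta> / (\<zeta> - z))"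
    using z unit_circle_ne by (intro continuous_intros) auto
  have "cnj z * \<zeta> \<noteq> 1" if "\<zeta> \<in> unit_circle" for \<zeta>
  proof
    assume "cnj z * \<zeta> = 1"
    then have "cmod (cnj z * \<zeta>) = 1" by simp
    with that z show False by (simp add: norm_mult)
  qed
  then show "continuous_on unit_circle (\<lambda>\<zeta>. cnj z * \<zeta> / (1 - cnj z * \<zeta>))"
    by (intro continuous_intros) auto
qed

lemma poisson_eq_Cauchy:
  assumes "integrable circle_measure g" "cmod z < 1"
  shows "poisson g z = (LINT \<zeta>|circle_measure. \<zeta> / (\<zeta> - z) * g \<zeta>)
    + (LINT \<zeta>|circle_measure. cnj z * \<zeta> / (1 - cnj z * \<zeta>) * g \<zeta>)"
proof -
  have "poisson g z = (LINT \<zeta>|circle_measure. \<zeta> / (\<zeta> - z) * g \<zeta> + cnj z * \<zeta> / (1 - cnj z * \<zeta>) * g \<zeta>)"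
    unfolding poisson_def
    using assms(2)
    by (intro Bochner_Integration.integral_cong refl) (simp only: Poisson_kernel_eq space_circle_measure distrib_right)
  then show ?thesis
    by (simp only: Bochner_Integration.integral_add integrable_circle_mult[OF continuous_on_Cauchy_kernel(1)[OF assms(2)] assms(1)]
      integrable_circle_mult[OF continuous_on_Cauchy_kernel(2)[OF assms(2)] assms(1)])
qed

lemma poisson_analytic_sums:
  assumes "integrable circle_measure g" "cmod z < 1" "\<And>n. n < 0 \<Longrightarrow> fourier_coeff g n = 0"
  shows "(\<lambda>n. z ^ n * fourier_coeff g (int n)) sums poisson g z"
proof -
  have "(LINT \<zeta>|circle_measure. cnj z * \<zeta> / (1 - cnj z * \<zeta>) * g \<zeta>) = 0"
    using conj_Cauchy_integral_sums[OF assms(1,2)] assms(3) by (simp add: sums_iff)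
  then show ?thesis
    using Cauchy_integral_sums[OF assms(1,2)] poisson_eq_Cauchy[OF assms(1,2)] by simp
qed

text \<open>With \<open>c = 1\<close> this is the total mass of the Poisson kernel, as required for
  the approximate identity below; it is read off from the coefficient expansion.\<close>

lemma poisson_const: "cmod z < 1 \<Longrightarrow> poisson (\<lambda>_. c) z = c"
proof -
  assume z: "cmod z < 1"
  have fc: "fourier_coeff (\<lambda>_. c) n = (if n = 0 then c else 0)" for n
    using fourier_coeff_cmult[of c "\<lambda>\<zeta>. \<zeta> powi 0" n] by (simp only: fourier_coeff_powi) auto
  have "(\<lambda>n. z ^ n * fourier_coeff (\<lambda>_. c) (int n)) sums poisson (\<lambda>_. c) z"
    using z by (intro poisson_analytic_sums) (auto simp: fc)
  moreover have "(\<lambda>n. z ^ n * fourier_coeff (\<lambda>_. c) (int n)) sums (\<Sum>n\<in>{0}. z ^ n * fourier_coeff (\<lambda>_. c) (int n))"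
    by (intro sums_finite) (auto simp: fc)
  ultimately show ?thesis
    by (simp add: fc sums_unique2)
qed

lemma poisson_radial_uniform:
  assumes g: "continuous_on unit_circle g" and "\<epsilon> > 0"
  shows "eventually (\<lambda>r. \<forall>\<zeta>\<in>unit_circle. cmod (poisson g (of_real r * \<zeta>) - g \<zeta>) < \<epsilon>) (at_left 1)"
proof -
  have int: "integrable circle_measure g"
    by (rule integrable_circle[OF g])
  obtain M where "M > 0" and M: "\<And>\<zeta>. \<zeta> \<in> unit_circle \<Longrightarrow> cmod (g \<zeta>) \<le> M"
    using bounded_on_circle[OF g] by metis
  have "uniformly_continuous_on unit_circle g"
    by (intro compact_uniformly_continuous g compact_sphere)
  then obtain d where "d > 0" and
    d: "\<And>\<zeta> \<eta>. \<zeta> \<in> unit_circle \<Longrightarrow> \<eta> \<in> unit_circle \<Longrightarrow> dist \<eta> \<zeta> < d \<Longrightarrow> dist (g \<eta>) (g \<zeta>) < \<epsilon> / 3"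
    using \<open>\<epsilon> > 0\<close> unfolding uniformly_continuous_on_def by (metis divide_pos_pos zero_less_numeral)
  have "((\<lambda>r::real. (1 - r\<^sup>2) / (d / 2)\<^sup>2 * (2 * M)) \<longlongrightarrow> (1 - 1\<^sup>2) / (d / 2)\<^sup>2 * (2 * M)) (at_left 1)"
    using \<open>d > 0\<close> by (intro tendsto_intros) auto
  then have "eventually (\<lambda>r::real. (1 - r\<^sup>2) / (d / 2)\<^sup>2 * (2 * M) < \<epsilon> / 3) (at_left 1)"
    using \<open>\<epsilon> > 0\<close> by (intro order_tendstoD(2)) auto
  \<comment> \<open>This close to the boundary, a point at distance at least \<open>d\<close> from
    \<open>\<zeta>\<close> is still at distance \<open>d / 2\<close> from
    \<open>r * \<zeta>\<close>, so the kernel is at most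
    \<open>(1 - r\<^sup>2) / (d / 2)\<^sup>2\<close> there.\<close>
  moreover have "eventually (\<lambda>r::real. r \<in> {max 0 (1 - d / 2)<..<1}) (at_left 1)"
    using \<open>d > 0\<close> by (intro eventually_at_left_real) auto
  ultimately show ?thesis
  proof eventually_elim
    case (elim r)
    then have r: "0 < r" "r < 1" "1 - r < d / 2" by auto
    show ?case
    proof
      fix \<zeta> assume \<zeta>: "\<zeta> \<in> unit_circle"
      let ?z = "of_real r * \<zeta>"
      have nz: "cmod ?z = r" using \<zeta> r by (simp add: norm_mult)
      define P where "P \<eta> = (1 - (cmod ?z)\<^sup>2) / (cmod (\<eta> - ?z))\<^sup>2" for \<eta>
      have Ppos: "0 \<le> P \<eta>" for \<eta>
        using r nz by (simp add: P_def power_le_one)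
      have Pcont: "continuous_on unit_circle P"
        unfolding P_def using r nz by (intro continuous_intros) auto
      have "(LINT \<eta>|circle_measure. complex_of_real (P \<eta>)) = 1"
        using poisson_const[of ?z 1] nz r by (simp add: poisson_def P_def)
      then have P1: "(LINT \<eta>|circle_measure. P \<eta>) = 1"
        by simp
      have intP: "integrable circle_measure (\<lambda>\<eta>. of_real (P \<eta>) * h \<eta>)"
        if "continuous_on unit_circle h" for h :: "complex \<Rightarrow> complex"
        by (intro integrable_circle continuous_intros that Pcont)
      have "poisson g ?z - g \<zeta> = poisson g ?z - poisson (\<lambda>_. g \<zeta>) ?z"
        using poisson_const[of ?z "g \<zeta>"] nz r by simp
      also have "\<dots> = (LINT \<eta>|circle_measure. of_real (P \<eta>) * (g \<eta> - g \<zeta>))"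
        unfolding poisson_def P_def[symmetric] right_diff_distrib
        by (intro Bochner_Integration.integral_diff[symmetric] intP g continuous_intros)
      finally have "cmod (poisson g ?z - g \<zeta>) \<le> (LINT \<eta>|circle_measure. cmod (of_real (P \<eta>) * (g \<eta> - g \<zeta>)))"
        by (simp only: integral_norm_bound)
      also have "\<dots> \<le> (LINT \<eta>|circle_measure. \<epsilon> / 3 * P \<eta> + (1 - r\<^sup>2) / (d / 2)\<^sup>2 * (2 * M))"
      proof (intro integral_mono integrable_norm intP continuous_intros g integrable_circle Pcont)
        fix \<eta> assume \<eta>: "\<eta> \<in> space circle_measure"
        have e: "cmod (of_real (P \<eta>) * (g \<eta> - g \<zeta>)) = P \<eta> * cmod (g \<eta> - g \<zeta>)"
          using Ppos by (simp add: norm_mult)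
        have nn: "0 \<le> (1 - r\<^sup>2) / (d / 2)\<^sup>2 * (2 * M)"
          using r \<open>M > 0\<close> by (simp add: power_le_one)
        show "cmod (of_real (P \<eta>) * (g \<eta> - g \<zeta>)) \<le> \<epsilon> / 3 * P \<eta> + (1 - r\<^sup>2) / (d / 2)\<^sup>2 * (2 * M)"
        proof (cases "dist \<eta> \<zeta> < d")
          case True
          then have "cmod (g \<eta> - g \<zeta>) \<le> \<epsilon> / 3"
            using d[of \<zeta> \<eta>] \<eta> \<zeta> by (simp add: dist_norm)
          then have "P \<eta> * cmod (g \<eta> - g \<zeta>) \<le> P \<eta> * (\<epsilon> / 3)"
            using Ppos by (intro mult_left_mono)
          then show ?thesis using e nn by (simp add: mult.commute)
        next
          case False
          have "dist \<eta> \<zeta> \<le> cmod (\<eta> - ?z) + cmod (\<zeta> - ?z)"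
            by (metis dist_norm dist_triangle2)
          moreover have "cmod (\<zeta> - ?z) = 1 - r"
          proof -
            have "\<zeta> - ?z = of_real (1 - r) * \<zeta>" by (simp add: algebra_simps)
            then show ?thesis using \<zeta> r by (simp only: norm_mult norm_of_real) simp
          qed
          ultimately have "cmod (\<eta> - ?z) \<ge> d / 2"
            using False r by simp
          then have "P \<eta> \<le> (1 - r\<^sup>2) / (d / 2)\<^sup>2"
            unfolding P_def nz using r \<open>d > 0\<close>
            by (intro divide_left_mono power_mono mult_pos_pos zero_less_power) (auto simp: power_le_one)
          moreover have "cmod (g \<eta> - g \<zeta>) \<le> 2 * M"
            using M[of \<eta>] M[of \<zeta>] \<eta> \<zeta> norm_triangle_ineq4[of "g \<eta>" "g \<zeta>"] by simp
          ultimately have "P \<eta> * cmod (g \<eta> - g \<zeta>) \<le> (1 - r\<^sup>2) / (d / 2)\<^sup>2 * (2 * M)"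
            using Ppos[of \<eta>] r by (intro mult_mono) (auto simp: power_le_one)
          then show ?thesis using e Ppos[of \<eta>] \<open>\<epsilon> > 0\<close> by (simp add: add_increasing)
        qed
      qed
      also have "\<dots> = \<epsilon> / 3 + (1 - r\<^sup>2) / (d / 2)\<^sup>2 * (2 * M)"
        using integrable_circle[OF Pcont] P1 circle.prob_space by simp
      also have "\<dots> < \<epsilon>" using elim \<open>\<epsilon> > 0\<close> by simp
      finally show "cmod (poisson g ?z - g \<zeta>) < \<epsilon>" .
    qed
  qed
qed

section \<open>Taylor coefficients and the disc algebra\<close>

definition taylor :: "(complex \<Rightarrow> complex) \<Rightarrow> nat \<Rightarrow> complex" where
  "taylor f n = (deriv ^^ n) f 0 / fact n"

lemma taylor_sums:
  "f holomorphic_on ball 0 R \<Longrightarrow> cmod z < R \<Longrightarrow> (\<lambda>n. taylor f n * z ^ n) sums f z"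
  using holomorphic_power_series[of f 0 R z] by (simp add: taylor_def)

lemma taylor_unique:
  assumes "R > 0" "\<And>z. cmod z < R \<Longrightarrow> (\<lambda>n. c n * z ^ n) sums f z"
  shows "taylor f n = c n"
proof -
  have "f has_fps_expansion Abs_fps c"
    by (rule has_fps_expansionI)
      (use assms in \<open>auto simp: eventually_nhds_metric dist_norm intro!: exI[of _ R]\<close>)
  then show ?thesis
    using fps_nth_fps_expansion[of f "Abs_fps c" n] by (simp add: taylor_def)
qed

lemma summable_taylor_norm:
  assumes "f holomorphic_on ball 0 R" "0 \<le> r" "r < R"
  shows "summable (\<lambda>n. cmod (taylor f n) * r ^ n)"
proof -
  obtain s where s: "r < s" "s < R" using assms dense by blast
  then have "summable (\<lambda>n. taylor f n * of_real s ^ n)"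
    using taylor_sums[OF assms(1), of "of_real s"] assms by (auto simp: sums_iff)
  then have "summable (\<lambda>n. norm (taylor f n * of_real r ^ n))"
    using s assms by (intro powser_insidea) auto
  then show ?thesis using assms by (simp add: norm_mult norm_power)
qed

lemma fourier_coeff_dilation:
  assumes f: "f holomorphic_on ball 0 R" and r: "0 < r" "r < R"
  shows "fourier_coeff (\<lambda>\<zeta>. f (of_real r * \<zeta>)) n =
    (if n < 0 then 0 else taylor f (nat n) * of_real r ^ nat n)"
proof -
  define c where "c m = taylor f m * of_real r ^ m" for m
  have c: "summable (\<lambda>m. norm (c m))"
    using summable_taylor_norm[OF f, of r] r by (simp add: c_def norm_mult norm_power)
  \<comment> \<open>The roles are exchanged: the Taylor series of \<open>f\<close> is the summable
    factor, and the monomial \<open>\<zeta> powi (- n)\<close> is the function whose coefficients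
    are taken.\<close>
  have "(\<lambda>m. c m * fourier_coeff (\<lambda>\<zeta>. \<zeta> powi (- n)) (- int m)) sums
      (LINT \<zeta>|circle_measure. (\<Sum>m. c m * \<zeta> powi (- (- int m))) * \<zeta> powi (- n))"
    by (intro fourier_coeff_sums integrable_circle continuous_intros c)
  also have "(LINT \<zeta>|circle_measure. (\<Sum>m. c m * \<zeta> powi (- (- int m))) * \<zeta> powi (- n))
      = fourier_coeff (\<lambda>\<zeta>. f (of_real r * \<zeta>)) n"
    unfolding fourier_coeff_def
  proof (rule Bochner_Integration.integral_cong[OF refl])
    fix \<zeta> assume "\<zeta> \<in> space circle_measure"
    then have "(\<lambda>n. taylor f n * (of_real r * \<zeta>) ^ n) sums f (of_real r * \<zeta>)"
      using r by (intro taylor_sums[OF f]) (simp add: norm_mult)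
    then have "(\<Sum>m. c m * \<zeta> powi (- (- int m))) = f (of_real r * \<zeta>)"
      by (simp add: c_def power_mult_distrib mult.assoc sums_iff)
    then show "(\<Sum>m. c m * \<zeta> powi (- (- int m))) * \<zeta> powi - n = \<zeta> powi - n * f (of_real r * \<zeta>)"
      by simp
  qed
  finally have s: "(\<lambda>m. c m * (if int m = n then 1 else 0)) sums fourier_coeff (\<lambda>\<zeta>. f (of_real r * \<zeta>)) n"
    by (simp add: fourier_coeff_powi)
  show ?thesis
  proof (cases "n < 0")
    case True
    then have "(\<lambda>m. c m * (if int m = n then 1 else 0)) = (\<lambda>m. 0)" by (auto simp: fun_eq_iff)
    with s True show ?thesis by (simp add: sums_iff)
  next
    case False
    have "(\<lambda>m. c m * (if int m = n then 1 else 0)) sums (\<Sum>m\<in>{nat n}. c m * (if int m = n then 1 else 0))"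
      by (intro sums_finite) auto
    then show ?thesis using s False by (auto simp: c_def dest: sums_unique2)
  qed
qed

text \<open>The Taylor series of \<open>f\<close> need not converge on the circle itself. Hence the
  coefficients are computed for dilations by \<open>r k < 1\<close> and passed to the limit by
  dominated convergence, \<open>f\<close> being bounded on the closed disc.\<close>

lemma fourier_coeff_disc_algebra:
  assumes cont: "continuous_on (cball 0 1) f" and holo: "f holomorphic_on ball 0 1"
  shows "fourier_coeff f n = (if n < 0 then 0 else taylor f (nat n))"
proof -
  define r where "r k = 1 - 1 / real (Suc (Suc k))" for k
  have r: "0 < r k" "r k < 1" for k
    by (auto simp: r_def field_simps)
  have rlim: "r \<longlonglongrightarrow> 1"
    unfolding r_def using tendsto_diff[OF tendsto_const LIMSEQ_Suc[OF LIMSEQ_inverse_real_of_nat]]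
    by (force simp: inverse_eq_divide)
  have "compact (f ` cball 0 1)"
    by (intro compact_continuous_image cont compact_cball)
  then obtain M where "\<forall>y\<in>f ` cball 0 1. cmod y \<le> M"
    using compact_imp_bounded bounded_iff by metis
  then have M: "cmod (f z) \<le> M" if "z \<in> cball 0 1" for z
    using that by blast
  have inb: "of_real (r k) * \<zeta> \<in> cball 0 1" if "\<zeta> \<in> unit_circle" for k and \<zeta> :: complex
    using r[of k] that by (auto simp: norm_mult)
  have "(\<lambda>k. fourier_coeff (\<lambda>\<zeta>. f (of_real (r k) * \<zeta>)) n) \<longlonglongrightarrow> fourier_coeff f n"
    unfolding fourier_coeff_def
  proof (rule integral_dominated_convergence[where w = "\<lambda>_. M"])
    show "(\<lambda>\<zeta>. \<zeta> powi - n * f \<zeta>) \<in> borel_measurable circle_measure"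
      by (intro borel_measurable_circle continuous_intros continuous_on_subset[OF cont]) auto
    show "(\<lambda>\<zeta>. \<zeta> powi - n * f (of_real (r k) * \<zeta>)) \<in> borel_measurable circle_measure" for k
      by (intro borel_measurable_circle continuous_intros continuous_on_compose2[OF cont]) (use inb in auto)
    show "AE \<zeta> in circle_measure. (\<lambda>k. \<zeta> powi - n * f (of_real (r k) * \<zeta>)) \<longlonglongrightarrow> \<zeta> powi - n * f \<zeta>"
    proof (intro AE_I2 tendsto_mult tendsto_const)
      fix \<zeta> assume z: "\<zeta> \<in> space circle_measure"
      have "(\<lambda>k. of_real (r k) * \<zeta>) \<longlonglongrightarrow> of_real 1 * \<zeta>"
        by (intro tendsto_intros rlim)
      then show "(\<lambda>k. f (of_real (r k) * \<zeta>)) \<longlonglongrightarrow> f \<zeta>"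
        using z inb by (intro continuous_on_tendsto_compose[OF cont]) auto
    qed
    show "AE \<zeta> in circle_measure. norm (\<zeta> powi - n * f (of_real (r k) * \<zeta>)) \<le> M" for k
      using M inb by (intro AE_I2) (auto simp: norm_mult norm_power_int)
  qed auto
  moreover have "(\<lambda>k. fourier_coeff (\<lambda>\<zeta>. f (of_real (r k) * \<zeta>)) n) \<longlonglongrightarrow>
      (if n < 0 then 0 else taylor f (nat n) * of_real 1 ^ nat n)"
    unfolding fourier_coeff_dilation[OF holo r]
    by (cases "n < 0") (auto intro!: tendsto_eq_intros rlim)
  ultimately show ?thesis
    using LIMSEQ_unique by fastforce
qed

lemma poisson_disc_algebra:
  assumes cont: "continuous_on (cball 0 1) f" and holo: "f holomorphic_on ball 0 1" and z: "cmod z < 1"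
  shows "poisson f z = f z"
proof -
  have "(\<lambda>n. z ^ n * fourier_coeff f (int n)) sums poisson f z"
    using z by (intro poisson_analytic_sums integrable_circle continuous_on_subset[OF cont])
      (auto simp: fourier_coeff_disc_algebra[OF cont holo])
  moreover have "(\<lambda>n. taylor f n * z ^ n) sums f z"
    using z by (rule taylor_sums[OF holo])
  ultimately show ?thesis
    by (simp add: fourier_coeff_disc_algebra[OF cont holo] mult.commute sums_unique2)
qed

lemma disc_algebra_CA:
  assumes cont: "continuous_on (cball 0 1) f" and holo: "f holomorphic_on ball 0 1"
  shows "f \<in> CA"
proof -
  have "poisson f holomorphic_on ball 0 1 \<longleftrightarrow> f holomorphic_on ball 0 1"
    by (intro holomorphic_cong refl) (simp add: poisson_disc_algebra[OF assms])
  then show ?thesis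
    using holo continuous_on_subset[OF cont] by (auto simp: CA_def)
qed

text \<open>\<open>(\<zeta> + z) / (\<zeta> - z) = 2 * (\<zeta> / (\<zeta> - z)) - 1\<close> and
  \<open>Re F = (F + cnj F) / 2\<close>. The Cauchy integral reproduces \<open>F\<close>, and of
  \<open>cnj F\<close>, which has no positive frequencies, it keeps only \<open>cnj (F 0)\<close>.
  The remaining constant is \<open>- \<i> * Im (F 0)\<close>, hence the normalisation.\<close>

lemma Herglotz:
  assumes cont: "continuous_on (cball 0 1) F" and holo: "F holomorphic_on ball 0 1"
    and "Im (F 0) = 0" and z: "cmod z < 1"
  shows "(LINT \<zeta>|circle_measure. (\<zeta> + z) / (\<zeta> - z) * of_real (Re (F \<zeta>))) = F z"
proof -
  have cF: "continuous_on unit_circle F" by (rule continuous_on_subset[OF cont]) auto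
  have ccF: "continuous_on unit_circle (\<lambda>\<zeta>. cnj (F \<zeta>))" by (intro continuous_intros cF)
  have "(\<lambda>n. z ^ n * fourier_coeff F (int n)) sums (LINT \<zeta>|circle_measure. \<zeta> / (\<zeta> - z) * F \<zeta>)"
    by (rule Cauchy_integral_sums[OF integrable_circle[OF cF] z])
  moreover have "(\<lambda>n. taylor F n * z ^ n) sums F z"
    using z by (rule taylor_sums[OF holo])
  ultimately have 1: "(LINT \<zeta>|circle_measure. \<zeta> / (\<zeta> - z) * F \<zeta>) = F z"
    by (simp add: fourier_coeff_disc_algebra[OF cont holo] mult.commute sums_unique2)
  have F0: "taylor F 0 = F 0" by (simp add: taylor_def)
  have "(\<lambda>n. z ^ n * fourier_coeff (\<lambda>\<zeta>. cnj (F \<zeta>)) (int n)) sums (LINT \<zeta>|circle_measure. \<zeta> / (\<zeta> - z) * cnj (F \<zeta>))"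
    by (rule Cauchy_integral_sums[OF integrable_circle[OF ccF] z])
  moreover have "(\<lambda>n. z ^ n * fourier_coeff (\<lambda>\<zeta>. cnj (F \<zeta>)) (int n)) sums
     (\<Sum>n\<in>{0}. z ^ n * fourier_coeff (\<lambda>\<zeta>. cnj (F \<zeta>)) (int n))"
    by (intro sums_finite) (auto simp: fourier_coeff_cnj fourier_coeff_disc_algebra[OF cont holo])
  ultimately have 2: "(LINT \<zeta>|circle_measure. \<zeta> / (\<zeta> - z) * cnj (F \<zeta>)) = cnj (F 0)"
    by (simp add: fourier_coeff_cnj fourier_coeff_disc_algebra[OF cont holo] sums_unique2 F0)
  have 3: "(LINT \<zeta>|circle_measure. F \<zeta>) = F 0" "(LINT \<zeta>|circle_measure. cnj (F \<zeta>)) = cnj (F 0)"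
    using fourier_coeff_disc_algebra[OF cont holo, of 0] fourier_coeff_cnj[of F 0] F0
    by (auto simp: fourier_coeff_def)
  have "(LINT \<zeta>|circle_measure. (\<zeta> + z) / (\<zeta> - z) * of_real (Re (F \<zeta>)))
     = (LINT \<zeta>|circle_measure. (\<zeta> / (\<zeta> - z) * F \<zeta> + \<zeta> / (\<zeta> - z) * cnj (F \<zeta>)) - (F \<zeta> + cnj (F \<zeta>)) / 2)"
  proof (rule Bochner_Integration.integral_cong[OF refl])
    fix \<zeta> assume "\<zeta> \<in> space circle_measure"
    then have nz: "\<zeta> - z \<noteq> 0" using z unit_circle_ne by auto
    have re: "of_real (Re (F \<zeta>)) = (F \<zeta> + cnj (F \<zeta>)) / 2"
      by (simp add: complex_add_cnj)
    have k: "(\<zeta> + z) / (\<zeta> - z) = 2 * (\<zeta> / (\<zeta> - z)) - 1"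
      using nz by (simp add: field_simps)
    have "(2 * k - 1) * ((a + b) / 2) = k * a + k * b - (a + b) / 2" for a b k :: complex
      by (simp add: field_simps)
    then show "(\<zeta> + z) / (\<zeta> - z) * of_real (Re (F \<zeta>))
        = (\<zeta> / (\<zeta> - z) * F \<zeta> + \<zeta> / (\<zeta> - z) * cnj (F \<zeta>)) - (F \<zeta> + cnj (F \<zeta>)) / 2"
      unfolding re k .
  qed
  also have "\<dots> = F z + cnj (F 0) - (F 0 + cnj (F 0)) / 2"
  proof -
    have i: "integrable circle_measure (\<lambda>\<zeta>. \<zeta> / (\<zeta> - z) * F \<zeta>)" "integrable circle_measure (\<lambda>\<zeta>. \<zeta> / (\<zeta> - z) * cnj (F \<zeta>))"
      "integrable circle_measure F" "integrable circle_measure (\<lambda>\<zeta>. cnj (F \<zeta>))"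
      by (intro integrable_circle continuous_on_mult continuous_on_Cauchy_kernel z cF ccF)+
    have "integrable circle_measure (\<lambda>\<zeta>. (F \<zeta> + cnj (F \<zeta>)) / 2)"
      using i by auto
    then show ?thesis
      by (simp only: Bochner_Integration.integral_diff Bochner_Integration.integral_add
        Bochner_Integration.integrable_add i 1 2 3 integral_divide_zero)
  qed
  also have "\<dots> = F z"
    using assms(3) by (simp add: complex_eq_iff)
  finally show ?thesis .
qed

section \<open>Parseval's formula and weighted coefficient norms\<close>

text \<open>Strictly inside the disc of holomorphy the conjugate Taylor series converges absolutely,
  and it is integrated termwise against \<open>f\<close> itself.\<close>

lemma Parseval_taylor:
  assumes f: "f holomorphic_on ball 0 R" and r: "0 < r" "r < R"
  shows "(\<lambda>n. (cmod (taylor f n))\<^sup>2 * r ^ (2 * n)) sums (LINT \<zeta>|circle_measure. (cmod (f (of_real r * \<zeta>)))\<^sup>2)"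
proof -
  define c where "c n = taylor f n * of_real r ^ n" for n
  have sc: "summable (\<lambda>n. norm (c n))"
    using summable_taylor_norm[OF f, of r] r by (simp add: c_def norm_mult norm_power)
  then have scc: "summable (\<lambda>n. norm (cnj (c n)))" by simp
  have cont: "continuous_on unit_circle (\<lambda>\<zeta>. f (of_real r * \<zeta>))"
    using r by (intro continuous_on_compose2[OF holomorphic_on_imp_continuous_on[OF f]] continuous_intros)
      (auto simp: norm_mult)
  have "(\<lambda>n. cnj (c n) * fourier_coeff (\<lambda>\<zeta>. f (of_real r * \<zeta>)) (int n)) sums
     (LINT \<zeta>|circle_measure. (\<Sum>n. cnj (c n) * \<zeta> powi (- int n)) * f (of_real r * \<zeta>))"
    by (rule fourier_coeff_sums[OF integrable_circle[OF cont] scc])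
  also have "(LINT \<zeta>|circle_measure. (\<Sum>n. cnj (c n) * \<zeta> powi (- int n)) * f (of_real r * \<zeta>))
     = (LINT \<zeta>|circle_measure. of_real ((cmod (f (of_real r * \<zeta>)))\<^sup>2))"
  proof (rule Bochner_Integration.integral_cong[OF refl])
    fix \<zeta> assume z: "\<zeta> \<in> space circle_measure"
    then have "inverse \<zeta> = cnj \<zeta>"
      by (simp add: inverse_complex_def complex_norm_square[symmetric] complex_eq_iff cmod_def)
    then have "\<zeta> powi (- int n) = cnj \<zeta> ^ n" for n
      by (metis power_int_minus power_int_of_nat power_inverse)
    moreover have "(\<lambda>n. taylor f n * (of_real r * \<zeta>) ^ n) sums f (of_real r * \<zeta>)"
      using r z by (intro taylor_sums[OF f]) (simp add: norm_mult)
    then have "(\<lambda>n. cnj (taylor f n * (of_real r * \<zeta>) ^ n)) sums cnj (f (of_real r * \<zeta>))"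
      by (simp only: sums_cnj)
    ultimately have "(\<lambda>n. cnj (c n) * \<zeta> powi (- int n)) sums cnj (f (of_real r * \<zeta>))"
      by (simp add: c_def power_mult_distrib mult_ac)
    then show "(\<Sum>n. cnj (c n) * \<zeta> powi (- int n)) * f (of_real r * \<zeta>) = of_real ((cmod (f (of_real r * \<zeta>)))\<^sup>2)"
      unfolding complex_norm_square by (simp add: sums_iff mult.commute)
  qed
  also have "(\<lambda>n. cnj (c n) * fourier_coeff (\<lambda>\<zeta>. f (of_real r * \<zeta>)) (int n))
      = (\<lambda>n. of_real ((cmod (taylor f n))\<^sup>2 * r ^ (2 * n)))"
  proof
    fix n
    have "cnj (c n) * fourier_coeff (\<lambda>\<zeta>. f (of_real r * \<zeta>)) (int n) = c n * cnj (c n)"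
      by (simp add: fourier_coeff_dilation[OF f r] c_def)
    also have "\<dots> = of_real ((cmod (c n))\<^sup>2)"
      by (simp only: complex_norm_square)
    also have "(cmod (c n))\<^sup>2 = (cmod (taylor f n))\<^sup>2 * r ^ (2 * n)"
      using r by (simp add: c_def norm_mult norm_power power_mult_distrib power_mult mult.commute[of 2])
    finally show "cnj (c n) * fourier_coeff (\<lambda>\<zeta>. f (of_real r * \<zeta>)) (int n) = of_real ((cmod (taylor f n))\<^sup>2 * r ^ (2 * n))" .
  qed
  finally show ?thesis
    by (simp only: integral_complex_of_real sums_of_real_iff)
qed

definition wsummable :: "(nat \<Rightarrow> real) \<Rightarrow> (nat \<Rightarrow> complex) \<Rightarrow> bool" where
  "wsummable \<Omega> c \<longleftrightarrow> summable (\<lambda>n. \<Omega> n * (cmod (c n))\<^sup>2)"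

definition wnorm2 :: "(nat \<Rightarrow> real) \<Rightarrow> (nat \<Rightarrow> complex) \<Rightarrow> real" where
  "wnorm2 \<Omega> c = (\<Sum>n. \<Omega> n * (cmod (c n))\<^sup>2)"

text \<open>Stands in for the triangle inequality, so that norms stay squared throughout. Each use
  costs a factor 2, which explains the fractions of \<open>\<epsilon>\<close> in later
  arguments.\<close>

lemma norm_add_squared_le: "(norm (x + y))\<^sup>2 \<le> 2 * (norm x)\<^sup>2 + 2 * (norm (y::'a::real_normed_vector))\<^sup>2"
proof -
  have "(norm (x + y))\<^sup>2 \<le> (norm x + norm y)\<^sup>2"
    by (intro power_mono norm_triangle_ineq) auto
  also have "\<dots> \<le> 2 * (norm x)\<^sup>2 + 2 * (norm y)\<^sup>2"
    using zero_le_power2[of "norm x - norm y"] by (simp add: power2_sum power2_diff)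
  finally show ?thesis .
qed

locale pos_weight =
  fixes \<Omega> :: "nat \<Rightarrow> real"
  assumes \<Omega>_pos: "\<Omega> n > 0"
begin

lemma \<Omega>_nonneg [simp]: "0 \<le> \<Omega> n"
  using \<Omega>_pos[of n] by simp

lemma wnorm2_nonneg: "wsummable \<Omega> c \<Longrightarrow> 0 \<le> wnorm2 \<Omega> c"
  unfolding wnorm2_def wsummable_def by (rule suminf_nonneg) auto

text \<open>Serves as Fatou's lemma: a bound valid on every initial segment survives a limit taken
  coefficient by coefficient.\<close>

lemma wsummable_bounded:
  assumes "\<And>N. (\<Sum>n<N. \<Omega> n * (cmod (c n))\<^sup>2) \<le> B"
  shows "wsummable \<Omega> c" "wnorm2 \<Omega> c \<le> B"
proof -
  show s: "wsummable \<Omega> c"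
    unfolding wsummable_def using assms[of "Suc n" for n]
    by (intro bounded_imp_summable[where B = B]) (auto simp: lessThan_Suc_atMost simp del: sum.lessThan_Suc)
  show "wnorm2 \<Omega> c \<le> B"
    unfolding wnorm2_def using s assms by (intro suminf_le_const) (auto simp: wsummable_def)
qed

lemma wsum_le_wnorm2: "wsummable \<Omega> c \<Longrightarrow> finite A \<Longrightarrow> (\<Sum>n\<in>A. \<Omega> n * (cmod (c n))\<^sup>2) \<le> wnorm2 \<Omega> c"
  unfolding wsummable_def wnorm2_def by (intro sum_le_suminf) auto

lemma wsummable_add:
  assumes "wsummable \<Omega> a" "wsummable \<Omega> b"
  shows "wsummable \<Omega> (\<lambda>n. a n + b n)" "wnorm2 \<Omega> (\<lambda>n. a n + b n) \<le> 2 * wnorm2 \<Omega> a + 2 * wnorm2 \<Omega> b"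
proof -
  have "(\<Sum>n<N. \<Omega> n * (cmod (a n + b n))\<^sup>2) \<le> 2 * wnorm2 \<Omega> a + 2 * wnorm2 \<Omega> b" for N
  proof -
    have "(\<Sum>n<N. \<Omega> n * (cmod (a n + b n))\<^sup>2) \<le> (\<Sum>n<N. \<Omega> n * (2 * (cmod (a n))\<^sup>2 + 2 * (cmod (b n))\<^sup>2))"
      by (intro sum_mono mult_left_mono norm_add_squared_le) simp
    also have "\<dots> = 2 * (\<Sum>n<N. \<Omega> n * (cmod (a n))\<^sup>2) + 2 * (\<Sum>n<N. \<Omega> n * (cmod (b n))\<^sup>2)"
      by (simp add: algebra_simps sum.distrib sum_distrib_left)
    also have "\<dots> \<le> 2 * wnorm2 \<Omega> a + 2 * wnorm2 \<Omega> b"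
      using wsum_le_wnorm2[OF assms(1), of "{..<N}"] wsum_le_wnorm2[OF assms(2), of "{..<N}"] by simp
    finally show ?thesis .
  qed
  then show "wsummable \<Omega> (\<lambda>n. a n + b n)" "wnorm2 \<Omega> (\<lambda>n. a n + b n) \<le> 2 * wnorm2 \<Omega> a + 2 * wnorm2 \<Omega> b"
    by (rule wsummable_bounded)+
qed

lemma wsummable_cmult:
  assumes "wsummable \<Omega> a"
  shows "wsummable \<Omega> (\<lambda>n. k * a n)" "wnorm2 \<Omega> (\<lambda>n. k * a n) = (cmod k)\<^sup>2 * wnorm2 \<Omega> a"
  using assms suminf_mult[of "\<lambda>n. \<Omega> n * (cmod (a n))\<^sup>2" "(cmod k)\<^sup>2"]
    summable_mult[of "\<lambda>n. \<Omega> n * (cmod (a n))\<^sup>2" "(cmod k)\<^sup>2"]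
  by (auto simp: wsummable_def wnorm2_def norm_mult power_mult_distrib mult_ac)

lemma wsummable_diff:
  assumes "wsummable \<Omega> a" "wsummable \<Omega> b"
  shows "wsummable \<Omega> (\<lambda>n. a n - b n)" "wnorm2 \<Omega> (\<lambda>n. a n - b n) \<le> 2 * wnorm2 \<Omega> a + 2 * wnorm2 \<Omega> b"
  using wsummable_add[OF assms(1) wsummable_cmult(1)[OF assms(2), of "- 1"]]
    wsummable_cmult(2)[OF assms(2), of "- 1"] by simp_all

lemma wsummable_finite: "finite {n. c n \<noteq> 0} \<Longrightarrow> wsummable \<Omega> c"
  unfolding wsummable_def by (rule summable_finite[where N = "{n. c n \<noteq> 0}"]) auto

lemma wsummable_le:
  assumes "wsummable \<Omega> a" "\<And>n. cmod (b n) \<le> cmod (a n)"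
  shows "wsummable \<Omega> b" "wnorm2 \<Omega> b \<le> wnorm2 \<Omega> a"
proof -
  have le: "\<Omega> n * (cmod (b n))\<^sup>2 \<le> \<Omega> n * (cmod (a n))\<^sup>2" for n
    using assms(2) by (intro mult_left_mono power_mono) auto
  show "wsummable \<Omega> b"
    unfolding wsummable_def
    by (rule summable_comparison_test'[OF assms(1)[unfolded wsummable_def]]) (use le in auto)
  then show "wnorm2 \<Omega> b \<le> wnorm2 \<Omega> a"
    unfolding wnorm2_def using assms le by (intro suminf_le) (auto simp: wsummable_def)
qed

lemma wnorm2_tail_tendsto:
  assumes "wsummable \<Omega> c"
  shows "(\<lambda>N. wnorm2 \<Omega> (\<lambda>n. if n < N then 0 else c n)) \<longlonglongrightarrow> 0"
proof -
  let ?t = "\<lambda>n. \<Omega> n * (cmod (c n))\<^sup>2"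
  have s: "summable ?t" using assms by (simp add: wsummable_def)
  have "wnorm2 \<Omega> (\<lambda>n. if n < N then 0 else c n) = (\<Sum>n. ?t n) - (\<Sum>n<N. ?t n)" for N
  proof -
    have "(\<lambda>n. \<Omega> n * (cmod (if n < N then 0 else c n))\<^sup>2) = (\<lambda>n. ?t n - (if n \<in> {..<N} then ?t n else 0))"
      by auto
    moreover have "(\<lambda>n. ?t n - (if n \<in> {..<N} then ?t n else 0)) sums ((\<Sum>n. ?t n) - (\<Sum>n<N. ?t n))"
      by (intro sums_diff summable_sums s sums_If_finite_set) auto
    ultimately show ?thesis by (simp add: wnorm2_def sums_iff)
  qed
  moreover have "(\<lambda>N. (\<Sum>n. ?t n) - (\<Sum>n<N. ?t n)) \<longlonglongrightarrow> (\<Sum>n. ?t n) - (\<Sum>n. ?t n)"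
    by (intro tendsto_intros summable_LIMSEQ s)
  ultimately show ?thesis by simp
qed

end

locale doubling_weight = pos_weight +
  fixes C :: real
  assumes \<Omega>_mono: "m \<le> n \<Longrightarrow> \<Omega> m \<le> \<Omega> n"
    and \<Omega>_double: "\<Omega> (2 * n) \<le> C * \<Omega> n"
    and C_less: "C < 4"
begin

lemma C_ge_1: "1 \<le> C"
  using \<Omega>_double[of 0] \<Omega>_pos[of 0] by simp

text \<open>For \<open>n \<ge> 1\<close> one has \<open>Suc n \<le> 2 * n\<close>, so
  \<open>C\<close> serves; at \<open>n = 0\<close> doubling does nothing, and the ratio
  \<open>\<Omega> 1 / \<Omega> 0\<close> is added by hand.\<close>

definition shift_const :: real where "shift_const = max C (\<Omega> 1 / \<Omega> 0)"

lemma \<Omega>_Suc: "\<Omega> (Suc n) \<le> shift_const * \<Omega> n"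
proof (cases n)
  case 0
  then show ?thesis
    using \<Omega>_pos[of 0] by (simp add: shift_const_def max_def field_simps)
next
  case (Suc k)
  have "\<Omega> (Suc n) \<le> \<Omega> (2 * n)" using Suc by (intro \<Omega>_mono) auto
  also have "\<dots> \<le> C * \<Omega> n" by (rule \<Omega>_double)
  also have "\<dots> \<le> shift_const * \<Omega> n" by (intro mult_right_mono) (auto simp: shift_const_def)
  finally show ?thesis .
qed

text \<open>\<open>case_nat 0 c\<close> is the coefficient sequence of \<open>z * f\<close> when
  \<open>c\<close> is that of \<open>f\<close>: multiplication by \<open>z\<close> is
  bounded.\<close>

lemma wsummable_shift:
  assumes "wsummable \<Omega> c"
  shows "wsummable \<Omega> (case_nat 0 c)" "wnorm2 \<Omega> (case_nat 0 c) \<le> shift_const * wnorm2 \<Omega> c"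
proof -
  have sc: "0 \<le> shift_const" using C_ge_1 by (simp add: shift_const_def)
  have "(\<Sum>n<N. \<Omega> n * (cmod (case_nat 0 c n))\<^sup>2) \<le> shift_const * wnorm2 \<Omega> c" for N
  proof (cases N)
    case 0
    then show ?thesis using sc wnorm2_nonneg[OF assms] by simp
  next
    case (Suc M)
    have "(\<Sum>n<N. \<Omega> n * (cmod (case_nat 0 c n))\<^sup>2) = (\<Sum>n<M. \<Omega> (Suc n) * (cmod (c n))\<^sup>2)"
      unfolding Suc by (subst sum.lessThan_Suc_shift) simp
    also have "\<dots> \<le> (\<Sum>n<M. shift_const * (\<Omega> n * (cmod (c n))\<^sup>2))"
      unfolding mult.assoc[symmetric] by (intro sum_mono mult_right_mono \<Omega>_Suc) auto
    also have "\<dots> \<le> shift_const * wnorm2 \<Omega> c"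
      unfolding sum_distrib_left[symmetric] using sc by (intro mult_left_mono wsum_le_wnorm2 assms) auto
    finally show ?thesis .
  qed
  then show "wsummable \<Omega> (case_nat 0 c)" "wnorm2 \<Omega> (case_nat 0 c) \<le> shift_const * wnorm2 \<Omega> c"
    by (rule wsummable_bounded)+
qed

end

section \<open>Difference quotients control the weighted norm\<close>

text \<open>The integrand is \<open>(cmod (cis (n * t) - 1))\<^sup>2\<close>, the factor that the
  \<open>n\<close>-th squared coefficient acquires when a function is replaced by its difference
  with its rotation by \<open>t\<close>.\<close>

definition cos_avg :: "real \<Rightarrow> nat \<Rightarrow> real" where
  "cos_avg s n = (LINT t|uniform_measure lborel {0..s}. 2 - 2 * cos (n * t))"

lemma cos_diff_sums_avg:
  assumes "s > 0" and a: "summable a" "\<And>n. a n \<ge> 0"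
  shows "(\<lambda>n. cos_avg s n * a n) sums
    (LINT t|uniform_measure lborel {0..s}. (\<Sum>n. (2 - 2 * cos (real n * t)) * a n))"
    and "integrable (uniform_measure lborel {0..s}) (\<lambda>t. \<Sum>n. (2 - 2 * cos (real n * t)) * a n)"
proof -
  let ?U = "uniform_measure lborel {0..s}"
  interpret U: prob_space ?U
    using assms by (intro prob_space_uniform_measure) auto
  have meas: "(\<lambda>t. 2 - 2 * cos (real n * t)) \<in> borel_measurable ?U" for n
    by (simp cong: measurable_cong_sets)
  have b: "\<bar>2 - 2 * cos x\<bar> \<le> 4" for x :: real
    using cos_le_one[of x] cos_ge_minus_one[of x] by linarith
  have int: "integrable ?U (\<lambda>t. 2 - 2 * cos (real n * t))" for n
    by (intro U.integrable_const_bound[where B = 4] meas) (use b in auto)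
  then have int': "integrable ?U (\<lambda>t. (2 - 2 * cos (real n * t)) * a n)" for n
    by simp
  have n: "norm ((2 - 2 * cos (real n * t)) * a n) \<le> 4 * a n" for n t
    using b[of "real n * t"] a by (simp add: abs_mult mult_right_mono)
  have sm: "summable (\<lambda>n. norm ((2 - 2 * cos (real n * t)) * a n))" for t
    by (rule summable_comparison_test'[OF summable_mult[OF a(1), of 4]]) (use n in auto)
  have "norm (LINT t|?U. norm ((2 - 2 * cos (real n * t)) * a n)) \<le> 4 * a n" for n
  proof -
    have "(LINT t|?U. norm ((2 - 2 * cos (real n * t)) * a n)) \<le> (LINT t|?U. 4 * a n)"
      by (intro integral_mono integrable_norm int' n) auto
    then show ?thesis
      using U.prob_space by (simp add: integral_nonneg_AE)
  qed
  then have si: "summable (\<lambda>n. LINT t|?U. norm ((2 - 2 * cos (real n * t)) * a n))"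
    by (intro summable_comparison_test'[OF summable_mult[OF a(1), of 4]]) auto
  show "(\<lambda>n. cos_avg s n * a n) sums (LINT t|?U. (\<Sum>n. (2 - 2 * cos (real n * t)) * a n))"
    using sums_integral[OF int' AE_I2[OF sm] si] by (simp add: cos_avg_def int)
  show "integrable ?U (\<lambda>t. \<Sum>n. (2 - 2 * cos (real n * t)) * a n)"
    by (rule integrable_suminf[OF int' AE_I2[OF sm] si])
qed

text \<open>The quadratic bound is
  \<open>2 - 2 * cos x = (2 * sin (x / 2))\<^sup>2 \<le> x\<^sup>2\<close>. The lower bound follows
  from the exact value \<open>2 - 2 * sin (n * s) / (n * s)\<close>, in which the subtracted term is
  at most 1 once \<open>n * s \<ge> 2\<close>.\<close>

lemma cos_avg_bounds:
  assumes "s > 0"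
  shows "0 \<le> cos_avg s n" "cos_avg s n \<le> 4" "cos_avg s n \<le> (n * s)\<^sup>2"
    and "n * s \<ge> 2 \<Longrightarrow> 1 \<le> cos_avg s n"
proof -
  let ?U = "uniform_measure lborel {0..s}"
  interpret U: prob_space ?U
    using assms by (intro prob_space_uniform_measure) auto
  have meas: "(\<lambda>t. 2 - 2 * cos (real n * t)) \<in> borel_measurable ?U"
    by (simp cong: measurable_cong_sets)
  have b: "0 \<le> 2 - 2 * cos x" "2 - 2 * cos x \<le> 4" for x :: real
    using cos_le_one[of x] cos_ge_minus_one[of x] by linarith+
  have int: "integrable ?U (\<lambda>t. 2 - 2 * cos (real n * t))"
    by (intro U.integrable_const_bound[where B = 4] meas) (use b in auto)
  show "0 \<le> cos_avg s n"
    unfolding cos_avg_def using b by (intro integral_nonneg_AE) auto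
  have "cos_avg s n \<le> (LINT t|?U. 4)"
    unfolding cos_avg_def using b by (intro integral_mono int) auto
  then show "cos_avg s n \<le> 4" using U.prob_space by simp
  have q: "2 - 2 * cos x \<le> x\<^sup>2" for x :: real
  proof -
    have "(2 * sin (x / 2))\<^sup>2 \<le> x\<^sup>2"
      using abs_sin_x_le_abs_x[of "x / 2"] by (intro power2_le_iff_abs_le[THEN iffD2] abs_le_square_iff[THEN iffD1]) auto
    moreover have "cos x = 1 - 2 * (sin (x / 2))\<^sup>2"
      using cos_double_sin[of "x / 2"] by simp
    ultimately show ?thesis by (simp add: power_mult_distrib)
  qed
  have "cos_avg s n \<le> (LINT t|?U. (n * s)\<^sup>2)"
    unfolding cos_avg_def
  proof (intro integral_mono_AE int)
    show "AE t in ?U. 2 - 2 * cos (real n * t) \<le> (n * s)\<^sup>2"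
    proof (intro AE_uniform_measureI AE_I2 impI)
      fix t assume "t \<in> {0..s}"
      then have "(real n * t)\<^sup>2 \<le> (n * s)\<^sup>2" by (intro power_mono mult_left_mono) auto
      then show "2 - 2 * cos (real n * t) \<le> (n * s)\<^sup>2" using q[of "real n * t"] by linarith
    qed auto
  qed auto
  then show "cos_avg s n \<le> (n * s)\<^sup>2" using U.prob_space by simp
  assume ns: "n * s \<ge> 2"
  then have n0: "n \<noteq> 0" by (cases n) auto
  have "cos_avg s n = (LINT t|lborel. (indicator {0..s} t / s) *\<^sub>R (2 - 2 * cos (real n * t)))"
  proof -
    have "?U = density lborel (\<lambda>t. ennreal (indicator {0..s} t / s))"
      unfolding uniform_measure_def using assms
      by (intro arg_cong2[where f = density] refl ext)
        (auto split: split_indicator simp: divide_ennreal[symmetric] ennreal_1[symmetric] simp del: ennreal_1)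
    then show ?thesis
      unfolding cos_avg_def using assms
      by (simp only:) (intro integral_density, auto intro!: borel_measurable_continuous_onI continuous_intros)
  qed
  also have "\<dots> = (LINT t|lborel. indicator {0..s} t *\<^sub>R ((2 - 2 * cos (real n * t)) / s))"
    by (auto intro!: Bochner_Integration.integral_cong split: split_indicator)
  also have "\<dots> = (2 * s - 2 * sin (real n * s) / n) / s - (2 * 0 - 2 * sin (real n * 0) / n) / s"
    using assms n0
    by (intro integral_FTC_atLeastAtMost)
      (auto intro!: derivative_eq_intros continuous_intros simp: has_real_derivative_iff_has_vector_derivative[symmetric] field_simps)
  also have "\<dots> = 2 - 2 * sin (n * s) / (n * s)"
    using assms n0 by (simp add: field_simps)
  also have "\<dots> \<ge> 1"
  proof -
    have "2 * sin (n * s) / (n * s) \<le> 2 / (n * s)"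
      using assms by (intro divide_right_mono) auto
    also have "\<dots> \<le> 1" using ns by (simp add: divide_le_eq)
    finally show ?thesis by simp
  qed
  finally show "1 \<le> cos_avg s n" .
qed

context doubling_weight
begin

text \<open>Summation by parts for \<open>\<Omega>\<close> along powers of 2: the partial sums
  telescope to \<open>\<Omega> (2 ^ j)\<close>, and monotonicity keeps the weights
  nonnegative.\<close>

primrec dyadic_incr :: "nat \<Rightarrow> real" where
  "dyadic_incr 0 = \<Omega> 1"
| "dyadic_incr (Suc i) = \<Omega> (2 ^ Suc i) - \<Omega> (2 ^ i)"

lemma dyadic_incr_nonneg: "0 \<le> dyadic_incr i"
  by (cases i) (auto intro: \<Omega>_mono)

lemma dyadic_incr_le: "dyadic_incr i \<le> \<Omega> (2 ^ i)"
  by (cases i) auto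

lemma sum_dyadic_incr: "(\<Sum>i\<le>j. dyadic_incr i) = \<Omega> (2 ^ j)"
  by (induction j) auto

lemma \<Omega>_dyadic: "\<Omega> (2 ^ (j + k)) \<le> C ^ k * \<Omega> (2 ^ j)"
proof (induction k)
  case (Suc k)
  have "\<Omega> (2 ^ (j + Suc k)) \<le> C * \<Omega> (2 ^ (j + k))" using \<Omega>_double[of "2 ^ (j + k)"] by simp
  also have "\<dots> \<le> C * (C ^ k * \<Omega> (2 ^ j))" using Suc C_ge_1 by (intro mult_left_mono) auto
  finally show ?case by simp
qed simp

text \<open>Comparable with \<open>\<Omega> n\<close> for \<open>n < 2 ^ Suc J\<close>. The averaging is essential: for a single \<open>t\<close> the factor
  \<open>2 - 2 * cos (n * t)\<close> may vanish at large \<open>n\<close>.\<close>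

definition smear :: "nat \<Rightarrow> nat \<Rightarrow> real" where
  "smear J n = (\<Sum>i\<le>J. dyadic_incr i * cos_avg (2 / 2 ^ i) n)"

text \<open>If \<open>2 ^ j \<le> n < 2 ^ (j + 1)\<close>, each scale \<open>i \<le> j\<close> is
  coarse enough for an average of at least 1, so the weights add up to at least
  \<open>\<Omega> (2 ^ j)\<close>; one doubling compares this with \<open>\<Omega> n\<close>. The
  upper bound on \<open>n\<close> ensures that all those scales occur in the sum.\<close>

lemma smear_lower:
  assumes "1 \<le> n" "n < 2 ^ Suc J"
  shows "\<Omega> n \<le> C * smear J n"
proof -
  obtain j where j: "2 ^ j \<le> n" "n < 2 ^ (j + 1)"
    using ex_power_ivl1[of 2 n] assms by auto
  have "(2::nat) ^ j < 2 ^ Suc J" using j assms by linarith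
  then have jJ: "j \<le> J" using power_less_imp_less_exp[of "2::nat" j "Suc J"] by simp
  have "\<Omega> n \<le> \<Omega> (2 * 2 ^ j)" using j by (intro \<Omega>_mono) auto
  also have "\<dots> \<le> C * \<Omega> (2 ^ j)" by (rule \<Omega>_double)
  also have "\<Omega> (2 ^ j) = (\<Sum>i\<le>j. dyadic_incr i * 1)" by (simp add: sum_dyadic_incr)
  also have "\<dots> \<le> (\<Sum>i\<le>j. dyadic_incr i * cos_avg (2 / 2 ^ i) n)"
  proof (intro sum_mono mult_left_mono dyadic_incr_nonneg cos_avg_bounds(4))
    fix i assume "i \<in> {..j}"
    then have "(2::nat) ^ i \<le> 2 ^ j" by (intro power_increasing) auto
    then have "2 ^ i \<le> n" using j by linarith
    then have "(2::real) ^ i \<le> real n" by (metis of_nat_le_iff of_nat_numeral of_nat_power)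
    then show "2 \<le> real n * (2 / 2 ^ i)" by (simp add: field_simps)
  qed auto
  also have "\<dots> \<le> smear J n"
    unfolding smear_def using jJ
    by (intro sum_mono2) (auto intro!: mult_nonneg_nonneg dyadic_incr_nonneg cos_avg_bounds)
  finally show ?thesis using C_ge_1 by simp
qed

text \<open>4 is the trivial bound for \<open>cos_avg\<close>, applied to the scales
  \<open>i \<le> j\<close>; the fraction sums \<open>16 * (C / 4) ^ k\<close> over the finer scales
  \<open>j + k\<close>.\<close>

definition smear_const :: real where "smear_const = 4 + 16 / (1 - C / 4)"

text \<open>At the scales finer than \<open>1 / n\<close> the quadratic bound yields a decay
  \<open>16 / 4 ^ k\<close>, whereas the weights grow at most like \<open>C ^ k\<close>. The series
  converges because \<open>C < 4\<close>, and the bound does not depend on \<open>J\<close>.\<close>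

lemma smear_upper: "smear J n \<le> smear_const * \<Omega> n"
proof (cases "n = 0")
  case True
  then show ?thesis
    using C_less by (simp add: smear_def cos_avg_def smear_const_def add_nonneg_nonneg)
next
  case False
  then obtain j where j: "2 ^ j \<le> n" "n < 2 ^ (j + 1)"
    using ex_power_ivl1[of 2 n] by auto
  define t where "t i = dyadic_incr i * cos_avg (2 / 2 ^ i) n" for i
  have t0: "0 \<le> t i" for i
    unfolding t_def by (intro mult_nonneg_nonneg dyadic_incr_nonneg cos_avg_bounds) auto
  have jn: "\<Omega> (2 ^ j) \<le> \<Omega> n" using j by (intro \<Omega>_mono)
  have "smear J n \<le> (\<Sum>i\<le>j+J. t i)"
    unfolding smear_def t_def[symmetric] by (intro sum_mono2) (auto simp: t0)
  also have "{..j + J} = {..j} \<union> {1 + j..J + j}"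
    by auto
  also have "(\<Sum>i\<in>\<dots>. t i) = (\<Sum>i\<le>j. t i) + (\<Sum>i=1+j..J+j. t i)"
    by (intro sum.union_disjoint) auto
  also have "(\<Sum>i=1+j..J+j. t i) = (\<Sum>k=1..J. t (j + k))"
    using sum.shift_bounds_cl_nat_ivl[of t 1 j J] by (simp add: add.commute)
  also have "(\<Sum>i\<le>j. t i) \<le> (\<Sum>i\<le>j. dyadic_incr i * 4)"
    unfolding t_def by (intro sum_mono mult_left_mono dyadic_incr_nonneg cos_avg_bounds) auto
  also have "\<dots> = 4 * \<Omega> (2 ^ j)" by (simp add: sum_dyadic_incr flip: sum_distrib_right)
  also have "\<dots> \<le> 4 * \<Omega> n" using jn by simp
  also have "(\<Sum>k=1..J. t (j + k)) \<le> (\<Sum>k=1..J. 16 * (C / 4) ^ k * \<Omega> n)"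
  proof (intro sum_mono)
    fix k
    have "real n * (2 / 2 ^ (j + k)) \<le> 2 ^ (j + 1) * (2 / 2 ^ (j + k))"
    proof (intro mult_right_mono)
      have "real n < real (2 ^ (j + 1))" using j(2) of_nat_less_iff by blast
      then show "real n \<le> 2 ^ (j + 1)" by simp
    qed auto
    also have "\<dots> = 4 / 2 ^ k" by (simp add: power_add field_simps)
    finally have "(real n * (2 / 2 ^ (j + k)))\<^sup>2 \<le> (4 / 2 ^ k)\<^sup>2"
      by (intro power_mono) auto
    also have "\<dots> = 16 / 4 ^ k" by (simp add: power_divide power_mult_distrib flip: power_mult power_mult_distrib power_even_eq)
       (metis mult.commute numeral_Bit0 numeral_code(2) mult_2 power2_eq_square power_mult numeral_times_numeral semiring_norm(11) semiring_norm(13))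
    finally have a: "cos_avg (2 / 2 ^ (j + k)) n \<le> 16 / 4 ^ k"
      using cos_avg_bounds(3)[of "2 / 2 ^ (j + k)" n] by (simp add: order_trans)
    have "dyadic_incr (j + k) \<le> C ^ k * \<Omega> n"
    proof -
      have "dyadic_incr (j + k) \<le> \<Omega> (2 ^ (j + k))" by (rule dyadic_incr_le)
      also have "\<dots> \<le> C ^ k * \<Omega> (2 ^ j)" by (rule \<Omega>_dyadic)
      also have "\<dots> \<le> C ^ k * \<Omega> n" using jn C_ge_1 by (intro mult_left_mono) auto
      finally show ?thesis .
    qed
    then have "t (j + k) \<le> (C ^ k * \<Omega> n) * (16 / 4 ^ k)"
      unfolding t_def using a C_ge_1 by (intro mult_mono cos_avg_bounds) auto
    then show "t (j + k) \<le> 16 * (C / 4) ^ k * \<Omega> n"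
      by (simp add: power_divide field_simps)
  qed
  also have "\<dots> = 16 * \<Omega> n * (\<Sum>k=1..J. (C / 4) ^ k)"
    by (simp add: sum_distrib_left sum_distrib_right mult_ac)
  also have "\<dots> \<le> 16 * \<Omega> n * (1 / (1 - C / 4))"
  proof (intro mult_left_mono)
    have "(\<Sum>k=1..J. (C / 4) ^ k) \<le> (\<Sum>k. (C / 4) ^ k)"
      using C_ge_1 C_less by (intro sum_le_suminf summable_geometric) auto
    also have "\<dots> = 1 / (1 - C / 4)"
      using C_ge_1 C_less by (intro suminf_geometric) auto
    finally show "(\<Sum>k=1..J. (C / 4) ^ k) \<le> 1 / (1 - C / 4)" .
  qed auto
  finally show ?thesis
    by (simp add: smear_const_def algebra_simps)
qed

definition diff_const :: real where "diff_const = C * smear_const"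

lemma diff_const_nonneg: "0 \<le> diff_const"
  using C_ge_1 C_less by (auto simp: diff_const_def smear_const_def)

text \<open>Averaging the hypothesis over \<open>t\<close> and adding the scales with weights
  \<open>dyadic_incr i\<close> replaces \<open>2 - 2 * cos (n * t)\<close> by
  \<open>smear J n\<close>, which is compared with \<open>\<Omega>\<close> on both sides. The sum
  starts at 1 since differences do not see the coefficient at 0.\<close>

lemma weighted_sum_le_of_cos_differences:
  assumes a: "summable a" "\<And>n. a n \<ge> 0" and b: "summable b" "\<And>n. b n \<ge> 0"
    and le: "\<And>t. (\<Sum>n. (2 - 2 * cos (real n * t)) * a n) \<le> (\<Sum>n. (2 - 2 * cos (real n * t)) * b n)"
    and sb: "summable (\<lambda>n. \<Omega> n * b n)"
  shows "(\<Sum>n=1..N. \<Omega> n * a n) \<le> diff_const * (\<Sum>n. \<Omega> n * b n)"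
proof -
  \<comment> \<open>Any \<open>J\<close> with \<open>N < 2 ^ Suc J\<close> would do: the constant
    obtained is independent of \<open>J\<close>.\<close>
  define J where "J = N"
  have N: "N < 2 ^ Suc J" unfolding J_def
    by (metis less_exp less_SucI power_Suc Suc_lessD less_trans lessI)
  have s: "summable (\<lambda>n. cos_avg (2 / 2 ^ i) n * a n)" "summable (\<lambda>n. cos_avg (2 / 2 ^ i) n * b n)"
    and avg: "(\<Sum>n. cos_avg (2 / 2 ^ i) n * a n) \<le> (\<Sum>n. cos_avg (2 / 2 ^ i) n * b n)" for i
  proof -
    have p: "(2::real) / 2 ^ i > 0" by simp
    note A = cos_diff_sums_avg[OF p a] and B = cos_diff_sums_avg[OF p b]
    show "summable (\<lambda>n. cos_avg (2 / 2 ^ i) n * a n)" "summable (\<lambda>n. cos_avg (2 / 2 ^ i) n * b n)"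
      using A B by (auto simp: sums_iff)
    have "(LINT t|uniform_measure lborel {0..2 / 2 ^ i}. (\<Sum>n. (2 - 2 * cos (real n * t)) * a n))
        \<le> (LINT t|uniform_measure lborel {0..2 / 2 ^ i}. (\<Sum>n. (2 - 2 * cos (real n * t)) * b n))"
      by (rule integral_mono[OF A(2) B(2) le])
    then show "(\<Sum>n. cos_avg (2 / 2 ^ i) n * a n) \<le> (\<Sum>n. cos_avg (2 / 2 ^ i) n * b n)"
      using A(1) B(1) by (simp add: sums_iff)
  qed
  have sm: "(\<lambda>n. smear J n * c n) sums (\<Sum>i\<le>J. dyadic_incr i * (\<Sum>n. cos_avg (2 / 2 ^ i) n * c n))"
    if "\<And>i. summable (\<lambda>n. cos_avg (2 / 2 ^ i) n * c n)" for c
    unfolding smear_def sum_distrib_right mult.assoc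
    by (intro sums_sum sums_mult summable_sums that)
  have nn: "0 \<le> smear J n" for n
    unfolding smear_def by (intro sum_nonneg mult_nonneg_nonneg dyadic_incr_nonneg cos_avg_bounds) auto
  have "(\<Sum>n=1..N. \<Omega> n * a n) \<le> (\<Sum>n=1..N. C * smear J n * a n)"
    using N a by (intro sum_mono mult_right_mono smear_lower) auto
  also have "\<dots> = C * (\<Sum>n=1..N. smear J n * a n)"
    by (simp add: sum_distrib_left mult.assoc)
  also have "(\<Sum>n=1..N. smear J n * a n) \<le> (\<Sum>n. smear J n * a n)"
    using sm[OF s(1)] nn a by (intro sum_le_suminf) (auto simp: sums_iff)
  also have "\<dots> \<le> (\<Sum>n. smear J n * b n)"
    using sm[OF s(1)] sm[OF s(2)] avg by (auto simp: sums_iff intro!: sum_mono mult_left_mono dyadic_incr_nonneg)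
  also have "\<dots> \<le> (\<Sum>n. smear_const * (\<Omega> n * b n))"
    using sm[OF s(2)] b unfolding mult.assoc[symmetric]
    by (intro suminf_le mult_right_mono smear_upper) (auto simp: sums_iff mult.assoc intro!: summable_mult sb)
  also have "\<dots> = smear_const * (\<Sum>n. \<Omega> n * b n)"
    by (intro suminf_mult sb)
  finally show ?thesis
    using C_ge_1 by (simp add: diff_const_def mult.assoc)
qed

end


section \<open>Contractions operate on the weighted norm\<close>

context doubling_weight
begin

lemma taylor_rotation_diff:
  assumes "h holomorphic_on ball 0 1"
  shows "taylor (\<lambda>z. h (cis t * z) - h z) n = taylor h n * (cis (real n * t) - 1)"
    and "(\<lambda>z. h (cis t * z) - h z) holomorphic_on ball 0 1"
proof -
  show "taylor (\<lambda>z. h (cis t * z) - h z) n = taylor h n * (cis (real n * t) - 1)"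
  proof (rule taylor_unique)
    fix z :: complex assume z: "cmod z < 1"
    then have z': "cmod (cis t * z) < 1" by (simp add: norm_mult)
    have "(\<lambda>n. taylor h n * (cis t * z) ^ n - taylor h n * z ^ n) sums (h (cis t * z) - h z)"
      by (intro sums_diff taylor_sums[OF assms] z z')
    then show "(\<lambda>n. taylor h n * (cis (real n * t) - 1) * z ^ n) sums (h (cis t * z) - h z)"
      by (simp add: power_mult_distrib Complex.DeMoivre algebra_simps)
  qed simp
  have "(h \<circ> (\<lambda>z. cis t * z)) holomorphic_on ball 0 1"
    by (intro holomorphic_on_compose_gen[OF _ assms] holomorphic_intros) (auto simp: norm_mult)
  then show "(\<lambda>z. h (cis t * z) - h z) holomorphic_on ball 0 1"
    by (intro holomorphic_intros assms) (simp add: o_def)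
qed

lemma cmod_cis_minus_1: "(cmod (cis x - 1))\<^sup>2 = 2 - 2 * cos x"
  unfolding cmod_power2 using sin_cos_squared_add[of x] by (simp add: power2_eq_square algebra_simps)

lemma rotation_diff_sums:
  assumes "h holomorphic_on ball 0 1" "0 < r" "r < 1"
  shows "(\<lambda>n. (2 - 2 * cos (real n * t)) * ((cmod (taylor h n))\<^sup>2 * r ^ (2 * n))) sums
    (LINT \<zeta>|circle_measure. (cmod (h (cis t * (of_real r * \<zeta>)) - h (of_real r * \<zeta>)))\<^sup>2)"
  using Parseval_taylor[OF taylor_rotation_diff(2)[OF assms(1)] assms(2,3), of t]
  unfolding taylor_rotation_diff(1)[OF assms(1)] norm_mult power_mult_distrib cmod_cis_minus_1
  by (simp only: mult_ac)

text \<open>The pointwise inequality is applied to \<open>cis t * (r * \<zeta>)\<close> and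
  \<open>r * \<zeta>\<close> and integrated over the circle; Parseval turns it into the comparison
  of cosine sums for every \<open>t\<close>. Only finitely many terms stand on the left, so
  \<open>r\<close> may tend to 1. Two majorants are allowed in order to treat products.\<close>

lemma contraction_partial:
  assumes h: "h holomorphic_on ball 0 1" and f: "f holomorphic_on ball 0 1" and g: "g holomorphic_on ball 0 1"
    and AB: "0 \<le> A" "0 \<le> B"
    and le: "\<And>z w. cmod z < 1 \<Longrightarrow> cmod w < 1 \<Longrightarrow>
      (cmod (h z - h w))\<^sup>2 \<le> A * (cmod (f z - f w))\<^sup>2 + B * (cmod (g z - g w))\<^sup>2"
    and sf: "wsummable \<Omega> (taylor f)" and sg: "wsummable \<Omega> (taylor g)"
  shows "(\<Sum>n=1..N. \<Omega> n * (cmod (taylor h n))\<^sup>2)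
    \<le> diff_const * (A * wnorm2 \<Omega> (taylor f) + B * wnorm2 \<Omega> (taylor g))" (is "_ \<le> ?R")
proof -
  have bound: "(\<Sum>n=1..N. \<Omega> n * ((cmod (taylor h n))\<^sup>2 * r ^ (2 * n))) \<le> ?R" if r: "0 < r" "r < 1" for r
  proof -
    define b where "b n = A * ((cmod (taylor f n))\<^sup>2 * r ^ (2 * n)) + B * ((cmod (taylor g n))\<^sup>2 * r ^ (2 * n))" for n
    have b0: "0 \<le> b n" for n using AB r by (auto simp: b_def)
    have sb: "summable b" unfolding b_def
      using Parseval_taylor[OF f r] Parseval_taylor[OF g r] by (intro summable_add summable_mult) (auto simp: sums_iff)
    have rn: "r ^ (2 * n) \<le> 1" for n using r by (intro power_le_one) auto
    have ble: "\<Omega> n * b n \<le> A * (\<Omega> n * (cmod (taylor f n))\<^sup>2) + B * (\<Omega> n * (cmod (taylor g n))\<^sup>2)" for n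
    proof -
      have "b n \<le> A * ((cmod (taylor f n))\<^sup>2 * 1) + B * ((cmod (taylor g n))\<^sup>2 * 1)"
        unfolding b_def by (intro add_mono mult_left_mono rn AB) auto
      from mult_left_mono[OF this, of "\<Omega> n"] show ?thesis by (simp add: algebra_simps)
    qed
    have sR: "(\<lambda>n. A * (\<Omega> n * (cmod (taylor f n))\<^sup>2) + B * (\<Omega> n * (cmod (taylor g n))\<^sup>2)) sums
        (A * wnorm2 \<Omega> (taylor f) + B * wnorm2 \<Omega> (taylor g))"
      unfolding wnorm2_def using sf sg by (intro sums_add sums_mult summable_sums) (auto simp: wsummable_def)
    have sOb: "summable (\<lambda>n. \<Omega> n * b n)"
      by (rule summable_comparison_test'[OF sums_summable[OF sR]]) (use ble b0 in auto)
    have "(\<Sum>n=1..N. \<Omega> n * ((cmod (taylor h n))\<^sup>2 * r ^ (2 * n))) \<le> diff_const * (\<Sum>n. \<Omega> n * b n)"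
    proof (rule weighted_sum_le_of_cos_differences[OF _ _ sb b0 _ sOb])
      show "summable (\<lambda>n. (cmod (taylor h n))\<^sup>2 * r ^ (2 * n))"
        using Parseval_taylor[OF h r] by (auto simp: sums_iff)
      fix t :: real
      have in1: "cmod (of_real r * \<zeta>) < 1" "cmod (cis t * (of_real r * \<zeta>)) < 1" if "\<zeta> \<in> unit_circle" for \<zeta>
        using that r by (auto simp: norm_mult)
      have int: "integrable circle_measure (\<lambda>\<zeta>. (cmod (u (cis t * (of_real r * \<zeta>)) - u (of_real r * \<zeta>)))\<^sup>2)"
        if "u holomorphic_on ball 0 1" for u
        by (intro integrable_circle continuous_intros continuous_on_compose2[OF holomorphic_on_imp_continuous_on[OF that]])
          (use in1 in auto)
      have "(\<lambda>n. (2 - 2 * cos (real n * t)) * b n) sums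
         (A * (LINT \<zeta>|circle_measure. (cmod (f (cis t * (of_real r * \<zeta>)) - f (of_real r * \<zeta>)))\<^sup>2)
          + B * (LINT \<zeta>|circle_measure. (cmod (g (cis t * (of_real r * \<zeta>)) - g (of_real r * \<zeta>)))\<^sup>2))"
        using sums_add[OF sums_mult[OF rotation_diff_sums[OF f r, of t], of A] sums_mult[OF rotation_diff_sums[OF g r, of t], of B]]
        by (simp add: b_def algebra_simps)
      moreover have "(LINT \<zeta>|circle_measure. (cmod (h (cis t * (of_real r * \<zeta>)) - h (of_real r * \<zeta>)))\<^sup>2)
        \<le> (LINT \<zeta>|circle_measure. A * (cmod (f (cis t * (of_real r * \<zeta>)) - f (of_real r * \<zeta>)))\<^sup>2
          + B * (cmod (g (cis t * (of_real r * \<zeta>)) - g (of_real r * \<zeta>)))\<^sup>2)"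
        by (intro integral_mono int h f g Bochner_Integration.integrable_add integrable_mult_right le in1) auto
      ultimately show "(\<Sum>n. (2 - 2 * cos (real n * t)) * ((cmod (taylor h n))\<^sup>2 * r ^ (2 * n)))
          \<le> (\<Sum>n. (2 - 2 * cos (real n * t)) * b n)"
        using rotation_diff_sums[OF h r, of t] by (simp add: sums_iff int f g)
    qed (use r in auto)
    also have "(\<Sum>n. \<Omega> n * b n) \<le> A * wnorm2 \<Omega> (taylor f) + B * wnorm2 \<Omega> (taylor g)"
      using suminf_le[OF ble sOb sums_summable[OF sR]] sR by (simp add: sums_iff)
    finally show ?thesis using diff_const_nonneg by (simp add: mult_left_mono)
  qed
  have "((\<lambda>r. \<Sum>n=1..N. \<Omega> n * ((cmod (taylor h n))\<^sup>2 * r ^ (2 * n))) \<longlongrightarrow>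
      (\<Sum>n=1..N. \<Omega> n * ((cmod (taylor h n))\<^sup>2 * 1 ^ (2 * n)))) (at_left (1::real))"
    by (intro tendsto_intros)
  moreover have "eventually (\<lambda>r. r \<in> {0<..<1}) (at_left (1::real))"
    by (intro eventually_at_left_real) auto
  then have "eventually (\<lambda>r. (\<Sum>n=1..N. \<Omega> n * ((cmod (taylor h n))\<^sup>2 * r ^ (2 * n))) \<le> ?R) (at_left (1::real))"
    by eventually_elim (use bound in auto)
  ultimately show ?thesis
    using tendsto_upperbound[of _ _ "at_left (1::real)" ?R] by force
qed

text \<open>Differences determine \<open>h\<close> only up to a constant, hence the separate term
  with \<open>h 0\<close>.\<close>

lemma contraction:
  assumes h: "h holomorphic_on ball 0 1" and f: "f holomorphic_on ball 0 1" and g: "g holomorphic_on ball 0 1"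
    and AB: "0 \<le> A" "0 \<le> B"
    and le: "\<And>z w. cmod z < 1 \<Longrightarrow> cmod w < 1 \<Longrightarrow>
      (cmod (h z - h w))\<^sup>2 \<le> A * (cmod (f z - f w))\<^sup>2 + B * (cmod (g z - g w))\<^sup>2"
    and sf: "wsummable \<Omega> (taylor f)" and sg: "wsummable \<Omega> (taylor g)"
  shows "wsummable \<Omega> (taylor h)"
    and "wnorm2 \<Omega> (taylor h) \<le> \<Omega> 0 * (cmod (h 0))\<^sup>2 + diff_const * (A * wnorm2 \<Omega> (taylor f) + B * wnorm2 \<Omega> (taylor g))"
proof -
  let ?R = "diff_const * (A * wnorm2 \<Omega> (taylor f) + B * wnorm2 \<Omega> (taylor g))"
  have "(\<Sum>n<N. \<Omega> n * (cmod (taylor h n))\<^sup>2) \<le> \<Omega> 0 * (cmod (h 0))\<^sup>2 + ?R" for N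
  proof -
    have "(\<Sum>n<N. \<Omega> n * (cmod (taylor h n))\<^sup>2) \<le> (\<Sum>n\<in>insert 0 {1..N}. \<Omega> n * (cmod (taylor h n))\<^sup>2)"
      by (intro sum_mono2) auto
    also have "\<dots> = \<Omega> 0 * (cmod (h 0))\<^sup>2 + (\<Sum>n=1..N. \<Omega> n * (cmod (taylor h n))\<^sup>2)"
      by (simp add: taylor_def)
    also have "\<dots> \<le> \<Omega> 0 * (cmod (h 0))\<^sup>2 + ?R"
      using contraction_partial[OF assms, of N] by simp
    finally show ?thesis .
  qed
  then show "wsummable \<Omega> (taylor h)" "wnorm2 \<Omega> (taylor h) \<le> \<Omega> 0 * (cmod (h 0))\<^sup>2 + ?R"
    by (rule wsummable_bounded)+
qed

end

section \<open>Moment sequences and the potential kernel\<close>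

text \<open>The weight is reflected: \<open>w r\<close> stands for \<open>W (1 - r)\<close>, extended by \<open>0\<close> outside \<open>[0,1)\<close>.\<close>

locale moment_weight =
  fixes w :: "real \<Rightarrow> real"
  assumes w_int: "integrable lborel w"
    and w_nonneg: "0 \<le> w r"
    and w_supp: "r \<notin> {0..<1} \<Longrightarrow> w r = 0"
begin

lemma w_measurable [measurable]: "w \<in> borel_measurable lborel"
  using w_int by auto

definition mom :: "nat \<Rightarrow> real" where
  "mom n = (LINT r|lborel. r ^ n * w r)"

definition H :: "complex \<Rightarrow> complex" where
  "H z = (LINT r|lborel. of_real (w r) * ((1 + of_real r * z) / (1 - of_real r * z)))"

lemma integrable_w_mult:
  fixes g :: "real \<Rightarrow> complex"
  assumes [measurable]: "g \<in> borel_measurable lborel" and "\<And>r. r \<in> {0..<1} \<Longrightarrow> cmod (g r) \<le> B"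
  shows "integrable lborel (\<lambda>r. of_real (w r) * g r)"
    and "cmod (LINT r|lborel. of_real (w r) * g r) \<le> B * mom 0"
proof -
  have le: "cmod (of_real (w r) * g r) \<le> B * w r" for r
    using mult_left_mono[OF assms(2)[of r] w_nonneg[of r]] w_nonneg[of r] w_supp[of r]
    by (cases "r \<in> {0..<1}") (auto simp: norm_mult mult.commute)
  show i: "integrable lborel (\<lambda>r. of_real (w r) * g r)"
  proof (rule Bochner_Integration.integrable_bound)
    show "integrable lborel (\<lambda>r. B * w r)" using w_int by simp
    show "AE r in lborel. norm (of_real (w r) * g r) \<le> norm (B * w r)"
      using order_trans[OF le abs_ge_self] by (intro AE_I2) (simp only: real_norm_def)
  qed measurable
  have "cmod (LINT r|lborel. of_real (w r) * g r) \<le> (LINT r|lborel. B * w r)"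
    using le w_int i by (intro order_trans[OF integral_norm_bound] integral_mono integrable_norm) auto
  then show "cmod (LINT r|lborel. of_real (w r) * g r) \<le> B * mom 0"
    by (simp add: mom_def)
qed

lemma integrable_power_w: "integrable lborel (\<lambda>r. r ^ n * w r)"
proof (rule Bochner_Integration.integrable_bound[OF w_int])
  have "\<bar>r ^ n * w r\<bar> \<le> \<bar>w r\<bar>" for r
    using w_nonneg[of r] w_supp[of r] power_le_one[of r n]
    by (cases "r \<in> {0..<1}") (auto simp: abs_mult mult_left_le_one_le)
  then show "AE r in lborel. norm (r ^ n * w r) \<le> norm (w r)" by simp
qed measurable

lemma mom_nonneg: "0 \<le> mom n"
  unfolding mom_def
proof (rule integral_nonneg_AE, rule AE_I2)
  show "0 \<le> r ^ n * w r" for r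
    using w_nonneg[of r] w_supp[of r] by (cases "r \<in> {0..<1}") auto
qed

lemma mom_antimono: "m \<le> n \<Longrightarrow> mom n \<le> mom m"
  unfolding mom_def
proof (intro integral_mono integrable_power_w)
  fix r assume "m \<le> n"
  then show "r ^ n * w r \<le> r ^ m * w r"
    using w_nonneg[of r] w_supp[of r] by (cases "r \<in> {0..<1}") (auto intro!: mult_right_mono power_decreasing)
qed

lemma mom_pos_or_zero: "mom n = 0 \<Longrightarrow> mom 0 = 0"
proof -
  assume z: "mom n = 0"
  have nn: "0 \<le> r ^ n * w r" for r
    using w_nonneg[of r] w_supp[of r] by (cases "r \<in> {0..<1}") auto
  have "AE r in lborel. r ^ n * w r = 0"
    using integral_nonneg_eq_0_iff_AE[OF integrable_power_w AE_I2[OF nn]] z by (simp add: mom_def)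
  moreover have "AE r in lborel. r \<noteq> (0::real)"
    by (rule AE_lborel_singleton)
  ultimately have "AE r in lborel. w r = 0" by eventually_elim auto
  then show "mom 0 = 0"
    unfolding mom_def using integral_cong_AE[of w lborel "\<lambda>_. 0"] by simp
qed

text \<open>A quantitative form of \<open>z \<notin> [1, \<infinity>)\<close>.\<close>

definition sep :: "complex \<Rightarrow> real \<Rightarrow> bool" where
  "sep z c \<longleftrightarrow> 0 < c \<and> (\<forall>r\<in>{0..1}. c \<le> cmod (1 - of_real r * z))"

lemma sep_disc: "cmod z < 1 \<Longrightarrow> sep z (1 - cmod z)"
proof -
  assume z: "cmod z < 1"
  have "1 - cmod z \<le> cmod (1 - of_real r * z)" if "r \<in> {0..1}" for r
  proof -
    have "cmod (of_real r * z) \<le> 1 * cmod z"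
      unfolding norm_mult using that by (intro mult_right_mono) auto
    then show ?thesis using norm_triangle_ineq2[of 1 "of_real r * z"] by simp
  qed
  then show ?thesis using z by (simp add: sep_def)
qed

lemma sep_nz: "sep z c \<Longrightarrow> r \<in> {0..<1} \<Longrightarrow> 1 - of_real r * z \<noteq> 0"
  by (force simp: sep_def)

lemma sep_kernel_bound:
  assumes "sep z c" "r \<in> {0..<1}"
  shows "cmod (1 / (1 - of_real r * z)) \<le> 1 / c"
    and "cmod ((1 + of_real r * z) / (1 - of_real r * z)) \<le> (1 + cmod z) / c"
proof -
  have c: "0 < c" "c \<le> cmod (1 - of_real r * z)" using assms by (auto simp: sep_def)
  then show "cmod (1 / (1 - of_real r * z)) \<le> 1 / c"
    by (simp add: norm_divide frac_le)
  have "cmod (1 + of_real r * z) \<le> 1 + cmod (of_real r * z)" by (metis norm_one norm_triangle_ineq)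
  also have "cmod (of_real r * z) \<le> 1 * cmod z"
    unfolding norm_mult using assms by (intro mult_right_mono) auto
  finally show "cmod ((1 + of_real r * z) / (1 - of_real r * z)) \<le> (1 + cmod z) / c"
    unfolding norm_divide using c by (intro frac_le) auto
qed

lemma H_integrable:
  assumes "sep z c"
  shows "integrable lborel (\<lambda>r. of_real (w r) * ((1 + of_real r * z) / (1 - of_real r * z)))"
    and "integrable lborel (\<lambda>r. of_real (w r) * (1 / (1 - of_real r * z)))"
  by (rule integrable_w_mult; (rule sep_kernel_bound[OF assms])?; measurable)+

lemma H_bound: "sep z c \<Longrightarrow> cmod (H z) \<le> (1 + cmod z) / c * mom 0"
  unfolding H_def by (rule integrable_w_mult(2)) (measurable, rule sep_kernel_bound)

lemma H_field_differentiable: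
  assumes "sep z c"
  shows "H field_differentiable (at z)"
proof -
  have c: "c > 0" using assms by (simp add: sep_def)
  define D where "D = (LINT r|lborel. of_real (w r) * (2 * of_real r * (1 / (1 - of_real r * z))\<^sup>2))"
  have iD: "integrable lborel (\<lambda>r. of_real (w r) * (2 * of_real r * (1 / (1 - of_real r * z))\<^sup>2))"
  proof (rule integrable_w_mult)
    fix r :: real assume r: "r \<in> {0..<1}"
    have "cmod (2 * of_real r * (1 / (1 - of_real r * z))\<^sup>2) = 2 * r * (cmod (1 / (1 - of_real r * z)))\<^sup>2"
      using r by (simp add: norm_mult norm_power)
    also have "\<dots> \<le> 2 * 1 * (1 / c)\<^sup>2"
      using r by (intro mult_mono power_mono sep_kernel_bound[OF assms]) auto
    finally show "cmod (2 * of_real r * (1 / (1 - of_real r * z))\<^sup>2) \<le> 2 * 1 * (1 / c)\<^sup>2" .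
  qed measurable
  have bound: "cmod ((H (z + h) - H z) / h - D) \<le> 4 * mom 0 / c ^ 3 * cmod h"
    if h: "h \<noteq> 0" "cmod h < c / 2" for h
  proof -
    \<comment> \<open>Half the separation is given up so that one bound serves the kernel at
      \<open>z\<close> and at all nearby \<open>z + h\<close>.\<close>
    have sh: "sep (z + h) (c / 2)"
      unfolding sep_def
    proof (intro conjI ballI)
      fix r :: real assume r: "r \<in> {0..1}"
      have "cmod (of_real r * h) \<le> 1 * cmod h" unfolding norm_mult using r by (intro mult_right_mono) auto
      then have "cmod (1 - of_real r * z) - c / 2 \<le> cmod (1 - of_real r * z - of_real r * h)"
        using norm_triangle_ineq2[of "1 - of_real r * z" "of_real r * h"] h by simp
      moreover have "c \<le> cmod (1 - of_real r * z)" using assms r by (simp add: sep_def)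
      ultimately show "c / 2 \<le> cmod (1 - of_real r * (z + h))" by (simp add: algebra_simps)
    qed (use c in auto)
    \<comment> \<open>The exact remainder of the difference quotient: the kernel is
      \<open>2 / A - 1\<close> with \<open>A = 1 - r * z\<close>, and subtracting the derivative
      leaves \<open>2 * r\<^sup>2 * h / (A\<^sup>2 * B)\<close> with \<open>B = A - r * h\<close>.
      It is of order \<open>h\<close> uniformly in \<open>r\<close>.\<close>
    define q where "q r = 2 * (of_real r)\<^sup>2 * h * ((1 / (1 - of_real r * z))\<^sup>2 * (1 / (1 - of_real r * (z + h))))" for r :: real
    have "(H (z + h) - H z) / h - D = (LINT r|lborel. of_real (w r) * q r)"
    proof -
      have "(H (z + h) - H z) / h - D =
        (LINT r|lborel. (of_real (w r) * ((1 + of_real r * (z + h)) / (1 - of_real r * (z + h)))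
           - of_real (w r) * ((1 + of_real r * z) / (1 - of_real r * z))) / h
           - of_real (w r) * (2 * of_real r * (1 / (1 - of_real r * z))\<^sup>2))"
        unfolding H_def D_def
        by (simp only: Bochner_Integration.integral_diff integral_divide_zero Bochner_Integration.integrable_diff
          integrable_divide_zero H_integrable[OF sh] H_integrable[OF assms] iD simp_thms if_True)
      also have "\<dots> = (LINT r|lborel. of_real (w r) * q r)"
      proof (rule Bochner_Integration.integral_cong[OF refl])
        fix r :: real
        show "(of_real (w r) * ((1 + of_real r * (z + h)) / (1 - of_real r * (z + h)))
           - of_real (w r) * ((1 + of_real r * z) / (1 - of_real r * z))) / h
           - of_real (w r) * (2 * of_real r * (1 / (1 - of_real r * z))\<^sup>2) = of_real (w r) * q r"
        proof (cases "r \<in> {0..<1}")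
          case True
          define A where "A = 1 - of_real r * z"
          define B where "B = 1 - of_real r * (z + h)"
          have nz: "A \<noteq> 0" "B \<noteq> 0" using sep_nz[OF assms True] sep_nz[OF sh True] by (auto simp: A_def B_def)
          have e: "1 + of_real r * (z + h) = 2 - B" "1 + of_real r * z = 2 - A" "of_real r * h = A - B"
            by (auto simp: A_def B_def algebra_simps)
          have rh: "complex_of_real r = (A - B) / h" using e(3) h by (simp add: field_simps)
          show ?thesis
            unfolding q_def A_def[symmetric] B_def[symmetric] e(1,2) unfolding rh
            using nz h by (simp add: divide_simps power2_eq_square) (simp add: algebra_simps)
        qed (use w_supp in auto)
      qed
      finally show ?thesis .
    qed
    also have "cmod \<dots> \<le> (4 / c ^ 3 * cmod h) * mom 0"
    proof (rule integrable_w_mult(2))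
      show "q \<in> borel_measurable lborel" unfolding q_def by measurable
      fix r :: real assume r: "r \<in> {0..<1}"
      have "cmod (q r) = 2 * r\<^sup>2 * cmod h * ((cmod (1 / (1 - of_real r * z)))\<^sup>2 * cmod (1 / (1 - of_real r * (z + h))))"
        using r by (simp add: q_def norm_mult norm_power norm_divide)
      also have "\<dots> \<le> 2 * 1 * cmod h * ((1 / c)\<^sup>2 * (1 / (c / 2)))"
        using r c by (intro mult_mono power_mono sep_kernel_bound[OF assms] sep_kernel_bound[OF sh] power_le_one) auto
      also have "\<dots> = 4 / c ^ 3 * cmod h"
        using c by (simp add: field_simps power2_eq_square power3_eq_cube)
      finally show "cmod (q r) \<le> 4 / c ^ 3 * cmod h" .
    qed
    finally show ?thesis by (simp add: mult_ac)
  qed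
  have "((\<lambda>h. (H (z + h) - H z) / h - D) \<longlongrightarrow> 0) (at 0)"
  proof (rule Lim_null_comparison)
    show "eventually (\<lambda>h. norm ((H (z + h) - H z) / h - D) \<le> 4 * mom 0 / c ^ 3 * cmod h) (at 0)"
      unfolding eventually_at by (rule exI[of _ "c / 2"]) (use c bound in \<open>auto simp: dist_norm\<close>)
    show "((\<lambda>h. 4 * mom 0 / c ^ 3 * cmod h) \<longlongrightarrow> 0) (at (0::complex))"
      using c by (auto intro!: tendsto_eq_intros)
  qed
  then have "((\<lambda>h. (H (z + h) - H z) / h) \<longlongrightarrow> D) (at 0)"
    by (simp add: LIM_zero_iff)
  then have "(H has_field_derivative D) (at z)" by (simp add: DERIV_def)
  then show ?thesis using field_differentiable_def by blast
qed

definition Hcoeff :: "nat \<Rightarrow> real" where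
  "Hcoeff n = (if n = 0 then mom 0 else 2 * mom n)"

lemma Hcoeff_nonneg: "0 \<le> Hcoeff n"
  using mom_nonneg by (simp add: Hcoeff_def)

lemma H_sums:
  assumes z: "cmod z < 1"
  shows "(\<lambda>n. of_real (Hcoeff n) * z ^ n) sums H z"
proof -
  note sep = sep_disc[OF z]
  have e: "of_real (w r) * (of_real r * z) ^ n = of_real (r ^ n * w r) * z ^ n" for r n
    by (simp add: power_mult_distrib)
  have nr: "cmod (of_real r * z) \<le> cmod z" if "r \<in> {0..<1}" for r
    using that by (simp add: norm_mult mult_left_le_one_le)
  have i: "integrable lborel (\<lambda>r. of_real (w r) * (of_real r * z) ^ n)" for n
    unfolding e by (intro integrable_mult_left integrable_of_real integrable_power_w)
  have n: "norm (of_real (w r) * (of_real r * z) ^ n) \<le> w r * cmod z ^ n" for r n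
    using w_nonneg[of r] w_supp[of r] power_mono[OF nr[of r] norm_ge_zero, of n]
    by (cases "r \<in> {0..<1}") (auto simp: norm_mult norm_power intro!: mult_left_mono)
  have sg: "summable (\<lambda>n. k * cmod z ^ n)" for k :: real
    using z by (intro summable_mult summable_geometric) auto
  have "(\<lambda>n. LINT r|lborel. of_real (w r) * (of_real r * z) ^ n) sums
      (LINT r|lborel. (\<Sum>n. of_real (w r) * (of_real r * z) ^ n))"
  proof (rule sums_integral[OF i])
    show "AE r in lborel. summable (\<lambda>n. norm (of_real (w r) * (of_real r * z) ^ n))"
      by (intro AE_I2 summable_comparison_test'[OF sg]) (use n in auto)
    have "(LINT r|lborel. norm (of_real (w r) * (of_real r * z) ^ n)) \<le> mom 0 * cmod z ^ n" for n
    proof -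
      have "(LINT r|lborel. norm (of_real (w r) * (of_real r * z) ^ n)) \<le> (LINT r|lborel. w r * cmod z ^ n)"
        by (intro integral_mono integrable_norm i n) (use w_int in auto)
      then show ?thesis by (simp add: mom_def)
    qed
    then show "summable (\<lambda>n. LINT r|lborel. norm (of_real (w r) * (of_real r * z) ^ n))"
      by (intro summable_comparison_test'[OF sg]) (auto simp: integral_nonneg_AE)
  qed
  also have "(\<lambda>n. LINT r|lborel. of_real (w r) * (of_real r * z) ^ n) = (\<lambda>n. of_real (mom n) * z ^ n)"
    by (simp only: e mom_def integral_mult_left_zero integral_complex_of_real)
  also have "(LINT r|lborel. (\<Sum>n. of_real (w r) * (of_real r * z) ^ n))
      = (LINT r|lborel. of_real (w r) * (1 / (1 - of_real r * z)))"
  proof (rule Bochner_Integration.integral_cong[OF refl])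
    fix r :: real
    show "(\<Sum>n. of_real (w r) * (of_real r * z) ^ n) = of_real (w r) * (1 / (1 - of_real r * z))"
    proof (cases "r \<in> {0..<1}")
      case True
      then have "(\<lambda>n. (of_real r * z) ^ n) sums (1 / (1 - of_real r * z))"
        using nr[OF True] z by (intro geometric_sums) auto
      from sums_mult[OF this, of "of_real (w r)"] show ?thesis by (simp add: sums_iff)
    qed (simp add: w_supp)
  qed
  finally have S: "(\<lambda>n. of_real (mom n) * z ^ n) sums (LINT r|lborel. of_real (w r) * (1 / (1 - of_real r * z)))" (is "_ sums ?S") .
  \<comment> \<open>\<open>(1 + u) / (1 - u) = 2 / (1 - u) - 1\<close>, so the geometric series just
    summed appears doubled except at index 0.\<close>
  have "H z = (LINT r|lborel. 2 * (of_real (w r) * (1 / (1 - of_real r * z))) - of_real (w r))"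
    unfolding H_def
  proof (rule Bochner_Integration.integral_cong[OF refl])
    fix r :: real
    show "of_real (w r) * ((1 + of_real r * z) / (1 - of_real r * z)) =
        2 * (of_real (w r) * (1 / (1 - of_real r * z))) - of_real (w r)"
    proof (cases "r \<in> {0..<1}")
      case True
      then show ?thesis using sep_nz[OF sep True] by (simp add: divide_simps) (simp add: algebra_simps)
    qed (simp add: w_supp)
  qed
  also have "\<dots> = 2 * ?S - (LINT r|lborel. of_real (w r))"
  proof -
    have "integrable lborel (\<lambda>r. 2 * (of_real (w r) * (1 / (1 - of_real r * z))))"
      by (intro integrable_mult_right H_integrable[OF sep])
    moreover have "integrable lborel (\<lambda>r. complex_of_real (w r))"
      using w_int by (rule integrable_of_real)
    ultimately show ?thesis
      by (simp only: Bochner_Integration.integral_diff integral_mult_right_zero)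
  qed
  also have "\<dots> = 2 * ?S - of_real (mom 0)"
    by (simp add: mom_def)
  finally have HS: "H z = 2 * ?S - of_real (mom 0)" .
  have "(\<lambda>n. 2 * (of_real (mom n) * z ^ n) - (if n \<in> {0} then of_real (mom 0) else 0)) sums (2 * ?S - (\<Sum>n\<in>{0::nat}. of_real (mom 0)))"
    by (intro sums_diff sums_mult S sums_If_finite_set) auto
  moreover have "(\<lambda>n. 2 * (of_real (mom n) * z ^ n) - (if n \<in> {0} then of_real (mom 0) else 0)) = (\<lambda>n. of_real (Hcoeff n) * z ^ n)"
    by (auto simp: Hcoeff_def fun_eq_iff)
  ultimately show ?thesis by (simp add: HS)
qed

text \<open>The Taylor coefficients are real. This is what makes the energy kernel symmetric in its
  two arguments.\<close>

lemma H_cnj: "cmod z < 1 \<Longrightarrow> H (cnj z) = cnj (H z)"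
  using H_sums[of z] H_sums[of "cnj z"] sums_cnj[of "\<lambda>n. of_real (Hcoeff n) * z ^ n" "H z"]
  by (simp add: sums_unique2)

lemma Re_H_nonneg:
  assumes z: "cmod z < 1"
  shows "0 \<le> Re (H z)"
proof -
  have "Re (H z) = (LINT r|lborel. Re (of_real (w r) * ((1 + of_real r * z) / (1 - of_real r * z))))"
    unfolding H_def using H_integrable[OF sep_disc[OF z]] by (intro integral_Re[symmetric])
  also have "\<dots> \<ge> 0"
  proof (intro integral_nonneg_AE AE_I2)
    fix r :: real
    show "0 \<le> Re (of_real (w r) * ((1 + of_real r * z) / (1 - of_real r * z)))"
    proof (cases "r \<in> {0..<1}")
      case True
      define u where "u = of_real r * z"
      have "cmod u \<le> 1" using True z by (simp add: u_def norm_mult mult_le_one)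
      then have u: "(cmod u)\<^sup>2 \<le> 1" by (intro power_le_one) auto
      have "Re ((1 + u) / (1 - u)) = (1 - (cmod u)\<^sup>2) / (cmod (1 - u))\<^sup>2"
        unfolding cmod_power2 Re_divide by (simp add: power2_eq_square algebra_simps)
      then have "0 \<le> Re ((1 + u) / (1 - u))" using u by simp
      moreover have "Re (of_real a * b) = a * Re b" for a b by simp
      ultimately show ?thesis
        using w_nonneg[of r] by (simp only: u_def[symmetric] mult_nonneg_nonneg)
    qed (simp add: w_supp)
  qed
  finally show ?thesis .
qed

end

lemma moment_weight_reflect:
  assumes "weight W"
  shows "moment_weight (\<lambda>r. indicator {0..<1} r * W (1 - r))"
    and "(LINT r|lborel. indicator {0..<1} r * W (1 - r)) = (LINT t|lborel. indicator {0<..1} t * W t)"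
    and "moment_weight.mom (\<lambda>r. indicator {0..<1} r * W (1 - r)) n = moment_seq W n"
proof -
  have i: "integrable lborel (\<lambda>t. indicator {0<..1} t * W t)"
    using assms by (simp add: weight_def set_integrable_def)
  have e: "(\<lambda>r. indicator {0<..1} (1 + - 1 * r) * W (1 + - 1 * r)) = (\<lambda>r. indicator {0..<1} r * W (1 - r))"
    by (auto simp: fun_eq_iff split: split_indicator)
  have "integrable lborel (\<lambda>r. indicator {0..<1} r * W (1 - r))"
    using lborel_integrable_real_affine[OF i, of "- 1" 1] unfolding e by simp
  moreover have "0 \<le> indicator {0..<1} r * W (1 - r)" for r
    using assms by (auto simp: weight_def split: split_indicator)
  ultimately show mw: "moment_weight (\<lambda>r. indicator {0..<1} r * W (1 - r))"
    by unfold_locales auto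
  show "(LINT r|lborel. indicator {0..<1} r * W (1 - r)) = (LINT t|lborel. indicator {0<..1} t * W t)"
    using lborel_integral_real_affine[of "- 1" "\<lambda>t. indicator {0<..1} t * W t" 1] unfolding e by simp
  show "moment_weight.mom (\<lambda>r. indicator {0..<1} r * W (1 - r)) n = moment_seq W n"
    unfolding moment_weight.mom_def[OF mw] moment_seq_def set_lebesgue_integral_def
    by (intro Bochner_Integration.integral_cong) auto
qed

text \<open>A vanishing moment forces \<open>W = 0\<close> almost everywhere, and then the integral
  in \<open>cond_C2\<close> would be 0.\<close>

lemma moment_seq_pos:
  assumes W: "weight W" and "cond_C2 W"
  shows "0 < moment_seq W n"
proof -
  interpret moment_weight "\<lambda>r. indicator {0..<1} r * W (1 - r)"
    by (rule moment_weight_reflect[OF W])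
  have "mom n \<noteq> 0"
  proof
    assume "mom n = 0"
    then have "mom 0 = 0" by (rule mom_pos_or_zero)
    then have z: "(LINT t|lborel. indicator {0<..1} t * W t) = 0"
      using moment_weight_reflect(2)[OF W] by (simp add: mom_def)
    have i: "integrable lborel (\<lambda>t. indicator {0<..1} t * W t)"
      using W by (simp add: weight_def set_integrable_def)
    have "AE t in lborel. indicator {0<..1} t * W t = 0"
      using W by (subst integral_nonneg_eq_0_iff_AE[OF i, symmetric]) (auto simp: z weight_def split: split_indicator)
    then have "(\<integral>\<^sup>+t\<in>{0<..1}. ennreal (W t / t) \<partial>lborel) = (\<integral>\<^sup>+t. 0 \<partial>(lborel :: real measure))"
      by (intro nn_integral_cong_AE) (auto split: split_indicator_asm elim!: eventually_mono split: split_indicator)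
    then show False using assms(2) by (simp add: cond_C2_def)
  qed
  then show ?thesis
    using mom_nonneg[of n] moment_weight_reflect(3)[OF W, of n] by simp
qed

text \<open>The substitution \<open>r = x\<^sup>2\<close> turns the \<open>n\<close>-th moment into
  an integral of \<open>x ^ (2 * n)\<close> against \<open>2 * x * w (x\<^sup>2)\<close>, and
  \<open>W (1 - x\<^sup>2) \<le> k * W (1 - x)\<close> with \<open>k < 2\<close>. The resulting
  constant is \<open>2 * k\<close>.\<close>

lemma moment_seq_double:
  assumes W: "weight W" and C1: "cond_C1 W" and C3: "cond_C3 W"
  obtains C where "0 < C" "C < 4" "\<And>n. moment_seq W n \<le> C * moment_seq W (2 * n)"
proof -
  obtain c where c: "0 < c" "c < 2" "\<And>t. 0 < t \<Longrightarrow> t < 1 \<Longrightarrow> W t \<le> c * W (t / 2)"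
    using C3 by (auto simp: cond_C3_def)
  \<comment> \<open>The 1 serves the non-increasing case, where
    \<open>1 - r \<le> 1 - r\<^sup>2\<close> already gives the inequality with constant 1;
    \<open>c\<close> serves the non-decreasing case through
    \<open>(1 - r\<^sup>2) / 2 \<le> 1 - r\<close>.\<close>
  define k where "k = max 1 c"
  have Wle: "W (1 - r\<^sup>2) \<le> k * W (1 - r)" if r: "0 < r" "r < 1" for r
  proof -
    have r2: "0 < r\<^sup>2" "r\<^sup>2 < 1" using r by (auto simp: power_less_one_iff)
    have W0: "0 \<le> W (1 - r)" using W r by (auto simp: weight_def)
    have cW: "c * W (1 - r) \<le> k * W (1 - r)" "W (1 - r) \<le> k * W (1 - r)"
      using W0 mult_right_mono[of 1 k "W (1 - r)"] by (auto simp: k_def intro: mult_right_mono)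
    from C1 show ?thesis unfolding cond_C1_def
    proof
      assume mono: "mono_on {0<..1} W"
      have "(1 - r\<^sup>2) / 2 \<le> 1 - r"
        using zero_le_power2[of "1 - r"] by (simp add: power2_eq_square field_simps)
      then have "W ((1 - r\<^sup>2) / 2) \<le> W (1 - r)"
        using r r2 by (intro monotone_onD[OF mono]) simp_all
      then have "c * W ((1 - r\<^sup>2) / 2) \<le> c * W (1 - r)" using c by simp
      then show ?thesis using c(3)[of "1 - r\<^sup>2"] r2 cW by simp
    next
      assume anti: "antimono_on {0<..1} W"
      have "1 - r \<le> 1 - r\<^sup>2" using r by (simp add: power2_eq_square mult_left_le_one_le)
      then have "W (1 - r\<^sup>2) \<le> W (1 - r)"
        using monotone_onD[OF anti, of "1 - r" "1 - r\<^sup>2"] r r2 by auto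
      then show ?thesis using cW by simp
    qed
  qed
  define w where "w = (\<lambda>r. indicator {0..<1} r * W (1 - r))"
  interpret moment_weight w
    unfolding w_def by (rule moment_weight_reflect[OF W])
  have m: "moment_seq W n = mom n" for n
    using moment_weight_reflect(3)[OF W] by (simp add: w_def)
  have "mom n \<le> 2 * k * mom (2 * n)" for n
  proof -
    \<comment> \<open>The interval is written \<open>{0\<^sup>2..1\<^sup>2}\<close> to match the
      substitution rule for squaring.\<close>
    have s: "set_integrable lborel {0\<^sup>2..1\<^sup>2} (\<lambda>r::real. r ^ n * w r)"
      using integrable_power_w[of n] unfolding set_integrable_def by (intro integrable_mult_indicator) auto
    have d: "(power2 has_real_derivative 2 * x) (at x)" for x :: real
      by (auto intro!: derivative_eq_intros)
    have c: "continuous_on {0..1} (\<lambda>x::real. 2 * x)"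
      by (intro continuous_intros)
    have "mom n = (LBINT x. (x ^ n * w x) * indicator {0\<^sup>2..1\<^sup>2} x)"
      unfolding mom_def using w_supp
      by (intro Bochner_Integration.integral_cong refl) (auto split: split_indicator)
    also have "\<dots> = (LBINT x. ((x\<^sup>2) ^ n * w (x\<^sup>2)) * (2 * x) * indicator {0..1} x)"
      by (rule integral_substitution(2)[where g' = "\<lambda>x::real. 2 * x"]) (use s d in \<open>auto intro!: continuous_intros\<close>)
    also have "\<dots> \<le> (LBINT x. 2 * k * (x ^ (2 * n) * w x))"
    proof (intro integral_mono)
      show "integrable lborel (\<lambda>x. ((x\<^sup>2) ^ n * w (x\<^sup>2)) * (2 * x) * indicator {0..1} x)"
        using integral_substitution(1)[where a = 0 and b = 1 and g = power2 and g' = "\<lambda>x::real. 2 * x", OF s d c]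
        by (auto simp: set_integrable_def mult_ac)
      show "integrable lborel (\<lambda>x. 2 * k * (x ^ (2 * n) * w x))"
        by (intro integrable_mult_right integrable_power_w)
      fix x :: real
      have k: "0 \<le> k" by (simp add: k_def)
      show "((x\<^sup>2) ^ n * w (x\<^sup>2)) * (2 * x) * indicator {0..1} x \<le> 2 * k * (x ^ (2 * n) * w x)"
      proof (cases "0 < x \<and> x < 1")
        case True
        then have x: "0 < x" "x < 1" "x\<^sup>2 < 1" by (auto simp: power_less_one_iff)
        have "x ^ (2 * n) * (W (1 - x\<^sup>2) * (2 * x)) \<le> x ^ (2 * n) * ((k * W (1 - x)) * (2 * 1))"
          using x k W by (intro mult_left_mono mult_mono Wle mult_nonneg_nonneg) (auto simp: weight_def)
        moreover have "w (x\<^sup>2) = W (1 - x\<^sup>2)" "w x = W (1 - x)" using x by (auto simp: w_def)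
        ultimately show ?thesis
          using x unfolding power_mult[symmetric] by (simp only: atLeastAtMost_iff less_imp_le indicator_simps mult_1_right mult_ac simp_thms)
      next
        case False
        then have "x = 0 \<or> x < 0 \<or> x \<ge> 1" by auto
        moreover have "0 \<le> x ^ (2 * n) * w x"
          using w_nonneg by (auto simp: power_mult)
        moreover have "x = 1 \<Longrightarrow> w (x\<^sup>2) = 0" by (simp add: w_supp)
        ultimately show ?thesis using k by (auto split: split_indicator)
      qed
    qed
    also have "\<dots> = 2 * k * mom (2 * n)" by (simp add: mom_def)
    finally show ?thesis .
  qed
  then show ?thesis
    using c by (intro that[of "2 * k"]) (auto simp: k_def m)
qed

section \<open>Sets of zero capacity carry small functions with large real part\<close>

definition fin_prob :: "complex set \<Rightarrow> complex set \<Rightarrow> (complex \<Rightarrow> real) \<Rightarrow> bool" where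
  "fin_prob E S p \<longleftrightarrow> finite S \<and> S \<subseteq> E \<and> (\<forall>y\<in>S. 0 \<le> p y) \<and> sum p S = 1"

text \<open>Integration against the mixture of \<open>p\<close> and a point mass at
  \<open>x\<close>. The conditionals allow for \<open>x\<close> lying inside or outside
  \<open>S\<close>.\<close>

lemma mixture_sum:
  fixes g :: "complex \<Rightarrow> 'a::real_vector"
  assumes "finite S"
  shows "(\<Sum>y\<in>insert x S. ((1 - t) * (if y \<in> S then p y else 0) + (if y = x then t else 0)) *\<^sub>R g y)
    = (1 - t) *\<^sub>R (\<Sum>y\<in>S. p y *\<^sub>R g y) + t *\<^sub>R g x"
proof -
  have "(\<Sum>y\<in>insert x S. ((1 - t) * (if y \<in> S then p y else 0) + (if y = x then t else 0)) *\<^sub>R g y)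
     = (\<Sum>y\<in>insert x S. (1 - t) *\<^sub>R (if y \<in> S then p y *\<^sub>R g y else 0) + (if y = x then t *\<^sub>R g y else 0))"
    by (intro sum.cong) (auto simp: scaleR_add_left)
  also have "\<dots> = (1 - t) *\<^sub>R (\<Sum>y\<in>insert x S. if y \<in> S then p y *\<^sub>R g y else 0) + (\<Sum>y\<in>insert x S. if y = x then t *\<^sub>R g y else 0)"
    by (simp only: sum.distrib scaleR_sum_right)
  also have "(\<Sum>y\<in>insert x S. if y \<in> S then p y *\<^sub>R g y else 0) = (\<Sum>y\<in>S. p y *\<^sub>R g y)"
    using assms by (intro sum.mono_neutral_cong_right) auto
  also have "(\<Sum>y\<in>insert x S. if y = x then t *\<^sub>R g y else 0) = t *\<^sub>R g x"
    using assms by (subst sum.delta) auto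
  finally show ?thesis .
qed

locale positive_moments = moment_weight +
  assumes mom0: "mom 0 > 0"
begin

lemma mom_pos: "mom n > 0"
  using mom_pos_or_zero[of n] mom_nonneg[of n] mom0 by (cases "mom n = 0") auto

text \<open>The analytic completion of the potential: its real part is the potential for the kernel
  \<open>Re (H (\<rho> * u))\<close>, and for \<open>0 < \<rho>\<close> it is analytic in the disc
  of radius \<open>1 / \<rho>\<close> when \<open>S\<close> lies on the circle.\<close>

definition pot :: "real \<Rightarrow> complex set \<Rightarrow> (complex \<Rightarrow> real) \<Rightarrow> complex \<Rightarrow> complex" where
  "pot \<rho> S p z = (\<Sum>y\<in>S. p y *\<^sub>R H (of_real \<rho> * (z * cnj y)))"

definition en :: "real \<Rightarrow> complex set \<Rightarrow> (complex \<Rightarrow> real) \<Rightarrow> real" where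
  "en \<rho> S p = (\<Sum>x\<in>S. p x * Re (pot \<rho> S p x))"

text \<open>The Fourier coefficient at \<open>- n\<close> of the measure, in the sign convention of
  \<open>fourier_measure\<close>.\<close>

definition hat :: "complex set \<Rightarrow> (complex \<Rightarrow> real) \<Rightarrow> nat \<Rightarrow> complex" where
  "hat S p n = (\<Sum>y\<in>S. p y *\<^sub>R y ^ n)"

lemma pot_sums:
  assumes "finite S" "S \<subseteq> unit_circle" "0 \<le> \<rho>" "\<rho> * cmod z < 1"
  shows "(\<lambda>n. (of_real (Hcoeff n * \<rho> ^ n) * cnj (hat S p n)) * z ^ n) sums pot \<rho> S p z"
proof -
  have "(\<lambda>n. \<Sum>y\<in>S. p y *\<^sub>R (of_real (Hcoeff n) * (of_real \<rho> * (z * cnj y)) ^ n)) sums pot \<rho> S p z"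
    unfolding pot_def
  proof (intro sums_sum sums_scaleR_right H_sums)
    fix y assume "y \<in> S"
    then have "cmod y = 1" using assms by auto
    then show "cmod (of_real \<rho> * (z * cnj y)) < 1" using assms by (simp add: norm_mult)
  qed
  moreover have "(\<Sum>y\<in>S. p y *\<^sub>R (of_real (Hcoeff n) * (of_real \<rho> * (z * cnj y)) ^ n))
      = (of_real (Hcoeff n * \<rho> ^ n) * cnj (hat S p n)) * z ^ n" for n
    by (simp add: hat_def sum_distrib_left sum_distrib_right power_mult_distrib scaleR_conv_of_real mult_ac)
  ultimately show ?thesis by simp
qed

text \<open>In terms of coefficients the energy is a sum of squares with nonnegative weights. The
  same coefficients occur in the Taylor series of the potential, by \<open>pot_sums\<close>.\<close>

lemma en_sums:
  assumes "finite S" "S \<subseteq> unit_circle" "0 < \<rho>" "\<rho> < 1"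
  shows "(\<lambda>n. Hcoeff n * \<rho> ^ n * (cmod (hat S p n))\<^sup>2) sums en \<rho> S p"
proof -
  have "(\<lambda>n. \<Sum>x\<in>S. p x * Re ((of_real (Hcoeff n * \<rho> ^ n) * cnj (hat S p n)) * x ^ n)) sums en \<rho> S p"
    unfolding en_def
  proof (intro sums_sum sums_mult sums_Re pot_sums)
    fix x assume "x \<in> S"
    then have "cmod x = 1" using assms by auto
    then show "\<rho> * cmod x < 1" using assms by simp
  qed (use assms in auto)
  moreover have "(\<Sum>x\<in>S. p x * Re ((of_real (Hcoeff n * \<rho> ^ n) * cnj (hat S p n)) * x ^ n))
      = Hcoeff n * \<rho> ^ n * (cmod (hat S p n))\<^sup>2" for n
  proof -
    define A where "A = of_real (Hcoeff n * \<rho> ^ n) * cnj (hat S p n)"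
    have "(\<Sum>x\<in>S. p x * Re (A * x ^ n)) = Re (\<Sum>x\<in>S. A * (p x *\<^sub>R x ^ n))"
      by (simp add: algebra_simps)
    also have "\<dots> = Re (A * hat S p n)"
      by (simp add: hat_def sum_distrib_left)
    also have "A * hat S p n = of_real (Hcoeff n * \<rho> ^ n) * (hat S p n * cnj (hat S p n))"
      by (simp add: A_def)
    also have "Re \<dots> = Hcoeff n * \<rho> ^ n * (cmod (hat S p n))\<^sup>2"
      unfolding complex_norm_square[symmetric] by (simp flip: of_real_mult of_real_power)
    also note A_def
    finally show ?thesis .
  qed
  ultimately show ?thesis by simp
qed

text \<open>With \<open>s = r * \<rho>\<close>, the distance from \<open>s * \<zeta>\<close> to
  \<open>\<zeta>\<close> is \<open>(1 - s) * cmod \<zeta>\<close>, at most the distance from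
  \<open>s * \<zeta>\<close> to the circle point \<open>y\<close>; so \<open>y\<close> is at least
  \<open>d / 2\<close> away from \<open>s * \<zeta>\<close>. Replacing \<open>\<zeta>\<close> by
  \<open>z\<close> costs at most \<open>d / 4\<close>.\<close>

lemma sep_away:
  assumes "cmod \<zeta> \<le> 1" "0 < d" "d \<le> dist \<zeta> y" "cmod y = 1" "z \<in> ball \<zeta> (d / 4)" "0 \<le> \<rho>" "\<rho> \<le> 1" "d \<le> 1"
  shows "sep (of_real \<rho> * (z * cnj y)) (d / 4)"
  unfolding sep_def
proof (intro conjI ballI)
  show "0 < d / 4" using assms by simp
  fix r :: real assume r: "r \<in> {0..1}"
  define s where "s = r * \<rho>"
  have s: "0 \<le> s" "s \<le> 1" using r assms by (auto simp: s_def mult_le_one)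
  have "y * cnj y = 1" using assms by (simp flip: complex_norm_square)
  then have "1 - of_real r * (of_real \<rho> * (z * cnj y)) = cnj y * (y - of_real s * z)"
    by (simp add: s_def algebra_simps)
  then have e: "cmod (1 - of_real r * (of_real \<rho> * (z * cnj y))) = cmod (y - of_real s * z)"
    using assms by (simp only: norm_mult complex_mod_cnj mult_1_left)
  have "dist \<zeta> y \<le> cmod (y - of_real s * \<zeta>) + cmod (of_real (1 - s) * \<zeta>)"
  proof -
    have "y - \<zeta> = (y - of_real s * \<zeta>) - of_real (1 - s) * \<zeta>" by (simp add: algebra_simps)
    then show ?thesis by (metis dist_norm norm_minus_commute norm_triangle_ineq4)
  qed
  also have "cmod (of_real (1 - s) * \<zeta>) = (1 - s) * cmod \<zeta>"
    using s by (simp only: norm_mult norm_of_real)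
  also have "\<dots> \<le> 1 - s * cmod \<zeta>" using assms by (simp add: algebra_simps)
  also have "\<dots> \<le> cmod (y - of_real s * \<zeta>)"
    using norm_triangle_ineq2[of y "of_real s * \<zeta>"] assms s by (simp add: norm_mult)
  finally have 1: "d / 2 \<le> cmod (y - of_real s * \<zeta>)" using assms by simp
  have "cmod (of_real s * (z - \<zeta>)) \<le> 1 * cmod (z - \<zeta>)"
    unfolding norm_mult using s by (intro mult_right_mono) auto
  then have 2: "cmod (of_real s * (z - \<zeta>)) \<le> d / 4"
    using assms by (simp add: dist_norm norm_minus_commute)
  have "y - of_real s * z = (y - of_real s * \<zeta>) - of_real s * (z - \<zeta>)" by (simp add: algebra_simps)
  then have "cmod (y - of_real s * \<zeta>) - cmod (of_real s * (z - \<zeta>)) \<le> cmod (y - of_real s * z)"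
    by (metis norm_triangle_ineq2)
  then show "d / 4 \<le> cmod (1 - of_real r * (of_real \<rho> * (z * cnj y)))"
    unfolding e using 1 2 by linarith
qed

lemma pot_holomorphic:
  assumes "open U" "\<And>y z. y \<in> S \<Longrightarrow> z \<in> U \<Longrightarrow> \<exists>c. sep (of_real \<rho> * (z * cnj y)) c"
  shows "pot \<rho> S p holomorphic_on U"
proof -
  have "(\<lambda>z. \<Sum>y\<in>S. of_real (p y) * H (of_real \<rho> * (z * cnj y))) holomorphic_on U"
  proof (intro holomorphic_on_sum holomorphic_on_mult holomorphic_on_const)
    fix y assume y: "y \<in> S"
    have "(H \<circ> (\<lambda>z. of_real \<rho> * (z * cnj y))) field_differentiable (at z)" if "z \<in> U" for z
    proof (rule field_differentiable_compose)
      show "(\<lambda>z. of_real \<rho> * (z * cnj y)) field_differentiable (at z)"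
        by (intro derivative_intros)
      show "H field_differentiable (at (of_real \<rho> * (z * cnj y)))"
        using assms(2)[OF y that] H_field_differentiable by blast
    qed
    then show "(\<lambda>z. H (of_real \<rho> * (z * cnj y))) holomorphic_on U"
      unfolding holomorphic_on_def o_def by (blast intro: field_differentiable_at_within)
  qed
  then show ?thesis by (simp add: pot_def[abs_def] scaleR_conv_of_real)
qed

lemma pot_bound:
  assumes "fin_prob E S p" "\<And>y. y \<in> S \<Longrightarrow> sep (of_real \<rho> * (z * cnj y)) c" "S \<subseteq> unit_circle" "0 \<le> \<rho>" "\<rho> \<le> 1" "0 < c"
  shows "cmod (pot \<rho> S p z) \<le> (1 + cmod z) / c * mom 0"
proof -
  have "cmod (pot \<rho> S p z) \<le> (\<Sum>y\<in>S. cmod (p y *\<^sub>R H (of_real \<rho> * (z * cnj y))))"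
    unfolding pot_def by (rule norm_sum)
  also have "\<dots> \<le> (\<Sum>y\<in>S. p y * ((1 + cmod z) / c * mom 0))"
  proof (intro sum_mono)
    fix y assume y: "y \<in> S"
    then have "cmod y = 1" using assms by auto
    then have "cmod (of_real \<rho> * (z * cnj y)) \<le> cmod z"
      using assms by (simp add: norm_mult mult_left_le_one_le)
    then have "(1 + cmod (of_real \<rho> * (z * cnj y))) / c * mom 0 \<le> (1 + cmod z) / c * mom 0"
      using assms mom0 by (intro mult_right_mono divide_right_mono) auto
    then have "cmod (H (of_real \<rho> * (z * cnj y))) \<le> (1 + cmod z) / c * mom 0"
      using H_bound[OF assms(2)[OF y]] by linarith
    then show "cmod (p y *\<^sub>R H (of_real \<rho> * (z * cnj y))) \<le> p y * ((1 + cmod z) / c * mom 0)"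
      unfolding norm_scaleR using assms(1) y by (intro mult_mono) (auto simp: fin_prob_def)
  qed
  also have "\<dots> = (1 + cmod z) / c * mom 0"
    using assms(1) by (subst sum_distrib_right[symmetric]) (simp add: fin_prob_def)
  finally show ?thesis .
qed

text \<open>A near-minimiser of the energy among the finitely supported probability measures on \<open>E\<close> has a
  large potential on all of \<open>E\<close>: otherwise moving a little mass to a point of low potential would
  lower the energy below its infimum.\<close>

lemma near_minimiser:
  assumes E: "E \<subseteq> unit_circle" "E \<noteq> {}" and \<rho>: "0 < \<rho>" "\<rho> < 1" and "0 < M"
    and M: "\<And>S p. fin_prob E S p \<Longrightarrow> M \<le> en \<rho> S p"
  obtains S p I where "fin_prob E S p" "M \<le> I" "en \<rho> S p \<le> 2 * I" "\<And>x. x \<in> E \<Longrightarrow> I / 2 \<le> Re (pot \<rho> S p x)"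
proof -
  define X where "X = {en \<rho> S p | S p. fin_prob E S p}"
  obtain x0 where "x0 \<in> E" using E by auto
  then have "fin_prob E {x0} (\<lambda>_. 1)" by (simp add: fin_prob_def)
  then have Xne: "X \<noteq> {}" by (auto simp: X_def)
  have bdd: "bdd_below X" using M by (auto simp: X_def bdd_below_def)
  define I where "I = Inf X"
  have IM: "M \<le> I" unfolding I_def by (intro cInf_greatest Xne) (use M in \<open>auto simp: X_def\<close>)
  define B where "B = Re (H (of_real \<rho>))"
  have B: "0 \<le> B" unfolding B_def using \<rho> by (intro Re_H_nonneg) auto
  \<comment> \<open>The mass to be moved, small enough for the error \<open>t * (1 + B)\<close> to
    be absorbed by \<open>I / 2\<close>.\<close>
  define t where "t = min (1/2) (I / (2 * (1 + B)))"
  have t: "0 < t" "t \<le> 1/2" "t * (1 + B) \<le> I / 2"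
  proof -
    show "0 < t" using IM \<open>0 < M\<close> B by (simp add: t_def)
    show "t \<le> 1/2" unfolding t_def by (rule min.cobounded1)
    have "t * (1 + B) \<le> I / (2 * (1 + B)) * (1 + B)" using B by (intro mult_right_mono) (auto simp: t_def)
    also have "\<dots> = I / 2" using B by (simp add: field_simps)
    finally show "t * (1 + B) \<le> I / 2" .
  qed
  have tI: "t * t \<le> I / 2"
  proof -
    have "t * t \<le> t * (1 + B)" using t B by (intro mult_left_mono) auto
    then show ?thesis using t by linarith
  qed
  \<comment> \<open>The tolerance is of second order in \<open>t\<close>, whereas a point of low
    potential would lower the energy to first order. After division by \<open>t\<close>, the
    tolerance and the self-energy \<open>B\<close> together leave
    \<open>t * (1 + B)\<close>.\<close>
  have "I < I + t * t" using t by simp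
  then obtain e where "e \<in> X" "e < I + t * t"
    unfolding I_def using cInf_lessD[OF Xne] by blast
  then obtain S p where Sp: "fin_prob E S p" "en \<rho> S p < I + t * t"
    by (auto simp: X_def)
  have fin: "finite S" and SE: "S \<subseteq> E" using Sp by (auto simp: fin_prob_def)
  have eI: "I \<le> en \<rho> S p" unfolding I_def using Sp by (intro cInf_lower bdd) (auto simp: X_def)
  have "I / 2 \<le> Re (pot \<rho> S p x)" if x: "x \<in> E" for x
  proof -
    define p' where "p' y = (1 - t) * (if y \<in> S then p y else 0) + (if y = x then t else 0)" for y
    define S' where "S' = insert x S"
    have mix: "(\<Sum>y\<in>S'. p' y *\<^sub>R g y) = (1 - t) *\<^sub>R (\<Sum>y\<in>S. p y *\<^sub>R g y) + t *\<^sub>R g x" for g :: "complex \<Rightarrow> 'b::real_vector"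
      unfolding p'_def S'_def by (rule mixture_sum[OF fin])
    have "sum p' S' = 1"
      using mix[of "\<lambda>_. 1::real"] Sp(1) by (simp add: fin_prob_def)
    then have fp': "fin_prob E S' p'"
      using Sp(1) x t by (auto simp: fin_prob_def S'_def p'_def)
    define \<kappa> where "\<kappa> u v = Re (H (of_real \<rho> * (u * cnj v)))" for u v
    have ksym: "\<kappa> u v = \<kappa> v u" if "u \<in> unit_circle" "v \<in> unit_circle" for u v
      using H_cnj[of "of_real \<rho> * (u * cnj v)"] that \<rho> by (simp add: \<kappa>_def norm_mult mult.commute)
    have "x * cnj x = 1" using x E by (auto simp flip: complex_norm_square)
    then have kxx: "\<kappa> x x = B" by (simp add: \<kappa>_def B_def)
    have Repot: "Re (pot \<rho> T q u) = (\<Sum>y\<in>T. q y *\<^sub>R \<kappa> u y)" for T q u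
      by (simp add: pot_def \<kappa>_def)
    have pot': "Re (pot \<rho> S' p' u) = (1 - t) * Re (pot \<rho> S p u) + t * \<kappa> u x" for u
      unfolding Repot mix by simp
    have ks: "(\<Sum>y\<in>S. p y * \<kappa> y x) = Re (pot \<rho> S p x)"
      unfolding Repot real_scaleR_def using SE E x by (intro sum.cong refl arg_cong2[where f = "(*)"] ksym) auto
    have "en \<rho> S' p' = (1 - t) * (\<Sum>u\<in>S. p u * Re (pot \<rho> S' p' u)) + t * Re (pot \<rho> S' p' x)"
      using mix[of "\<lambda>u. Re (pot \<rho> S' p' u)"] by (simp add: en_def)
    also have "(\<Sum>u\<in>S. p u * Re (pot \<rho> S' p' u)) = (1 - t) * en \<rho> S p + t * Re (pot \<rho> S p x)"
      unfolding pot' ks[symmetric] en_def by (simp add: algebra_simps sum.distrib sum_subtractf sum_distrib_left)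
    also have "Re (pot \<rho> S' p' x) = (1 - t) * Re (pot \<rho> S p x) + t * B"
      unfolding pot' kxx ..
    finally have en': "en \<rho> S' p' = (1 - t)\<^sup>2 * en \<rho> S p + 2 * t * (1 - t) * Re (pot \<rho> S p x) + t\<^sup>2 * B"
      by (simp add: power2_eq_square algebra_simps)
    have "I \<le> en \<rho> S' p'" unfolding I_def using fp' by (intro cInf_lower bdd) (auto simp: X_def)
    then have "en \<rho> S p - t * t \<le> (1 - t)\<^sup>2 * en \<rho> S p + 2 * t * (1 - t) * Re (pot \<rho> S p x) + t\<^sup>2 * B"
      using Sp(2) en' by linarith
    then have "t * ((2 - t) * en \<rho> S p - t * (1 + B)) \<le> t * (2 * (1 - t) * Re (pot \<rho> S p x))"
      by (simp add: power2_eq_square algebra_simps)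
    then have *: "(2 - t) * en \<rho> S p - t * (1 + B) \<le> 2 * (1 - t) * Re (pot \<rho> S p x)"
      using t by simp
    have "2 * (1 - t) * (I / 2) \<le> (2 - t) * I - I / 2" using t IM \<open>0 < M\<close> by (simp add: algebra_simps)
    also have "\<dots> \<le> (2 - t) * en \<rho> S p - t * (1 + B)"
      using t eI by (intro diff_mono mult_left_mono) auto
    finally have "2 * (1 - t) * (I / 2) \<le> 2 * (1 - t) * Re (pot \<rho> S p x)" using * by linarith
    then show ?thesis using t by simp
  qed
  moreover have "en \<rho> S p \<le> 2 * I" using Sp(2) tI IM \<open>0 < M\<close> by linarith
  ultimately show ?thesis using that[OF Sp(1) IM] by blast
qed

end

section \<open>Compactness: energies on a set of zero capacity\<close>

context positive_moments
begin

lemma infsum_int_le: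
  fixes f :: "int \<Rightarrow> real"
  assumes nn: "\<And>n. 0 \<le> f n" and le: "\<And>N. (\<Sum>n\<in>{- int N..int N}. f n) \<le> M"
  shows "(\<Sum>\<^sub>\<infinity>n. ennreal (f n)) \<le> ennreal M"
proof -
  have "(\<Sum>n\<in>F. ennreal (f n)) \<le> ennreal M" if F: "finite F" for F :: "int set"
  proof -
    obtain N where N: "F \<subseteq> {- int N..int N}"
    proof
      show "F \<subseteq> {- int (nat (Max (insert 0 (abs ` F))))..int (nat (Max (insert 0 (abs ` F))))}"
      proof
        fix x assume "x \<in> F"
        then have "\<bar>x\<bar> \<le> Max (insert 0 (abs ` F))" using F by (intro Max_ge) auto
        then show "x \<in> {- int (nat (Max (insert 0 (abs ` F))))..int (nat (Max (insert 0 (abs ` F))))}" by auto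
      qed
    qed
    have "(\<Sum>n\<in>F. f n) \<le> (\<Sum>n\<in>{- int N..int N}. f n)" using N nn by (intro sum_mono2) auto
    also have "\<dots> \<le> M" by (rule le)
    finally show ?thesis using nn by (simp add: sum_ennreal ennreal_leI)
  qed
  then show ?thesis
    by (subst nonneg_infsum_complete) (auto intro!: SUP_least)
qed

lemma sum_symmetric_int:
  fixes f :: "int \<Rightarrow> real"
  assumes "\<And>n. f (- n) = f n"
  shows "(\<Sum>n\<in>{- int N..int N}. f n) = f 0 + (\<Sum>n=1..N. 2 * f (int n))"
proof (induction N)
  case (Suc N)
  have "{- int (Suc N)..int (Suc N)} = insert (int (Suc N)) (insert (- int (Suc N)) {- int N..int N})" by auto
  then show ?case using Suc assms[of "int (Suc N)"] by simp
qed simp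

text \<open>If finitely supported probability measures on \<open>E\<close> had bounded energies for all \<open>\<rho> < 1\<close>, Helly's
  selection theorem would produce a probability measure of finite energy.\<close>

lemma zero_capacity_energies:
  assumes E: "compact E" "E \<subseteq> unit_circle" and cap: "capacity mom E = 0"
  shows "\<exists>\<rho>\<in>{0<..<1}. \<forall>S p. fin_prob E S p \<longrightarrow> M \<le> en \<rho> S p"
proof (rule ccontr)
  assume contra: "\<not> ?thesis"
  define \<rho> where "\<rho> k = 1 - 1 / real (Suc (Suc k))" for k
  have \<rho>: "0 < \<rho> k" "\<rho> k < 1" for k by (auto simp: \<rho>_def field_simps)
  have \<rho>lim: "\<rho> \<longlonglongrightarrow> 1"
    unfolding \<rho>_def using tendsto_diff[OF tendsto_const LIMSEQ_Suc[OF LIMSEQ_inverse_real_of_nat]]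
    by (force simp: inverse_eq_divide)
  have "\<exists>S p. fin_prob E S p \<and> en (\<rho> k) S p < M" for k
    using contra \<rho>[of k] by (auto simp: not_le)
  then obtain S p where fp: "\<And>k. fin_prob E (S k) (p k)" and enM: "\<And>k. en (\<rho> k) (S k) (p k) < M"
    by metis
  have fin: "finite (S k)" and SE: "S k \<subseteq> E" and p0: "\<And>y. y \<in> S k \<Longrightarrow> 0 \<le> p k y" and p1: "sum (p k) (S k) = 1" for k
    using fp[of k] by (auto simp: fin_prob_def)
  have Ene: "E \<noteq> {}" using SE[of 0] p1[of 0] by auto
  define P where "P k = point_measure (S k) (p k)" for k
  have Pint: "(LINT y|P k. g y) = (\<Sum>y\<in>S k. p k y *\<^sub>R g y)" for k and g :: "complex \<Rightarrow> 'b::{banach,second_countable_topology}"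
    unfolding P_def by (rule lebesgue_integral_point_measure_finite[OF fin p0])
  have Pprob: "prob_space (P k)" for k
  proof
    have "emeasure (P k) (space (P k)) = (\<Sum>y\<in>S k. ennreal (p k y))"
      unfolding P_def by (simp add: space_point_measure emeasure_point_measure_finite fin)
    also have "\<dots> = ennreal (sum (p k) (S k))" using p0 by (intro sum_ennreal) auto
    finally show "emeasure (P k) (space (P k)) = 1" by (simp add: p1)
  qed
  \<comment> \<open>Helly's theorem concerns distributions on the real line, so the measures are
    carried there by \<open>Arg\<close> and the limit is brought back by \<open>cis\<close>.\<close>
  define \<mu> where "\<mu> k = distr (P k) borel Arg" for k
  have Argm: "Arg \<in> P k \<rightarrow>\<^sub>M borel" for k
    unfolding P_def by (auto simp: measurable_def space_point_measure sets_point_measure)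
  have \<mu>dist: "real_distribution (\<mu> k)" for k
    unfolding \<mu>_def using prob_space.prob_space_distr[OF Pprob Argm]
    by (simp add: real_distribution_def real_distribution_axioms_def)
  have \<mu>int: "(LINT t|\<mu> k. g (cis t)) = (\<Sum>y\<in>S k. p k y *\<^sub>R g y)"
    if g: "continuous_on UNIV (\<lambda>t. g (cis t))" for k and g :: "complex \<Rightarrow> 'b::{banach,second_countable_topology}"
  proof -
    have "(LINT t|\<mu> k. g (cis t)) = (LINT y|P k. g (cis (Arg y)))"
      unfolding \<mu>_def by (intro integral_distr Argm borel_measurable_continuous_onI g)
    also have "\<dots> = (\<Sum>y\<in>S k. p k y *\<^sub>R g (cis (Arg y)))" by (rule Pint)
    also have "\<dots> = (\<Sum>y\<in>S k. p k y *\<^sub>R g y)"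
    proof (intro sum.cong refl)
      fix y assume "y \<in> S k"
      then have "cmod y = 1" using SE[of k] E(2) by auto
      then have "cis (Arg y) = y" by (subst cis_Arg) (auto simp: sgn_eq)
      then show "p k y *\<^sub>R g (cis (Arg y)) = p k y *\<^sub>R g y" by simp
    qed
    finally show ?thesis .
  qed
  \<comment> \<open>Tightness is automatic, since all arguments lie in
    \<open>{-pi<..pi}\<close>.\<close>
  have "measure (\<mu> k) {-4<..4} = 1" for k
  proof -
    have "measure (\<mu> k) {-4<..4} = measure (P k) (Arg -` {-4<..4} \<inter> space (P k))"
      unfolding \<mu>_def by (intro measure_distr Argm) auto
    also have "Arg -` {-4<..4} \<inter> space (P k) = space (P k)"
    proof -
      have "Arg y \<in> {-4<..4}" for y
        using mpi_less_Arg[of y] Arg_le_pi[of y] pi_less_4 unfolding greaterThanAtMost_iff by linarith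
      then show ?thesis by blast
    qed
    finally show ?thesis using prob_space.prob_space[OF Pprob] by simp
  qed
  then have "tight \<mu>"
    unfolding tight_def using \<mu>dist by (intro conjI allI impI exI[of _ "-4::real"] exI[of _ "4::real"]) simp_all
  then obtain s m where s: "strict_mono (s :: nat \<Rightarrow> nat)" and m: "real_distribution m" and conv: "weak_conv_m (\<mu> \<circ> id \<circ> s) m"
    using tight_imp_convergent_subsubsequence[of \<mu> id] by (auto simp: strict_mono_id)
  interpret m: real_distribution m by (rule m)
  \<comment> \<open>The bound on \<open>g\<close> is required on the circle only; test functions
    such as \<open>y powi (- n)\<close> may be unbounded elsewhere.\<close>
  have lim: "(\<lambda>k. \<Sum>y\<in>S (s k). p (s k) y *\<^sub>R g y) \<longlonglongrightarrow> (LINT t|m. g (cis t))"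
    if g: "continuous_on UNIV (\<lambda>t. g (cis t))" and B: "\<And>y. norm (g y) \<le> B \<or> y \<notin> unit_circle"
    for g :: "complex \<Rightarrow> 'b::{banach,second_countable_topology}" and B
  proof -
    have "(\<lambda>k. LINT t|(\<mu> \<circ> id \<circ> s) k. g (cis t)) \<longlonglongrightarrow> (LINT t|m. g (cis t))"
    proof (rule weak_conv_imp_integral_bdd_continuous_conv[OF _ m conv])
      show "real_distribution ((\<mu> \<circ> id \<circ> s) k)" for k using \<mu>dist by simp
      show "isCont (\<lambda>t. g (cis t)) x" for x using g by (simp add: continuous_on_eq_continuous_at)
      show "norm (g (cis x)) \<le> B" for x using B[of "cis x"] by auto
    qed
    then show ?thesis by (simp add: \<mu>int[OF g])
  qed
  define \<nu> where "\<nu> = distr m (restrict_space borel unit_circle) cis"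
  have cism: "cis \<in> m \<rightarrow>\<^sub>M restrict_space borel unit_circle"
  proof (rule measurable_restrict_space2)
    have "cis \<in> borel_measurable borel"
      by (intro borel_measurable_continuous_onI continuous_intros)
    then show "cis \<in> borel_measurable m"
      by (simp cong: measurable_cong_sets)
  qed auto
  have cisin: "continuous_on UNIV cis" by (intro continuous_intros)
  have "prob_measure_on E \<nu>"
    unfolding prob_measure_on_def
  proof (intro conjI)
    show "prob_space \<nu>" unfolding \<nu>_def by (rule m.prob_space_distr[OF cism])
    show "sets \<nu> = sets (restrict_space borel unit_circle)" by (simp add: \<nu>_def)
    obtain a where a: "a \<in> E" using Ene by auto
    \<comment> \<open>The distance to \<open>E\<close> is a continuous test function with integral 0
      against every approximating measure, hence against the limit, which is therefore carried by
      the closed set \<open>E\<close>.\<close>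
    have gc: "continuous_on UNIV (\<lambda>t. infdist (cis t) E)"
      by (intro continuous_on_infdist cisin)
    have gb: "norm (infdist y E) \<le> 2 \<or> y \<notin> unit_circle" for y
    proof -
      have "infdist y E \<le> dist y a" by (rule infdist_le[OF a])
      also have "\<dots> \<le> cmod y + cmod a" by (simp add: dist_norm norm_triangle_ineq4)
      finally show ?thesis using a E infdist_nonneg[of y E] by auto
    qed
    have "(\<lambda>k. \<Sum>y\<in>S (s k). p (s k) y *\<^sub>R infdist y E) \<longlonglongrightarrow> (LINT t|m. infdist (cis t) E)"
      by (rule lim[OF gc gb])
    moreover have "(\<Sum>y\<in>S (s k). p (s k) y *\<^sub>R infdist y E) = 0" for k
      using SE[of "s k"] by (intro sum.neutral) auto
    ultimately have "(\<lambda>k. 0) \<longlonglongrightarrow> (LINT t|m. infdist (cis t) E)"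
      by (simp only:)
    then have z: "(LINT t|m. infdist (cis t) E) = 0"
      using LIMSEQ_unique tendsto_const by metis
    have i: "integrable m (\<lambda>t. infdist (cis t) E)"
    proof (rule m.integrable_const_bound[where B = 2])
      show "AE t in m. norm (infdist (cis t) E) \<le> 2"
        using gb[of "cis t" for t] by (intro AE_I2) simp
      have "(\<lambda>t. infdist (cis t) E) \<in> borel_measurable borel"
        by (intro borel_measurable_continuous_onI gc)
      then show "(\<lambda>t. infdist (cis t) E) \<in> borel_measurable m"
        by (simp cong: measurable_cong_sets)
    qed
    have "AE t in m. infdist (cis t) E = 0"
      using integral_nonneg_eq_0_iff_AE[OF i] z by (simp add: infdist_nonneg)
    then have ae: "AE t in m. cis t \<in> E"
      by eventually_elim (simp add: in_closed_iff_infdist_zero[OF compact_imp_closed[OF E(1)] Ene])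
    have "unit_circle - E \<in> sets borel"
      by (intro sets.Diff borel_closed compact_imp_closed E compact_sphere)
    then have "emeasure \<nu> (unit_circle - E) = emeasure m (cis -` (unit_circle - E) \<inter> space m)"
      unfolding \<nu>_def by (intro emeasure_distr cism) (auto simp: sets_restrict_space_iff)
    also have "\<dots> = 0"
    proof -
      have "cis -` (unit_circle - E) \<inter> space m = {t \<in> space m. cis t \<notin> E}" by auto
      moreover have "emeasure m {t \<in> space m. cis t \<notin> E} = 0"
        using ae by (intro emeasure_eq_0_AE) simp
      ultimately show ?thesis by (simp only:)
    qed
    finally show "emeasure \<nu> (unit_circle - E) = 0" .
  qed
  then have "1 / energy mom \<nu> \<le> capacity mom E"
    unfolding capacity_def by (intro SUP_upper) auto
  then have "1 / energy mom \<nu> = 0" using cap by simp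
  then have inf: "energy mom \<nu> = \<infinity>"
    by (simp add: divide_ennreal_def)
  have pc: "continuous_on UNIV (\<lambda>t. cis t powi n)" for n
    unfolding cis_power_int by (intro continuous_intros)
  define h where "h n k = (\<Sum>y\<in>S (s k). p (s k) y *\<^sub>R y powi (- n))" for n :: int and k
  have hlim: "h n \<longlonglongrightarrow> fourier_measure \<nu> n" for n
  proof -
    have "fourier_measure \<nu> n = (LINT t|m. cis t powi (- n))"
      unfolding fourier_measure_def \<nu>_def
      by (intro integral_distr cism borel_measurable_continuous_on_restrict continuous_intros) auto
    moreover have "h n \<longlonglongrightarrow> (LINT t|m. cis t powi (- n))"
    proof -
      have b: "norm (y powi (- n)) \<le> 1 \<or> y \<notin> unit_circle" for y :: complex
        by (cases "cmod y = 1") (simp_all add: norm_power_int)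
      show ?thesis unfolding h_def by (rule lim[OF pc b])
    qed
    ultimately show ?thesis by simp
  qed
  have h_nonneg: "h (- int n) k = hat (S (s k)) (p (s k)) n" for n k
    by (simp add: h_def hat_def)
  have h_cnj: "h (- n) k = cnj (h n k)" for n k
  proof -
    have "y powi n = cnj (y powi (- n))" if "y \<in> S (s k)" for y
    proof -
      have "cmod y = 1" using that SE[of "s k"] E(2) by auto
      then have "inverse y = cnj y"
        by (simp add: inverse_complex_def complex_norm_square[symmetric] complex_eq_iff cmod_def)
      then have "cnj y powi (- n) = inverse (y powi (- n))" by (metis power_int_inverse)
      then show ?thesis by (simp add: power_int_minus)
    qed
    then show ?thesis by (simp add: h_def)
  qed
  have hc: "cmod (h (- n) k) = cmod (h n k)" for n k by (simp only: h_cnj complex_mod_cnj)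
  have bound: "(\<Sum>n\<in>{- int N..int N}. mom (nat \<bar>n\<bar>) * \<rho> (s k) ^ nat \<bar>n\<bar> * (cmod (h n k))\<^sup>2) \<le> M" for N k
  proof -
    have "(\<Sum>n\<in>{- int N..int N}. mom (nat \<bar>n\<bar>) * \<rho> (s k) ^ nat \<bar>n\<bar> * (cmod (h n k))\<^sup>2)
       = mom 0 * (cmod (h 0 k))\<^sup>2 + (\<Sum>n=1..N. 2 * (mom n * \<rho> (s k) ^ n * (cmod (h (int n) k))\<^sup>2))"
      by (subst sum_symmetric_int) (simp_all add: hc)
    \<comment> \<open>The factor 2 in \<open>Hcoeff\<close> accounts for the pair of frequencies
      \<open>n\<close> and \<open>- n\<close>.\<close>
    also have "\<dots> = (\<Sum>n\<in>insert 0 {1..N}. Hcoeff n * \<rho> (s k) ^ n * (cmod (hat (S (s k)) (p (s k)) n))\<^sup>2)"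
      by (subst sum.insert) (auto simp: Hcoeff_def h_nonneg[symmetric] hc intro!: sum.cong)
    also have "\<dots> \<le> en (\<rho> (s k)) (S (s k)) (p (s k))"
      using en_sums[OF fin[of "s k"] order_trans[OF SE E(2)] \<rho>] Hcoeff_nonneg \<rho>(1)[of "s k"]
      by (subst sums_unique[OF en_sums[OF fin[of "s k"] order_trans[OF SE E(2)] \<rho>]])
        (intro sum_le_suminf; auto simp: sums_iff less_imp_le intro!: mult_nonneg_nonneg)
    also have "\<dots> \<le> M" using enM[of "s k"] by simp
    finally show ?thesis .
  qed
  \<comment> \<open>For a fixed window of frequencies the coefficients converge and the damping
    \<open>\<rho> (s k)\<close> tends to 1; only afterwards is the window enlarged.\<close>
  have "(\<Sum>n\<in>{- int N..int N}. mom (nat \<bar>n\<bar>) * (cmod (fourier_measure \<nu> n))\<^sup>2) \<le> M" for N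
  proof (rule LIMSEQ_le_const2)
    have "(\<lambda>k. \<rho> (s k)) \<longlonglongrightarrow> 1" using LIMSEQ_subseq_LIMSEQ[OF \<rho>lim s] by (simp add: o_def)
    then have "(\<lambda>k. \<Sum>n\<in>{- int N..int N}. mom (nat \<bar>n\<bar>) * \<rho> (s k) ^ nat \<bar>n\<bar> * (cmod (h n k))\<^sup>2)
      \<longlonglongrightarrow> (\<Sum>n\<in>{- int N..int N}. mom (nat \<bar>n\<bar>) * 1 ^ nat \<bar>n\<bar> * (cmod (fourier_measure \<nu> n))\<^sup>2)"
      by (intro tendsto_intros hlim)
    then show "(\<lambda>k. \<Sum>n\<in>{- int N..int N}. mom (nat \<bar>n\<bar>) * \<rho> (s k) ^ nat \<bar>n\<bar> * (cmod (h n k))\<^sup>2)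
      \<longlonglongrightarrow> (\<Sum>n\<in>{- int N..int N}. mom (nat \<bar>n\<bar>) * (cmod (fourier_measure \<nu> n))\<^sup>2)" by simp
  qed (use bound in auto)
  then have "energy mom \<nu> \<le> ennreal M"
    unfolding energy_def by (intro infsum_int_le) (simp_all add: mom_nonneg)
  then show False using inf by (simp add: top_unique)
qed

lemma zero_capacity_functions:
  assumes E: "compact E" "E \<subseteq> unit_circle" and cap: "capacity mom E = 0" and "\<delta> > 0"
  obtains F R where "R > 1" "F holomorphic_on ball 0 R"
    "\<And>z. cmod z \<le> 1 \<Longrightarrow> 0 \<le> Re (F z)" "\<And>z. z \<in> E \<Longrightarrow> 1 \<le> Re (F z)" "Im (F 0) = 0"
    "wsummable (\<lambda>n. 1 / mom n) (taylor F)" "wnorm2 (\<lambda>n. 1 / mom n) (taylor F) \<le> \<delta>"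
    "\<And>\<zeta> d. cmod \<zeta> \<le> 1 \<Longrightarrow> 0 < d \<Longrightarrow> d \<le> 1 \<Longrightarrow> \<forall>y\<in>E. d \<le> dist \<zeta> y \<Longrightarrow>
      F holomorphic_on ball \<zeta> (d / 4) \<and> (\<forall>z\<in>ball \<zeta> (d / 4). cmod (F z) \<le> \<delta> / d)"
proof (cases "E = {}")
  case True
  have "taylor (\<lambda>z. 0) n = 0" for n by (rule taylor_unique[of 1]) auto
  then show ?thesis
    using True \<open>\<delta> > 0\<close> by (intro that[of 2 "\<lambda>_. 0"]) (auto simp: wsummable_def wnorm2_def)
next
  case False
  \<comment> \<open>\<open>16 / \<delta>\<close> serves the squared norm, which will be at most
    \<open>16 / I\<close>. In the local bound, \<open>2 / I\<close> times the kernel bound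
    \<open>(9 / 4) / (d / 4) * mom 0\<close> equals \<open>18 * mom 0 / (I * d)\<close>.\<close>
  define M where "M = max (18 * mom 0 / \<delta>) (16 / \<delta>)"
  have M: "0 < M" using \<open>\<delta> > 0\<close> by (simp add: M_def less_max_iff_disj)
  obtain \<rho> where \<rho>: "0 < \<rho>" "\<rho> < 1" and "\<And>S p. fin_prob E S p \<Longrightarrow> M \<le> en \<rho> S p"
    using zero_capacity_energies[OF E cap, of M] by auto
  from near_minimiser[OF E(2) False \<rho> M this(3)]
  obtain S p I where fp: "fin_prob E S p" and I: "M \<le> I" "en \<rho> S p \<le> 2 * I" and
    pot: "\<And>x. x \<in> E \<Longrightarrow> I / 2 \<le> Re (pot \<rho> S p x)" by blast
  have I0: "0 < I" using M I by simp
  have fin: "finite S" and SE: "S \<subseteq> unit_circle" "S \<subseteq> E" and p0: "\<And>y. y \<in> S \<Longrightarrow> 0 \<le> p y"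
    using fp E by (auto simp: fin_prob_def)
  have SE1: "cmod y = 1" if "y \<in> S" for y using SE that by auto
  \<comment> \<open>The factor normalises \<open>I / 2\<close>, the guaranteed lower bound for the
    potential on \<open>E\<close>, to 1.\<close>
  define F where "F z = of_real (2 / I) * pot \<rho> S p z" for z
  have ReF: "Re (F z) = 2 / I * Re (pot \<rho> S p z)" for z by (simp add: F_def del: of_real_divide)
  have holo: "pot \<rho> S p holomorphic_on ball 0 (1 / \<rho>)"
  proof (rule pot_holomorphic)
    fix y z assume "y \<in> S" "z \<in> ball (0::complex) (1 / \<rho>)"
    then have "cmod (of_real \<rho> * (z * cnj y)) < 1"
      using \<rho> SE1 by (simp add: norm_mult field_simps)
    then show "\<exists>c. sep (of_real \<rho> * (z * cnj y)) c" using sep_disc by blast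
  qed simp
  have tF: "taylor F n = of_real (2 / I) * (of_real (Hcoeff n * \<rho> ^ n) * cnj (hat S p n))" for n
  proof (rule taylor_unique[of 1])
    fix z :: complex assume "cmod z < 1"
    then have "\<rho> * cmod z < 1 * 1" using \<rho> by (intro mult_strict_mono) auto
    then have "(\<lambda>n. (of_real (Hcoeff n * \<rho> ^ n) * cnj (hat S p n)) * z ^ n) sums pot \<rho> S p z"
      using fin SE \<rho> by (intro pot_sums) auto
    from sums_mult[OF this, of "of_real (2 / I)"]
    show "(\<lambda>n. of_real (2 / I) * (of_real (Hcoeff n * \<rho> ^ n) * cnj (hat S p n)) * z ^ n) sums F z"
      by (simp only: F_def mult.assoc)
  qed simp
  \<comment> \<open>One factor \<open>Hcoeff n\<close> of the squared coefficient cancels against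
    the weight \<open>1 / mom n\<close> up to 2, and one factor \<open>\<rho> ^ n\<close> is
    dropped; what remains are the terms of the energy.\<close>
  define b where "b n = 8 / I\<^sup>2 * (Hcoeff n * \<rho> ^ n * (cmod (hat S p n))\<^sup>2)" for n
  have bs: "b sums (8 / I\<^sup>2 * en \<rho> S p)"
    unfolding b_def by (intro sums_mult en_sums fin SE \<rho>)
  have ble: "1 / mom n * (cmod (taylor F n))\<^sup>2 \<le> b n" for n
  proof -
    have H2: "Hcoeff n / mom n \<le> 2" "0 \<le> Hcoeff n / mom n"
      using mom_pos[of n] by (auto simp: Hcoeff_def)
    have r1: "\<rho> ^ n \<le> 1" "0 \<le> \<rho> ^ n" using \<rho> by (auto intro!: power_le_one)
    have "(cmod (taylor F n))\<^sup>2 = 4 / I\<^sup>2 * ((Hcoeff n * \<rho> ^ n)\<^sup>2 * (cmod (hat S p n))\<^sup>2)"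
      using I0 unfolding tF norm_mult power_mult_distrib norm_of_real
      by (simp add: power_divide power_mult_distrib)
    then have "1 / mom n * (cmod (taylor F n))\<^sup>2 = 4 / I\<^sup>2 * ((Hcoeff n / mom n * \<rho> ^ n) * (Hcoeff n * \<rho> ^ n * (cmod (hat S p n))\<^sup>2))"
      by (simp only:) (simp add: power2_eq_square mult_ac)
    also have "\<dots> \<le> 4 / I\<^sup>2 * ((2 * 1) * (Hcoeff n * \<rho> ^ n * (cmod (hat S p n))\<^sup>2))"
      using H2 r1 Hcoeff_nonneg[of n] by (intro mult_left_mono mult_right_mono mult_mono) auto
    finally show ?thesis by (simp add: b_def)
  qed
  have ws: "wsummable (\<lambda>n. 1 / mom n) (taylor F)"
    unfolding wsummable_def using mom_nonneg
    by (intro summable_comparison_test'[OF sums_summable[OF bs]]) (use ble in \<open>simp add: mom_nonneg\<close>)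
  have "wnorm2 (\<lambda>n. 1 / mom n) (taylor F) \<le> 8 / I\<^sup>2 * en \<rho> S p"
    unfolding wnorm2_def sums_unique[OF bs]
    by (intro suminf_le ble ws[unfolded wsummable_def] sums_summable[OF bs])
  also have "\<dots> \<le> 8 / I\<^sup>2 * (2 * I)" using I by (intro mult_left_mono) auto
  also have "\<dots> = 16 / I" using I0 by (simp add: power2_eq_square)
  also have "\<dots> \<le> \<delta>"
  proof -
    have "16 / \<delta> \<le> I" using I by (simp add: M_def)
    then show ?thesis using I0 \<open>\<delta> > 0\<close> by (simp add: field_simps)
  qed
  finally have wn: "wnorm2 (\<lambda>n. 1 / mom n) (taylor F) \<le> \<delta>" .
  show ?thesis
  proof (rule that[of "1 / \<rho>" F])
    show "1 / \<rho> > 1" using \<rho> by simp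
    show "F holomorphic_on ball 0 (1 / \<rho>)" unfolding F_def by (intro holomorphic_intros holo)
    show "0 \<le> Re (F z)" if "cmod z \<le> 1" for z
    proof -
      have "0 \<le> Re (H (of_real \<rho> * (z * cnj y)))" if "y \<in> S" for y
      proof (rule Re_H_nonneg)
        have "\<rho> * cmod z \<le> \<rho> * 1" using \<rho> \<open>cmod z \<le> 1\<close> by (intro mult_left_mono) auto
        then have "\<rho> * cmod z < 1" using \<rho> by linarith
        then show "cmod (of_real \<rho> * (z * cnj y)) < 1" using \<rho> SE1[OF that] by (simp add: norm_mult)
      qed
      then show ?thesis
        using I0 p0 unfolding ReF pot_def by (simp add: sum_nonneg)
    qed
    show "1 \<le> Re (F z)" if "z \<in> E" for z
      using pot[OF that] I0 by (simp add: ReF field_simps)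
    have "H 0 = of_real (mom 0)" by (simp add: H_def mom_def)
    then show "Im (F 0) = 0" by (simp add: F_def pot_def)
    show "wsummable (\<lambda>n. 1 / mom n) (taylor F)" by (rule ws)
    show "wnorm2 (\<lambda>n. 1 / mom n) (taylor F) \<le> \<delta>" by (rule wn)
    fix \<zeta> d assume \<zeta>: "cmod \<zeta> \<le> 1" and d: "0 < d" "d \<le> 1" "\<forall>y\<in>E. d \<le> dist \<zeta> y"
    have sep: "sep (of_real \<rho> * (z * cnj y)) (d / 4)" if "z \<in> ball \<zeta> (d / 4)" "y \<in> S" for z y
      using that d \<zeta> \<rho> SE SE1 by (intro sep_away[of \<zeta>]) auto
    show "F holomorphic_on ball \<zeta> (d / 4) \<and> (\<forall>z\<in>ball \<zeta> (d / 4). cmod (F z) \<le> \<delta> / d)"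
    proof (intro conjI ballI)
      show "F holomorphic_on ball \<zeta> (d / 4)"
        unfolding F_def using sep by (intro holomorphic_intros pot_holomorphic) auto
      fix z assume z: "z \<in> ball \<zeta> (d / 4)"
      have "cmod z \<le> cmod \<zeta> + dist \<zeta> z"
        using norm_triangle_ineq2[of z \<zeta>] by (simp add: dist_norm norm_minus_commute)
      then have z54: "1 + cmod z \<le> 9 / 4" using z d \<zeta> by simp
      have "cmod (F z) \<le> 2 / I * ((1 + cmod z) / (d / 4) * mom 0)"
        using pot_bound[OF fp sep[OF z] SE(1)] \<rho> d I0
        unfolding F_def norm_mult norm_of_real by (intro mult_mono) auto
      also have "\<dots> \<le> 2 / I * ((9 / 4) / (d / 4) * mom 0)"
        using z54 d I0 mom0 by (intro mult_left_mono mult_right_mono divide_right_mono) auto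
      also have "\<dots> = (18 * mom 0 / I) / d" using d by (simp add: field_simps)
      also have "\<dots> \<le> \<delta> / d"
      proof (rule divide_right_mono)
        have "18 * mom 0 / \<delta> \<le> I" using I by (simp add: M_def)
        then show "18 * mom 0 / I \<le> \<delta>" using I0 \<open>\<delta> > 0\<close> by (simp add: field_simps)
      qed (use d in simp)
      finally show "cmod (F z) \<le> \<delta> / d" .
    qed
  qed
qed

end

section \<open>Construction of the cyclic outer function\<close>

lemma taylor_cong:
  assumes "g holomorphic_on ball 0 1" "\<And>z. cmod z < 1 \<Longrightarrow> f z = g z"
  shows "taylor f n = taylor g n"
  by (rule taylor_unique[of 1]) (use assms taylor_sums in auto)

lemma taylor_diff:
  assumes "f holomorphic_on ball 0 1" "g holomorphic_on ball 0 1"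
  shows "taylor (\<lambda>z. f z - g z) n = taylor f n - taylor g n"
proof (rule taylor_unique[of 1])
  fix z :: complex assume "cmod z < 1"
  then have "(\<lambda>n. taylor f n * z ^ n - taylor g n * z ^ n) sums (f z - g z)"
    by (intro sums_diff taylor_sums[OF assms(1)] taylor_sums[OF assms(2)])
  then show "(\<lambda>n. (taylor f n - taylor g n) * z ^ n) sums (f z - g z)"
    by (simp add: algebra_simps)
qed simp

lemma taylor_const: "taylor (\<lambda>_. c) n = (if n = 0 then c else 0)"
proof (rule taylor_unique[of 1])
  fix z :: complex
  have "(\<lambda>n. (if n = 0 then c else 0) * z ^ n) sums (\<Sum>n\<in>{0}. (if n = 0 then c else 0) * z ^ n)"
    by (intro sums_finite) auto
  then show "(\<lambda>n. (if n = 0 then c else 0) * z ^ n) sums c" by simp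
qed simp

lemma holomorphic_poly: "poly p holomorphic_on A"
  unfolding holomorphic_on_def using poly_DERIV field_differentiable_def field_differentiable_at_within by blast

lemma taylor_poly: "taylor (poly p) n = coeff p n"
proof (rule taylor_unique[of 1])
  fix z :: complex
  have "(\<lambda>n. coeff p n * z ^ n) sums (\<Sum>n\<in>{..degree p}. coeff p n * z ^ n)"
    by (intro sums_finite) (auto simp: coeff_eq_0)
  then show "(\<lambda>n. coeff p n * z ^ n) sums poly p z" by (simp add: poly_altdef)
qed simp

text \<open>The derivative of \<open>exp (- z)\<close> has modulus at most 1 on the right
  half-plane, which is convex. Through \<open>contraction\<close>, the norm of
  \<open>exp (- F)\<close> is thereby controlled by that of \<open>F\<close>, apart from the value
  at 0.\<close>

lemma exp_minus_contraction:
  assumes "0 \<le> Re a" "0 \<le> Re b"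
  shows "cmod (exp (- a) - exp (- b)) \<le> cmod (a - b)"
proof -
  have "cmod (exp (- a) - exp (- b)) \<le> 1 * cmod (a - b)"
  proof (rule field_differentiable_bound[of "{z. 0 \<le> Re z}" "\<lambda>z. exp (- z)" "\<lambda>z. - exp (- z)"])
    show "convex {z. 0 \<le> Re z}" by (rule convex_halfspace_Re_ge)
    show "((\<lambda>z. exp (- z)) has_field_derivative - exp (- z)) (at z within {z. 0 \<le> Re z})" for z
      by (auto intro!: derivative_eq_intros)
  qed (use assms in auto)
  then show ?thesis by simp
qed

lemma exp_Lipschitz:
  assumes "Re a \<le> B" "Re b \<le> B"
  shows "cmod (exp a - exp b) \<le> exp B * cmod (a - b)"
proof (rule field_differentiable_bound[of "{z. Re z \<le> B}" exp exp])
  show "convex {z. Re z \<le> B}" by (rule convex_halfspace_Re_le)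
  show "(exp has_field_derivative exp z) (at z within {z. Re z \<le> B})" for z
    by (auto intro!: derivative_eq_intros)
qed (use assms in auto)

text \<open>Iteration of \<open>norm_add_squared_le\<close>, splitting off the first term each time.
  The weights do not depend on \<open>M\<close>, and they are harmless against squared norms of size
  \<open>(1 / 4) ^ Suc k\<close>.\<close>

lemma dyadic_norm_sum_squared:
  fixes c :: "nat \<Rightarrow> 'a::real_normed_vector"
  shows "(norm (\<Sum>k<M. c k))\<^sup>2 \<le> (\<Sum>k<M. 2 ^ Suc k * (norm (c k))\<^sup>2)"
proof (induction M arbitrary: c)
  case (Suc M)
  have "(norm (\<Sum>k<Suc M. c k))\<^sup>2 = (norm (c 0 + (\<Sum>k<M. c (Suc k))))\<^sup>2"
    by (simp only: sum.lessThan_Suc_shift)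
  also have "\<dots> \<le> 2 * (norm (c 0))\<^sup>2 + 2 * (norm (\<Sum>k<M. c (Suc k)))\<^sup>2"
    by (rule norm_add_squared_le)
  also have "\<dots> \<le> 2 * (norm (c 0))\<^sup>2 + 2 * (\<Sum>k<M. 2 ^ Suc k * (norm (c (Suc k)))\<^sup>2)"
    using Suc.IH[of "\<lambda>k. c (Suc k)"] by simp
  also have "\<dots> = (\<Sum>k<Suc M. 2 ^ Suc k * (norm (c k))\<^sup>2)"
    by (simp add: sum.lessThan_Suc_shift sum_distrib_left mult.assoc del: sum.lessThan_Suc)
  finally show ?case .
qed simp

context doubling_weight
begin

text \<open>\<open>f z * q z - f w * q w = (f z - f w) * q z + f w * (q z - q w)\<close>, so
  \<open>contraction\<close> applies with majorants \<open>f\<close> and \<open>q\<close>. The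
  product is small once \<open>q\<close> is small both in supremum and in weighted norm.\<close>

lemma taylor_product_bound:
  assumes f: "f holomorphic_on ball 0 1" and q: "q holomorphic_on ball 0 1"
    and f1: "\<And>z. cmod z < 1 \<Longrightarrow> cmod (f z) \<le> 1" and qe: "\<And>z. cmod z < 1 \<Longrightarrow> cmod (q z) \<le> e"
    and sf: "wsummable \<Omega> (taylor f)" and sq: "wsummable \<Omega> (taylor q)"
  shows "wsummable \<Omega> (taylor (\<lambda>z. f z * q z))"
    and "wnorm2 \<Omega> (taylor (\<lambda>z. f z * q z)) \<le> \<Omega> 0 * e\<^sup>2 + diff_const * (2 * e\<^sup>2 * wnorm2 \<Omega> (taylor f) + 2 * wnorm2 \<Omega> (taylor q))"
proof -
  have h: "(\<lambda>z. f z * q z) holomorphic_on ball 0 1" by (intro holomorphic_intros f q)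
  have le: "(cmod (f z * q z - f w * q w))\<^sup>2 \<le> 2 * e\<^sup>2 * (cmod (f z - f w))\<^sup>2 + 2 * (cmod (q z - q w))\<^sup>2"
    if "cmod z < 1" "cmod w < 1" for z w
  proof -
    have "f z * q z - f w * q w = (f z - f w) * q z + f w * (q z - q w)" by (simp add: algebra_simps)
    then have "(cmod (f z * q z - f w * q w))\<^sup>2 \<le> 2 * (cmod ((f z - f w) * q z))\<^sup>2 + 2 * (cmod (f w * (q z - q w)))\<^sup>2"
      by (metis norm_add_squared_le)
    also have "\<dots> \<le> 2 * (cmod (f z - f w) * e)\<^sup>2 + 2 * (1 * cmod (q z - q w))\<^sup>2"
      unfolding norm_mult using that f1 qe
      by (intro add_mono mult_left_mono power_mono mult_left_mono mult_right_mono) auto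
    finally show ?thesis by (simp add: power_mult_distrib mult_ac)
  qed
  note c = contraction[OF h f q _ _ le sf sq]
  show "wsummable \<Omega> (taylor (\<lambda>z. f z * q z))" by (rule c) auto
  have "cmod (f 0 * q 0) \<le> 1 * e" unfolding norm_mult using f1[of 0] qe[of 0] by (intro mult_mono) auto
  then have "(cmod (f 0 * q 0))\<^sup>2 \<le> e\<^sup>2" by (intro power_mono) auto
  then have "\<Omega> 0 * (cmod (f 0 * q 0))\<^sup>2 \<le> \<Omega> 0 * e\<^sup>2" by (intro mult_left_mono) auto
  moreover have "wnorm2 \<Omega> (taylor (\<lambda>z. f z * q z)) \<le> \<Omega> 0 * (cmod (f 0 * q 0))\<^sup>2 +
      diff_const * (2 * e\<^sup>2 * wnorm2 \<Omega> (taylor f) + 2 * wnorm2 \<Omega> (taylor q))"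
    by (rule c(2)) auto
  ultimately show "wnorm2 \<Omega> (taylor (\<lambda>z. f z * q z)) \<le> \<Omega> 0 * e\<^sup>2 + diff_const * (2 * e\<^sup>2 * wnorm2 \<Omega> (taylor f) + 2 * wnorm2 \<Omega> (taylor q))"
    by linarith
qed

end

text \<open>Records what \<open>zero_capacity_functions\<close> provides for
  \<open>\<delta> = (1 / 4) ^ Suc k\<close>. The ratio 1/4 outweighs the factors
  \<open>2 ^ Suc k\<close> lost when squared norms along a series are added.\<close>

locale exponential_construction = doubling_weight +
  fixes E :: "complex set" and Fs :: "nat \<Rightarrow> complex \<Rightarrow> complex"
  assumes E: "compact E" "E \<subseteq> unit_circle"
    and Fs_holo: "\<exists>R>1. Fs k holomorphic_on ball 0 R"
    and Fs_Re: "cmod z \<le> 1 \<Longrightarrow> 0 \<le> Re (Fs k z)"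
    and Fs_E: "z \<in> E \<Longrightarrow> 1 \<le> Re (Fs k z)"
    and Fs_Im: "Im (Fs k 0) = 0"
    and Fs_wsummable: "wsummable \<Omega> (taylor (Fs k))"
    and Fs_wnorm2: "wnorm2 \<Omega> (taylor (Fs k)) \<le> (1 / 4) ^ Suc k"
    and Fs_local: "cmod \<zeta> \<le> 1 \<Longrightarrow> 0 < d \<Longrightarrow> d \<le> 1 \<Longrightarrow> \<forall>y\<in>E. d \<le> dist \<zeta> y \<Longrightarrow>
      Fs k holomorphic_on ball \<zeta> (d / 4) \<and> (\<forall>z\<in>ball \<zeta> (d / 4). cmod (Fs k z) \<le> (1 / 4) ^ Suc k / d)"
begin

definition good :: "complex \<Rightarrow> real \<Rightarrow> bool" where
  "good \<zeta> d \<longleftrightarrow> cmod \<zeta> \<le> 1 \<and> 0 < d \<and> d \<le> 1 \<and> (\<forall>y\<in>E. d \<le> dist \<zeta> y)"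

text \<open>An open set that contains the closed disc without \<open>E\<close>, hence also points
  beyond the circle, and is disjoint from \<open>E\<close>. Its balls are those on which
  \<open>Fs_local\<close> gives bounds, so the series converges locally uniformly here.\<close>

definition V :: "complex set" where
  "V = (\<Union>(\<zeta>, d)\<in>{(\<zeta>, d). good \<zeta> d}. ball \<zeta> (d / 4))"

lemma open_V: "open V"
  by (auto simp: V_def)

lemma V_disjoint: "z \<in> V \<Longrightarrow> z \<notin> E"
  by (force simp: V_def good_def)

lemma disc_subset_V: "cball 0 1 - E \<subseteq> V"
proof
  fix z assume z: "z \<in> cball 0 1 - E"
  obtain d where d: "d > 0" "\<forall>y\<in>E. d \<le> dist z y"
    using separate_point_closed[OF compact_imp_closed[OF E(1)], of z] z by auto
  then have "good z (min d 1)" using z by (auto simp: good_def min.coboundedI1)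
  moreover have "z \<in> ball z (min d 1 / 4)" using d by simp
  ultimately show "z \<in> V" unfolding V_def by blast
qed

lemma V_obtain:
  assumes "z \<in> V"
  obtains \<zeta> d where "good \<zeta> d" "z \<in> ball \<zeta> (d / 4)" "ball \<zeta> (d / 4) \<subseteq> V"
  using assms unfolding V_def by auto

lemma Fs_bound: "good \<zeta> d \<Longrightarrow> z \<in> ball \<zeta> (d / 4) \<Longrightarrow> cmod (Fs k z) \<le> (1 / 4) ^ Suc k / d"
  using Fs_local[of \<zeta> d k] by (auto simp: good_def)

lemma Fs_holo_V: "Fs k holomorphic_on V"
proof -
  have "Fs k field_differentiable (at z within V)" if z: "z \<in> V" for z
  proof -
    obtain \<zeta> d where zd: "good \<zeta> d" "z \<in> ball \<zeta> (d / 4)" using V_obtain[OF z] by blast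
    then have "Fs k holomorphic_on ball \<zeta> (d / 4)" using Fs_local[of \<zeta> d k] by (auto simp: good_def)
    then have "Fs k field_differentiable (at z)"
      using zd(2) holomorphic_on_imp_differentiable_at[OF _ open_ball] by blast
    then show ?thesis by (rule field_differentiable_at_within)
  qed
  then show ?thesis by (simp add: holomorphic_on_def)
qed

lemma Fs_holo_ball: "Fs k holomorphic_on ball 0 1"
proof -
  obtain R where "R > 1" "Fs k holomorphic_on ball 0 R" using Fs_holo by blast
  then show ?thesis by (elim holomorphic_on_subset) auto
qed

lemma Fs_cont: "continuous_on (cball 0 1) (Fs k)"
proof -
  obtain R where "R > 1" "Fs k holomorphic_on ball 0 R" using Fs_holo by blast
  then show ?thesis by (intro continuous_on_subset[OF holomorphic_on_imp_continuous_on]) auto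
qed

section \<open>Tails of the exponent series and their exponentials\<close>

definition TT :: "nat \<Rightarrow> complex \<Rightarrow> complex" where
  "TT N z = (\<Sum>k. Fs (k + N) z)"

lemma summable_quarter: "summable (\<lambda>k. (1 / 4 :: real) ^ Suc (k + N) / d)"
proof -
  have "summable (\<lambda>k. (1 / 4 :: real) ^ k * ((1 / 4) ^ Suc N / d))"
    by (intro summable_mult2 summable_geometric) auto
  then show ?thesis by (simp add: power_add)
qed

lemma Fs_summable:
  assumes "z \<in> V"
  shows "summable (\<lambda>k. norm (Fs (k + N) z))"
proof -
  obtain \<zeta> d where zd: "good \<zeta> d" "z \<in> ball \<zeta> (d / 4)" using V_obtain[OF assms] by blast
  show ?thesis
    by (rule summable_comparison_test'[OF summable_quarter[of N d]]) (use Fs_bound[OF zd] in auto)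
qed

lemma TT_holo: "TT N holomorphic_on V"
proof (rule holomorphic_uniform_sequence[OF open_V])
  show "(\<lambda>z. \<Sum>k<n. Fs (k + N) z) holomorphic_on V" for n
    by (intro holomorphic_intros Fs_holo_V)
  fix x assume "x \<in> V"
  then obtain \<zeta> d where zd: "good \<zeta> d" "x \<in> ball \<zeta> (d / 4)" and sub: "ball \<zeta> (d / 4) \<subseteq> V"
    by (rule V_obtain)
  obtain e where e: "e > 0" "cball x e \<subseteq> ball \<zeta> (d / 4)"
    using zd(2) open_contains_cball[of "ball \<zeta> (d / 4)"] open_ball by blast
  have "uniform_limit (cball x e) (\<lambda>n z. \<Sum>k<n. Fs (k + N) z) (\<lambda>z. \<Sum>k. Fs (k + N) z) sequentially"
    by (rule Weierstrass_m_test[OF _ summable_quarter[of N d]]) (use e Fs_bound[OF zd(1)] in blast)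
  then show "\<exists>d>0. cball x d \<subseteq> V \<and> uniform_limit (cball x d) (\<lambda>n z. \<Sum>k<n. Fs (k + N) z) (TT N) sequentially"
    using e sub unfolding TT_def by (intro exI[of _ e]) auto
qed

lemma ball_subset_V: "ball 0 1 \<subseteq> V"
  using disc_subset_V E by force

lemma TT_holo_ball: "TT N holomorphic_on ball 0 1"
  by (rule holomorphic_on_subset[OF TT_holo ball_subset_V])

lemma TT_split: "z \<in> V \<Longrightarrow> TT 0 z = TT N z + (\<Sum>k<N. Fs k z)"
  unfolding TT_def using suminf_split_initial_segment[OF summable_norm_cancel[OF Fs_summable[of z 0]], of N]
  by simp

text \<open>All real parts are nonnegative on the closed disc, so any partial sum bounds the series
  from below. Partial sums are continuous up to \<open>E\<close>, where the series itself
  diverges.\<close>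

lemma Re_TT_ge:
  assumes "z \<in> cball 0 1 - E"
  shows "(\<Sum>k<n. Re (Fs (k + N) z)) \<le> Re (TT N z)"
proof -
  have z: "z \<in> V" using assms disc_subset_V by blast
  have "(\<lambda>k. Re (Fs (k + N) z)) sums Re (TT N z)"
    unfolding TT_def by (intro sums_Re summable_sums summable_norm_cancel[OF Fs_summable[OF z]])
  then have s: "summable (\<lambda>k. Re (Fs (k + N) z))" "(\<Sum>k. Re (Fs (k + N) z)) = Re (TT N z)"
    by (auto simp: sums_iff)
  have "(\<Sum>k<n. Re (Fs (k + N) z)) \<le> (\<Sum>k. Re (Fs (k + N) z))"
    by (rule sum_le_suminf[OF s(1)]) (use assms Fs_Re in auto)
  then show ?thesis by (simp only: s(2))
qed

lemma Re_TT_nonneg: "z \<in> cball 0 1 - E \<Longrightarrow> 0 \<le> Re (TT N z)"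
  using Re_TT_ge[of z N 0] by simp

text \<open>On \<open>E\<close> the real parts sum to infinity and \<open>TT N\<close> has no
  meaningful value; 0 is the limit of the exponential there.\<close>

definition fN :: "nat \<Rightarrow> complex \<Rightarrow> complex" where
  "fN N z = (if z \<in> E then 0 else exp (- TT N z))"

lemma fN_ball: "cmod z < 1 \<Longrightarrow> fN N z = exp (- TT N z)"
  using E by (auto simp: fN_def)

lemma fN_holo: "fN N holomorphic_on ball 0 1"
proof -
  have "(\<lambda>z. exp (- TT N z)) holomorphic_on ball 0 1" by (intro holomorphic_intros TT_holo_ball)
  then show ?thesis by (rule holomorphic_transform) (simp add: fN_ball)
qed

lemma fN_le_1: "cmod z \<le> 1 \<Longrightarrow> cmod (fN N z) \<le> 1"
  using Re_TT_nonneg[of z N] by (simp add: fN_def)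

text \<open>At a point of \<open>E\<close> the first \<open>n\<close> real parts sum to at least
  \<open>n\<close>, so by continuity to more than \<open>n - 1\<close> nearby; this bounds the
  modulus by \<open>exp (1 - n)\<close> close to the point.\<close>

lemma fN_cont: "continuous_on (cball 0 1) (fN N)"
  unfolding continuous_on_def
proof
  fix z :: complex assume z: "z \<in> cball 0 1"
  show "(fN N \<longlongrightarrow> fN N z) (at z within cball 0 1)"
  proof (cases "z \<in> E")
    case False
    then have zV: "z \<in> V" using z disc_subset_V by blast
    have "continuous_on V (\<lambda>z. exp (- TT N z))"
      by (intro continuous_intros holomorphic_on_imp_continuous_on TT_holo)
    then have "continuous_on V (fN N)"
      by (rule continuous_on_eq) (use V_disjoint in \<open>auto simp: fN_def\<close>)
    then have "isCont (fN N) z" using zV open_V continuous_on_eq_continuous_at by blast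
    then show ?thesis unfolding isCont_def by (rule tendsto_within_subset) auto
  next
    case True
    have "(fN N \<longlongrightarrow> 0) (at z within cball 0 1)"
    proof (rule tendstoI)
      fix e :: real assume "e > 0"
      obtain n :: nat where n: "exp (1 - real n) < e"
      proof -
        obtain n :: nat where "1 - ln e < real n" using reals_Archimedean2 by blast
        then have "exp (1 - real n) < exp (ln e)" by simp
        then show ?thesis using that \<open>e > 0\<close> by simp
      qed
      define g where "g z = (\<Sum>k<n. Re (Fs (k + N) z))" for z
      have "continuous_on (cball 0 1) g"
        unfolding g_def by (intro continuous_intros Fs_cont)
      then have "(g \<longlongrightarrow> g z) (at z within cball 0 1)" using z by (auto simp: continuous_on_def)
      moreover have "real n - 1 < g z"
      proof -
        have "real n = (\<Sum>k<n. 1)" by simp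
        also have "\<dots> \<le> g z" unfolding g_def by (intro sum_mono Fs_E True)
        finally show ?thesis by simp
      qed
      ultimately have "eventually (\<lambda>w. real n - 1 < g w) (at z within cball 0 1)"
        by (rule order_tendstoD(1))
      moreover have "eventually (\<lambda>w. w \<in> cball 0 1) (at z within cball 0 1)"
        by (simp add: eventually_at_filter)
      ultimately show "eventually (\<lambda>w. dist (fN N w) 0 < e) (at z within cball 0 1)"
      proof eventually_elim
        case (elim w)
        show ?case
        proof (cases "w \<in> E")
          case False
          have "real n - 1 < Re (TT N w)"
            using Re_TT_ge[of w N n] elim False by (auto simp: g_def)
          then have "exp (- Re (TT N w)) < exp (1 - real n)" by simp
          from less_trans[OF this n] show ?thesis using False by (simp add: fN_def)
        qed (use \<open>e > 0\<close> in \<open>simp add: fN_def\<close>)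
      qed
    qed
    then show ?thesis using True by (simp add: fN_def)
  qed
qed

text \<open>Coefficients are integrals over the circle of radius 1/2, whose points keep distance at
  least 1/2 from \<open>E\<close>; there \<open>Fs_local\<close> with \<open>d = 1/2\<close> allows
  the series to be integrated termwise.\<close>

lemma taylor_TT_sums: "(\<lambda>k. taylor (Fs (k + N)) n) sums taylor (TT N) n"
proof -
  have r: "(0::real) < 1 / 2" "(1/2::real) < 1" by auto
  have good: "good (of_real (1/2) * \<zeta>) (1/2)" if "\<zeta> \<in> unit_circle" for \<zeta>
    unfolding good_def
  proof (intro conjI ballI)
    fix y assume "y \<in> E"
    then have "cmod y = 1" using E by auto
    then show "1/2 \<le> dist (of_real (1/2) * \<zeta>) y"
      using norm_triangle_ineq2[of y "of_real (1/2) * \<zeta>"] that by (simp add: dist_norm norm_mult norm_minus_commute)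
  qed (use that in \<open>auto simp: norm_mult\<close>)
  have b: "norm (\<zeta> powi (- int n) * Fs (k + N) (of_real (1/2) * \<zeta>)) \<le> (1 / 4) ^ Suc (k + N) / (1/2)"
    if "\<zeta> \<in> unit_circle" for \<zeta> k
  proof -
    have "cmod (Fs (k + N) (of_real (1/2) * \<zeta>)) \<le> (1 / 4) ^ Suc (k + N) / (1/2)"
      by (rule Fs_bound[OF good[OF that]]) auto
    then show ?thesis using that by (simp add: norm_mult norm_power_int)
  qed
  have cont: "continuous_on unit_circle (\<lambda>\<zeta>. Fs k (of_real (1/2) * \<zeta>))" for k
    by (intro continuous_on_compose2[OF Fs_cont] continuous_intros) (auto simp: norm_mult)
  have int: "integrable circle_measure (\<lambda>\<zeta>. \<zeta> powi (- int n) * Fs (k + N) (of_real (1/2) * \<zeta>))" for k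
    by (intro integrable_circle continuous_intros cont)
  have "(\<lambda>k. LINT \<zeta>|circle_measure. \<zeta> powi (- int n) * Fs (k + N) (of_real (1/2) * \<zeta>)) sums
     (LINT \<zeta>|circle_measure. (\<Sum>k. \<zeta> powi (- int n) * Fs (k + N) (of_real (1/2) * \<zeta>)))"
  proof (rule sums_integral[OF int])
    show "AE \<zeta> in circle_measure. summable (\<lambda>k. norm (\<zeta> powi (- int n) * Fs (k + N) (of_real (1/2) * \<zeta>)))"
    proof (intro AE_I2 summable_comparison_test'[OF summable_quarter[of N "1/2"]])
      fix \<zeta> k assume "\<zeta> \<in> space circle_measure"
      then show "norm (norm (\<zeta> powi (- int n) * Fs (k + N) (of_real (1/2) * \<zeta>))) \<le> (1 / 4) ^ Suc (k + N) / (1/2)"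
        using b[of \<zeta> k] by simp
    qed
    show "summable (\<lambda>k. LINT \<zeta>|circle_measure. norm (\<zeta> powi (- int n) * Fs (k + N) (of_real (1/2) * \<zeta>)))"
    proof (rule summable_comparison_test'[OF summable_quarter[of N "1/2"]])
      fix k
      have "(LINT \<zeta>|circle_measure. norm (\<zeta> powi (- int n) * Fs (k + N) (of_real (1/2) * \<zeta>)))
         \<le> (LINT \<zeta>|circle_measure. (1 / 4) ^ Suc (k + N) / (1/2))"
        by (intro integral_mono integrable_norm int b) auto
      also have "\<dots> = (1 / 4) ^ Suc (k + N) / (1/2)" using circle.prob_space by simp
      finally show "norm (LINT \<zeta>|circle_measure. norm (\<zeta> powi (- int n) * Fs (k + N) (of_real (1/2) * \<zeta>)))
        \<le> (1 / 4) ^ Suc (k + N) / (1/2)" by (simp add: integral_nonneg_AE)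
    qed
  qed
  also have "(\<lambda>k. LINT \<zeta>|circle_measure. \<zeta> powi (- int n) * Fs (k + N) (of_real (1/2) * \<zeta>))
     = (\<lambda>k. taylor (Fs (k + N)) n * of_real (1/2) ^ n)"
    using fourier_coeff_dilation[OF Fs_holo_ball r, of _ "int n"] by (simp add: fourier_coeff_def)
  also have "(LINT \<zeta>|circle_measure. (\<Sum>k. \<zeta> powi (- int n) * Fs (k + N) (of_real (1/2) * \<zeta>)))
     = (LINT \<zeta>|circle_measure. \<zeta> powi (- int n) * TT N (of_real (1/2) * \<zeta>))"
  proof (rule Bochner_Integration.integral_cong[OF refl])
    fix \<zeta> assume "\<zeta> \<in> space circle_measure"
    then have "of_real (1/2) * \<zeta> \<in> V" using ball_subset_V by (auto simp: norm_mult subset_iff)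
    from suminf_mult[OF summable_norm_cancel[OF Fs_summable[OF this, of N]], of "\<zeta> powi (- int n)"]
    show "(\<Sum>k. \<zeta> powi (- int n) * Fs (k + N) (of_real (1/2) * \<zeta>)) = \<zeta> powi (- int n) * TT N (of_real (1/2) * \<zeta>)"
      by (simp add: TT_def)
  qed
  also have "\<dots> = taylor (TT N) n * of_real (1/2) ^ n"
    using fourier_coeff_dilation[OF TT_holo_ball r, of N "int n"] by (simp add: fourier_coeff_def)
  finally have "(\<lambda>k. taylor (Fs (k + N)) n * of_real (1/2) ^ n * 2 ^ n) sums (taylor (TT N) n * of_real (1/2) ^ n * 2 ^ n)"
    by (rule sums_mult2)
  then show ?thesis by (simp add: power_divide)
qed

text \<open>The weights of \<open>dyadic_norm_sum_squared\<close> leave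
  \<open>\<Sum>k. 2 ^ Suc k * (1 / 4) ^ Suc (k + N)\<close>, which is \<open>(1 / 4) ^ N\<close>
  times a geometric series with sum 1.\<close>

lemma TT_wnorm2: "wsummable \<Omega> (taylor (TT N))" "wnorm2 \<Omega> (taylor (TT N)) \<le> (1 / 4) ^ N"
proof -
  have "(\<Sum>n<L. \<Omega> n * (cmod (taylor (TT N) n))\<^sup>2) \<le> (1 / 4) ^ N" for L
  proof (rule LIMSEQ_le_const2)
    show "(\<lambda>M. \<Sum>n<L. \<Omega> n * (cmod (\<Sum>k<M. taylor (Fs (k + N)) n))\<^sup>2) \<longlonglongrightarrow> (\<Sum>n<L. \<Omega> n * (cmod (taylor (TT N) n))\<^sup>2)"
      by (intro tendsto_intros taylor_TT_sums[unfolded sums_def])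
    have "(\<Sum>n<L. \<Omega> n * (cmod (\<Sum>k<M. taylor (Fs (k + N)) n))\<^sup>2) \<le> (1 / 4) ^ N" for M
    proof -
      have "(\<Sum>n<L. \<Omega> n * (cmod (\<Sum>k<M. taylor (Fs (k + N)) n))\<^sup>2)
          \<le> (\<Sum>n<L. \<Omega> n * (\<Sum>k<M. 2 ^ Suc k * (cmod (taylor (Fs (k + N)) n))\<^sup>2))"
        by (intro sum_mono mult_left_mono dyadic_norm_sum_squared) auto
      also have "\<dots> = (\<Sum>n<L. \<Sum>k<M. 2 ^ Suc k * (\<Omega> n * (cmod (taylor (Fs (k + N)) n))\<^sup>2))"
        by (simp add: sum_distrib_left mult_ac)
      also have "\<dots> = (\<Sum>k<M. 2 ^ Suc k * (\<Sum>n<L. \<Omega> n * (cmod (taylor (Fs (k + N)) n))\<^sup>2))"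
        by (subst sum.swap) (simp add: sum_distrib_left)
      also have "\<dots> \<le> (\<Sum>k<M. 2 ^ Suc k * (1 / 4) ^ Suc (k + N))"
        by (intro sum_mono mult_left_mono order_trans[OF wsum_le_wnorm2 Fs_wnorm2] Fs_wsummable) auto
      also have "\<dots> = (1 / 4) ^ N * ((\<Sum>k<M. (1 / 2) ^ Suc k))"
      proof -
        have "(4::real) ^ k = 2 ^ k * 2 ^ k" for k
          by (simp flip: power_mult_distrib)
        then have "(2::real) ^ Suc k * (1 / 4) ^ Suc (k + N) = (1 / 4) ^ N * (1 / 2) ^ Suc k" for k
          by (simp add: power_add power_divide field_simps)
        then show ?thesis by (simp only: sum_distrib_left)
      qed
      also have "\<dots> \<le> (1 / 4) ^ N * 1"
      proof (intro mult_left_mono)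
        have "(\<Sum>k<M. (1 / 2 :: real) ^ Suc k) \<le> (\<Sum>k. (1 / 2) ^ Suc k)"
          using power_half_series by (intro sum_le_suminf) (auto simp: sums_iff)
        then show "(\<Sum>k<M. (1 / 2 :: real) ^ Suc k) \<le> 1" using power_half_series by (simp add: sums_iff)
      qed auto
      finally show ?thesis by simp
    qed
    then show "\<exists>K. \<forall>M\<ge>K. (\<Sum>n<L. \<Omega> n * (cmod (\<Sum>k<M. taylor (Fs (k + N)) n))\<^sup>2) \<le> (1 / 4) ^ N" by blast
  qed
  then show "wsummable \<Omega> (taylor (TT N))" "wnorm2 \<Omega> (taylor (TT N)) \<le> (1 / 4) ^ N"
    by (rule wsummable_bounded)+
qed

text \<open>\<open>fN N - 1\<close> is a contraction of \<open>TT N\<close>, and its value at 0 is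
  dominated by \<open>TT N 0\<close> as well. This is the quantitative form of \<open>fN N\<close>
  tending to 1. The second majorant of \<open>contraction\<close> enters with coefficient 0.\<close>

lemma fN_minus_1:
  "wsummable \<Omega> (taylor (\<lambda>z. fN N z - 1))"
  "wnorm2 \<Omega> (taylor (\<lambda>z. fN N z - 1)) \<le> (1 + diff_const) * (1 / 4) ^ N"
proof -
  have h: "(\<lambda>z. fN N z - 1) holomorphic_on ball 0 1" by (intro holomorphic_intros fN_holo)
  have notE: "cmod z < 1 \<Longrightarrow> z \<in> cball 0 1 - E" for z using E by auto
  have le: "(cmod ((fN N z - 1) - (fN N w - 1)))\<^sup>2 \<le> 1 * (cmod (TT N z - TT N w))\<^sup>2 + 0 * (cmod (TT N z - TT N w))\<^sup>2"
    if "cmod z < 1" "cmod w < 1" for z w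
    using exp_minus_contraction[OF Re_TT_nonneg[OF notE[OF that(1)]] Re_TT_nonneg[OF notE[OF that(2)]], of N N] that
    by (simp add: fN_ball power_mono)
  note c = contraction[OF h TT_holo_ball TT_holo_ball _ _ le TT_wnorm2(1) TT_wnorm2(1)]
  show "wsummable \<Omega> (taylor (\<lambda>z. fN N z - 1))" by (rule c) auto
  have "cmod (fN N 0 - 1) \<le> cmod (TT N 0)"
    using exp_minus_contraction[of "TT N 0" 0] Re_TT_nonneg[OF notE[of 0], of N] by (simp add: fN_ball)
  then have "\<Omega> 0 * (cmod (fN N 0 - 1))\<^sup>2 \<le> \<Omega> 0 * (cmod (taylor (TT N) 0))\<^sup>2"
    by (intro mult_left_mono power_mono) (auto simp: taylor_def)
  also have "\<dots> \<le> wnorm2 \<Omega> (taylor (TT N))"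
    using wsum_le_wnorm2[OF TT_wnorm2(1), of "{0}" N] by simp
  finally have 0: "\<Omega> 0 * (cmod (fN N 0 - 1))\<^sup>2 \<le> (1 / 4) ^ N" using TT_wnorm2(2)[of N] by linarith
  have "wnorm2 \<Omega> (taylor (\<lambda>z. fN N z - 1)) \<le> \<Omega> 0 * (cmod (fN N 0 - 1))\<^sup>2
      + diff_const * (1 * wnorm2 \<Omega> (taylor (TT N)) + 0 * wnorm2 \<Omega> (taylor (TT N)))"
    by (rule c) auto
  also have "\<dots> \<le> (1 / 4) ^ N + diff_const * (1 / 4) ^ N"
    using 0 TT_wnorm2(2)[of N] diff_const_nonneg by (intro add_mono mult_left_mono) auto
  finally show "wnorm2 \<Omega> (taylor (\<lambda>z. fN N z - 1)) \<le> (1 + diff_const) * (1 / 4) ^ N"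
    by (simp add: algebra_simps)
qed

lemma fN_wsummable: "wsummable \<Omega> (taylor (fN N))"
proof -
  have "taylor (fN N) = (\<lambda>n. taylor (\<lambda>z. fN N z - 1) n + taylor (\<lambda>_. 1) n)"
    using taylor_diff[OF fN_holo, of "\<lambda>_. 1" N] by (auto simp: holomorphic_on_const)
  moreover have "wsummable \<Omega> (taylor (\<lambda>_. 1))"
    by (rule wsummable_finite) (auto simp: taylor_const)
  ultimately show ?thesis using wsummable_add(1)[OF fN_minus_1(1)] by simp
qed

text \<open>\<open>fN 0 * exp S = fN N\<close> is close to 1. Since \<open>S\<close> is analytic
  beyond the closed disc, the Taylor remainders of \<open>exp S\<close> tend to 0 both uniformly and
  in weighted norm, as \<open>taylor_product_bound\<close> demands.\<close>

lemma approximate_one: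
  assumes "\<epsilon> > 0"
  shows "\<exists>p. wsummable \<Omega> (taylor (\<lambda>z. fN 0 z * poly p z - 1)) \<and> wnorm2 \<Omega> (taylor (\<lambda>z. fN 0 z * poly p z - 1)) < \<epsilon>"
proof -
  have "(\<lambda>N. (1 + diff_const) * (1 / 4) ^ N) \<longlonglongrightarrow> (1 + diff_const) * 0"
    by (intro tendsto_intros LIMSEQ_power_zero) auto
  \<comment> \<open>There will be two errors below \<open>\<epsilon> / 4\<close>, each doubled by
    \<open>wsummable_diff\<close>.\<close>
  then have "eventually (\<lambda>N. (1 + diff_const) * (1 / 4) ^ N < \<epsilon> / 4) sequentially"
    using \<open>\<epsilon> > 0\<close> by (intro order_tendstoD(2)[where y = "(1 + diff_const) * 0"]) auto
  then obtain N where N: "(1 + diff_const) * (1 / 4) ^ N < \<epsilon> / 4"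
    by (auto simp: eventually_sequentially)
  define S where "S z = (\<Sum>k<N. Fs k z)" for z
  define g where "g z = exp (S z)" for z
  obtain R where R: "R > 1" "S holomorphic_on ball 0 R"
  proof -
    have "\<exists>R>1. (\<lambda>z. \<Sum>k<n. Fs k z) holomorphic_on ball 0 R" for n
    proof (induction n)
      case 0
      show ?case by (intro exI[of _ 2]) auto
    next
      case (Suc n)
      then obtain R where R: "R > 1" "(\<lambda>z. \<Sum>k<n. Fs k z) holomorphic_on ball 0 R" by blast
      obtain R' where R': "R' > 1" "Fs n holomorphic_on ball 0 R'" using Fs_holo by blast
      have "(\<lambda>z. (\<Sum>k<n. Fs k z) + Fs n z) holomorphic_on ball 0 (min R R')"
        by (intro holomorphic_intros holomorphic_on_subset[OF R(2)] holomorphic_on_subset[OF R'(2)]) auto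
      then show ?case using R R' by (intro exI[of _ "min R R'"]) auto
    qed
    then show ?thesis using that unfolding S_def by blast
  qed
  have gR: "g holomorphic_on ball 0 R" unfolding g_def by (intro holomorphic_intros R(2))
  have gh: "g holomorphic_on ball 0 1" by (rule holomorphic_on_subset[OF gR]) (use R in auto)
  have Sh: "S holomorphic_on ball 0 1" by (rule holomorphic_on_subset[OF R(2)]) (use R in auto)
  \<comment> \<open>A finite sum is the difference of two tails, whose norms are already known to be
    finite.\<close>
  have Sw: "wsummable \<Omega> (taylor S)"
  proof -
    have "taylor S n = taylor (\<lambda>z. TT 0 z - TT N z) n" for n
      by (rule taylor_cong) (use ball_subset_V TT_split[of _ N] in \<open>auto intro!: holomorphic_intros TT_holo_ball simp: S_def subset_iff\<close>)
    then have "taylor S = (\<lambda>n. taylor (TT 0) n - taylor (TT N) n)"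
      by (simp add: fun_eq_iff taylor_diff TT_holo_ball)
    then show ?thesis using wsummable_diff(1)[OF TT_wnorm2(1) TT_wnorm2(1)] by simp
  qed
  have gw: "wsummable \<Omega> (taylor g)"
  proof -
    have "continuous_on (cball 0 1) S" unfolding S_def by (intro continuous_intros Fs_cont)
    then have "compact (S ` cball 0 1)" by (intro compact_continuous_image) auto
    then obtain B where "\<forall>y\<in>S ` cball 0 1. cmod y \<le> B" using compact_imp_bounded bounded_iff by metis
    then have B: "Re (S z) \<le> B" if "cmod z < 1" for z
    proof -
      have "cmod (S z) \<le> B"
        using \<open>\<forall>y\<in>S ` cball 0 1. cmod y \<le> B\<close> that by simp
      then show ?thesis using complex_Re_le_cmod[of "S z"] by linarith
    qed
    have le: "(cmod (g z - g w))\<^sup>2 \<le> (exp B)\<^sup>2 * (cmod (S z - S w))\<^sup>2 + 0 * (cmod (S z - S w))\<^sup>2"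
      if "cmod z < 1" "cmod w < 1" for z w
      using power_mono[OF exp_Lipschitz[OF B[OF that(1)] B[OF that(2)]], of 2]
      by (simp add: g_def power_mult_distrib)
    show ?thesis by (rule contraction(1)[OF gh Sh Sh _ _ le Sw Sw]) auto
  qed
  have sg: "summable (\<lambda>n. cmod (taylor g n))"
    using summable_taylor_norm[OF gR, of 1] R by simp
  \<comment> \<open>The tail of the absolutely convergent coefficient series bounds the remainder
    \<open>q j\<close> uniformly on the disc.\<close>
  define e where "e j = (\<Sum>n. cmod (taylor g (n + j)))" for j
  have e0: "e \<longlonglongrightarrow> 0"
  proof -
    have eq: "e = (\<lambda>j. (\<Sum>n. cmod (taylor g n)) - (\<Sum>n<j. cmod (taylor g n)))"
      by (rule ext) (simp only: e_def suminf_minus_initial_segment[OF sg])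
    have "(\<lambda>j. (\<Sum>n. cmod (taylor g n)) - (\<Sum>n<j. cmod (taylor g n))) \<longlonglongrightarrow> (\<Sum>n. cmod (taylor g n)) - (\<Sum>n. cmod (taylor g n))"
      by (intro tendsto_intros summable_LIMSEQ sg)
    then show ?thesis unfolding eq by simp
  qed
  define P where "P j = (\<Sum>n<j. monom (taylor g n) n)" for j
  have cP: "coeff (P j) n = (if n < j then taylor g n else 0)" for j n
    by (simp add: P_def coeff_sum)
  define q where "q j z = g z - poly (P j) z" for j z
  have qh: "q j holomorphic_on ball 0 1" for j
    unfolding q_def by (intro holomorphic_on_diff gh holomorphic_poly)
  have tq: "taylor (q j) = (\<lambda>n. if n < j then 0 else taylor g n)" for j
  proof
    fix n
    have "taylor (q j) n = taylor g n - taylor (poly (P j)) n"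
      unfolding q_def by (rule taylor_diff[OF gh holomorphic_poly])
    then show "taylor (q j) n = (if n < j then 0 else taylor g n)"
      by (simp add: taylor_poly cP)
  qed
  have qw: "wsummable \<Omega> (taylor (q j))" for j
    unfolding tq by (rule wsummable_le(1)[OF gw]) auto
  have qe: "cmod (q j z) \<le> e j" if z: "cmod z < 1" for j z
  proof -
    have s: "(\<lambda>n. taylor (q j) n * z ^ n) sums q j z" by (rule taylor_sums[OF qh z])
    have "(\<lambda>n. taylor (q j) (n + j) * z ^ (n + j)) sums (q j z - (\<Sum>n<j. taylor (q j) n * z ^ n))"
      using sums_iff_shift[of "\<lambda>n. taylor (q j) n * z ^ n" j "q j z - (\<Sum>n<j. taylor (q j) n * z ^ n)"] s by simp
    then have s': "(\<lambda>n. taylor g (n + j) * z ^ (n + j)) sums q j z" by (simp add: tq)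
    have le: "norm (taylor g (n + j) * z ^ (n + j)) \<le> cmod (taylor g (n + j))" for n
      using z by (simp add: norm_mult norm_power mult_left_le power_le_one)
    have sgj: "summable (\<lambda>n. cmod (taylor g (n + j)))" using sg by (rule summable_ignore_initial_segment)
    have sn: "summable (\<lambda>n. norm (taylor g (n + j) * z ^ (n + j)))"
      by (rule summable_comparison_test'[OF sgj]) (use le in auto)
    have "cmod (q j z) = norm (\<Sum>n. taylor g (n + j) * z ^ (n + j))" using s' by (simp add: sums_iff)
    also have "\<dots> \<le> (\<Sum>n. norm (taylor g (n + j) * z ^ (n + j)))" by (rule summable_norm[OF sn])
    also have "\<dots> \<le> e j" unfolding e_def by (rule suminf_le[OF le sn sgj])
    finally show ?thesis .
  qed
  have fb: "cmod (fN 0 z) \<le> 1" if "cmod z < 1" for z using fN_le_1[of z 0] that by simp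
  note prod = taylor_product_bound[OF fN_holo[of 0] qh fb qe fN_wsummable[of 0] qw]
  have "(\<lambda>j. wnorm2 \<Omega> (taylor (q j))) \<longlonglongrightarrow> 0"
    unfolding tq by (rule wnorm2_tail_tendsto[OF gw])
  then have "(\<lambda>j. \<Omega> 0 * (e j)\<^sup>2 + diff_const * (2 * (e j)\<^sup>2 * wnorm2 \<Omega> (taylor (fN 0)) + 2 * wnorm2 \<Omega> (taylor (q j))))
     \<longlonglongrightarrow> \<Omega> 0 * 0\<^sup>2 + diff_const * (2 * 0\<^sup>2 * wnorm2 \<Omega> (taylor (fN 0)) + 2 * 0)"
    by (intro tendsto_intros e0)
  then have "eventually (\<lambda>j. \<Omega> 0 * (e j)\<^sup>2 + diff_const * (2 * (e j)\<^sup>2 * wnorm2 \<Omega> (taylor (fN 0)) + 2 * wnorm2 \<Omega> (taylor (q j))) < \<epsilon> / 4) sequentially"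
    by (rule order_tendstoD(2)) (use \<open>\<epsilon> > 0\<close> in simp)
  then obtain j where j: "\<Omega> 0 * (e j)\<^sup>2 + diff_const * (2 * (e j)\<^sup>2 * wnorm2 \<Omega> (taylor (fN 0)) + 2 * wnorm2 \<Omega> (taylor (q j))) < \<epsilon> / 4"
    by (auto simp: eventually_sequentially)
  have fq: "wnorm2 \<Omega> (taylor (\<lambda>z. fN 0 z * q j z)) < \<epsilon> / 4" using prod(2)[of j] j by linarith
  have eq: "taylor (\<lambda>z. fN 0 z * poly (P j) z - 1) = (\<lambda>n. taylor (\<lambda>z. fN N z - 1) n - taylor (\<lambda>z. fN 0 z * q j z) n)"
  proof
    fix n
    have "taylor (\<lambda>z. fN 0 z * poly (P j) z - 1) n = taylor (\<lambda>z. (fN N z - 1) - fN 0 z * q j z) n"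
    proof (rule taylor_cong)
      show "(\<lambda>z. (fN N z - 1) - fN 0 z * q j z) holomorphic_on ball 0 1"
        by (intro holomorphic_intros fN_holo qh)
      fix z :: complex assume z: "cmod z < 1"
      then have "z \<in> V" using ball_subset_V by auto
      then have "fN 0 z * g z = fN N z"
        using z TT_split[of z N] by (simp add: fN_ball g_def S_def exp_add[symmetric])
      then show "fN 0 z * poly (P j) z - 1 = (fN N z - 1) - fN 0 z * q j z"
        by (simp add: q_def algebra_simps)
    qed
    then show "taylor (\<lambda>z. fN 0 z * poly (P j) z - 1) n = taylor (\<lambda>z. fN N z - 1) n - taylor (\<lambda>z. fN 0 z * q j z) n"
      by (subst (asm) taylor_diff) (auto intro!: holomorphic_intros fN_holo qh)
  qed
  show ?thesis
    unfolding eq[symmetric] using wsummable_diff[OF fN_minus_1(1)[of N] prod(1)[of j]] fN_minus_1(2)[of N] N fq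
    by (intro exI[of _ "P j"]) (auto simp: eq)
qed

section \<open>Boundary behaviour: nullity of the zero set, outerness and analytic
  continuation\<close>

lemma Fs_at_0: "cmod (Fs k 0) \<le> (1 / 4) ^ Suc k"
proof -
  have "good 0 1" using E by (auto simp: good_def dist_norm)
  then show ?thesis using Fs_bound[of 0 1 0 k] by simp
qed

lemma Fs_mean: "(LINT \<zeta>|circle_measure. Re (Fs k \<zeta>)) = Re (Fs k 0)"
proof -
  have c: "continuous_on unit_circle (Fs k)" by (rule continuous_on_subset[OF Fs_cont]) auto
  have "(LINT \<zeta>|circle_measure. Fs k \<zeta>) = Fs k 0"
    using fourier_coeff_disc_algebra[OF Fs_cont Fs_holo_ball, of k 0] by (simp add: fourier_coeff_def taylor_def)
  then show ?thesis using integral_Re[OF integrable_circle[OF c]] by simp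
qed

lemma summable_Re_Fs_0: "summable (\<lambda>k. Re (Fs k 0))"
proof (rule summable_comparison_test'[OF summable_quarter[of 0 1]])
  show "norm (Re (Fs k 0)) \<le> (1 / 4) ^ Suc (k + 0) / 1" for k
    using Fs_at_0[of k] abs_Re_le_cmod[of "Fs k 0"] by simp
qed

lemma E_sets: "E \<in> sets circle_measure"
  using E by (auto simp: sets_circle_measure sets_restrict_space_iff intro!: borel_closed compact_imp_closed)

lemma integrable_Re_Fs: "integrable circle_measure (\<lambda>\<zeta>. Re (Fs k \<zeta>))"
  by (intro integrable_circle continuous_intros continuous_on_subset[OF Fs_cont]) auto

text \<open>The series of the real parts is integrable but diverges on \<open>E\<close>.\<close>

lemma E_null: "AE \<zeta> in circle_measure. \<zeta> \<notin> E"
proof -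
  have [measurable]: "(\<lambda>\<zeta>. Re (Fs k \<zeta>)) \<in> borel_measurable circle_measure" for k
    using integrable_Re_Fs by auto
  have "(\<integral>\<^sup>+\<zeta>. (\<Sum>k. ennreal (Re (Fs k \<zeta>))) \<partial>circle_measure) = (\<Sum>k. \<integral>\<^sup>+\<zeta>. ennreal (Re (Fs k \<zeta>)) \<partial>circle_measure)"
    by (intro nn_integral_suminf) auto
  also have "\<dots> = (\<Sum>k. ennreal (Re (Fs k 0)))"
    by (intro arg_cong[where f = suminf] ext)
      (subst nn_integral_eq_integral[OF integrable_Re_Fs], auto simp: Fs_mean Fs_Re)
  also have "\<dots> = ennreal (\<Sum>k. Re (Fs k 0))"
    by (intro suminf_ennreal2 summable_Re_Fs_0) (simp add: Fs_Re)
  finally have "(\<integral>\<^sup>+\<zeta>. (\<Sum>k. ennreal (Re (Fs k \<zeta>))) \<partial>circle_measure) \<noteq> \<infinity>" by simp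
  then have "AE \<zeta> in circle_measure. (\<Sum>k. ennreal (Re (Fs k \<zeta>))) \<noteq> \<infinity>"
    by (intro nn_integral_PInf_AE) auto
  then show ?thesis
  proof eventually_elim
    case (elim \<zeta>)
    show ?case
    proof
      assume z: "\<zeta> \<in> E"
      have "of_nat n \<le> (\<Sum>k. ennreal (Re (Fs k \<zeta>)))" for n :: nat
      proof -
        have "(of_nat n :: ennreal) = (\<Sum>k<n. 1)" by simp
        also have "\<dots> \<le> (\<Sum>k<n. ennreal (Re (Fs k \<zeta>)))"
          using Fs_E[OF z] by (intro sum_mono) (simp add: ennreal_leI flip: ennreal_1)
        also have "\<dots> \<le> (\<Sum>k. ennreal (Re (Fs k \<zeta>)))" by (intro sum_le_suminf) auto
        finally show ?thesis .
      qed
      then have "(SUP n. of_nat n :: ennreal) \<le> (\<Sum>k. ennreal (Re (Fs k \<zeta>)))" by (intro SUP_least)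
      then show False using elim by (simp add: ennreal_SUP_of_nat_eq_top top_unique)
    qed
  qed
qed

text \<open>Each \<open>Fs k\<close> is recovered from its boundary real part by
  \<open>Herglotz\<close>. Sum and integral may be exchanged because the nonnegative functions
  \<open>Re (Fs k \<zeta>)\<close> have integrals \<open>Re (Fs k 0)\<close>, which are
  summable.\<close>

lemma fN_outer: "outer (poisson (fN 0))"
proof -
  \<comment> \<open>The boundary modulus, altered to 1 on the null set \<open>E\<close> because
    \<open>outer\<close> asks for a density that is positive at every point of the circle.\<close>
  define \<phi> where "\<phi> \<zeta> = (if \<zeta> \<in> E then 1 else cmod (fN 0 \<zeta>))" for \<zeta>
  have ln\<phi>: "ln (\<phi> \<zeta>) = - Re (TT 0 \<zeta>)" if "\<zeta> \<notin> E" for \<zeta>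
    using that by (simp add: \<phi>_def fN_def)
  have TTsum: "(\<lambda>k. Re (Fs k \<zeta>)) sums Re (TT 0 \<zeta>)" if "\<zeta> \<in> unit_circle" "\<zeta> \<notin> E" for \<zeta>
  proof -
    have z: "\<zeta> \<in> V" using that disc_subset_V by auto
    show ?thesis using summable_norm_cancel[OF Fs_summable[OF z, of 0]] unfolding TT_def
      by (intro sums_Re) (simp add: summable_sums)
  qed
  have AEs: "AE \<zeta> in circle_measure. summable (\<lambda>k. norm (Re (Fs k \<zeta>)))"
    using E_null AE_space
  proof eventually_elim
    case (elim \<zeta>)
    then show ?case using TTsum[of \<zeta>] Fs_Re[of \<zeta>] by (simp add: sums_iff)
  qed
  have sI: "summable (\<lambda>k. LINT \<zeta>|circle_measure. norm (Re (Fs k \<zeta>)))"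
  proof -
    have "(LINT \<zeta>|circle_measure. norm (Re (Fs k \<zeta>))) = Re (Fs k 0)" for k
      unfolding Fs_mean[symmetric] by (intro Bochner_Integration.integral_cong) (auto simp: Fs_Re)
    then show ?thesis using summable_Re_Fs_0 by simp
  qed
  have meas\<phi>: "\<phi> \<in> borel_measurable circle_measure"
    unfolding \<phi>_def
  proof (rule measurable_If)
    have "continuous_on unit_circle (fN 0)" by (rule continuous_on_subset[OF fN_cont]) auto
    then show "(\<lambda>\<zeta>. cmod (fN 0 \<zeta>)) \<in> borel_measurable circle_measure"
      by (intro borel_measurable_circle continuous_intros)
    have "{x \<in> space circle_measure. x \<in> E} = E" using E by auto
    then show "{x \<in> space circle_measure. x \<in> E} \<in> sets circle_measure" using E_sets by simp
  qed simp
  have iln: "integrable circle_measure (\<lambda>\<zeta>. ln (\<phi> \<zeta>))"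
  proof -
    have i: "integrable circle_measure (\<lambda>\<zeta>. - (\<Sum>k. Re (Fs k \<zeta>)))"
      by (intro integrable_minus integrable_suminf[OF integrable_Re_Fs AEs sI])
    have "AE \<zeta> in circle_measure. - (\<Sum>k. Re (Fs k \<zeta>)) = ln (\<phi> \<zeta>)"
      using E_null AE_space
    proof eventually_elim
      case (elim \<zeta>)
      then show ?case using TTsum[of \<zeta>] by (simp add: ln\<phi> sums_iff)
    qed
    moreover have "(\<lambda>\<zeta>. ln (\<phi> \<zeta>)) \<in> borel_measurable circle_measure"
      using meas\<phi> by measurable
    ultimately show ?thesis using i integrable_cong_AE_imp by blast
  qed
  have main: "poisson (fN 0) z = 1 * exp (LINT \<zeta>|circle_measure. (\<zeta> + z) / (\<zeta> - z) * of_real (ln (\<phi> \<zeta>)))"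
    if z: "cmod z < 1" for z
  proof -
    define K where "K \<zeta> = (\<zeta> + z) / (\<zeta> - z)" for \<zeta>
    have Kc: "continuous_on unit_circle K"
      unfolding K_def using z unit_circle_ne by (intro continuous_intros) auto
    obtain B where B: "B > 0" "\<And>\<zeta>. \<zeta> \<in> unit_circle \<Longrightarrow> cmod (K \<zeta>) \<le> B" using bounded_on_circle[OF Kc] by metis
    have iK: "integrable circle_measure (\<lambda>\<zeta>. K \<zeta> * of_real (Re (Fs k \<zeta>)))" for k
      by (intro integrable_circle continuous_intros Kc continuous_on_subset[OF Fs_cont]) auto
    have Kle: "norm (K \<zeta> * of_real (Re (Fs k \<zeta>))) \<le> B * norm (Re (Fs k \<zeta>))" if "\<zeta> \<in> unit_circle" for \<zeta> k
      using B(2)[OF that] by (simp add: norm_mult mult_right_mono)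
    have "(\<lambda>k. LINT \<zeta>|circle_measure. K \<zeta> * of_real (Re (Fs k \<zeta>))) sums
        (LINT \<zeta>|circle_measure. (\<Sum>k. K \<zeta> * of_real (Re (Fs k \<zeta>))))"
    proof (rule sums_integral[OF iK])
      show "AE \<zeta> in circle_measure. summable (\<lambda>k. norm (K \<zeta> * of_real (Re (Fs k \<zeta>))))"
        using AEs AE_space
      proof eventually_elim
        case (elim \<zeta>)
        show ?case
          by (rule summable_comparison_test'[OF summable_mult[OF elim(1), of B]]) (use elim(2) Kle in auto)
      qed
      show "summable (\<lambda>k. LINT \<zeta>|circle_measure. norm (K \<zeta> * of_real (Re (Fs k \<zeta>))))"
      proof (rule summable_comparison_test'[OF summable_mult[OF sI, of B]])
        fix k
        have "(LINT \<zeta>|circle_measure. norm (K \<zeta> * of_real (Re (Fs k \<zeta>)))) \<le> (LINT \<zeta>|circle_measure. B * norm (Re (Fs k \<zeta>)))"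
          by (intro integral_mono integrable_norm iK integrable_mult_right integrable_Re_Fs Kle) auto
        then show "norm (LINT \<zeta>|circle_measure. norm (K \<zeta> * of_real (Re (Fs k \<zeta>)))) \<le> B * (LINT \<zeta>|circle_measure. norm (Re (Fs k \<zeta>)))"
          by (simp add: integral_nonneg_AE)
      qed
    qed
    moreover have "(LINT \<zeta>|circle_measure. K \<zeta> * of_real (Re (Fs k \<zeta>))) = Fs k z" for k
      unfolding K_def by (rule Herglotz[OF Fs_cont Fs_holo_ball Fs_Im z])
    moreover have "(LINT \<zeta>|circle_measure. (\<Sum>k. K \<zeta> * of_real (Re (Fs k \<zeta>)))) = (LINT \<zeta>|circle_measure. - (K \<zeta> * of_real (ln (\<phi> \<zeta>))))"
    proof (rule integral_cong_AE)
      show "(\<lambda>\<zeta>. \<Sum>k. K \<zeta> * of_real (Re (Fs k \<zeta>))) \<in> borel_measurable circle_measure"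
        using iK by (intro borel_measurable_suminf) auto
      have [measurable]: "K \<in> borel_measurable circle_measure" "\<phi> \<in> borel_measurable circle_measure"
        using borel_measurable_circle[OF Kc] meas\<phi> by auto
      show "(\<lambda>\<zeta>. - (K \<zeta> * of_real (ln (\<phi> \<zeta>)))) \<in> borel_measurable circle_measure" by measurable
      show "AE \<zeta> in circle_measure. (\<Sum>k. K \<zeta> * of_real (Re (Fs k \<zeta>))) = - (K \<zeta> * of_real (ln (\<phi> \<zeta>)))"
        using E_null AE_space
      proof eventually_elim
        case (elim \<zeta>)
        then have "(\<lambda>k. K \<zeta> * of_real (Re (Fs k \<zeta>))) sums (K \<zeta> * of_real (Re (TT 0 \<zeta>)))"
          by (intro sums_mult sums_of_real TTsum) auto
        then show ?case using elim by (simp add: ln\<phi> sums_iff)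
      qed
    qed
    ultimately have "(\<lambda>k. Fs k z) sums - (LINT \<zeta>|circle_measure. K \<zeta> * of_real (ln (\<phi> \<zeta>)))" by simp
    then have "TT 0 z = - (LINT \<zeta>|circle_measure. K \<zeta> * of_real (ln (\<phi> \<zeta>)))" by (simp add: TT_def sums_iff)
    then have "fN 0 z = exp (LINT \<zeta>|circle_measure. K \<zeta> * of_real (ln (\<phi> \<zeta>)))" using z by (simp add: fN_ball)
    then show ?thesis using poisson_disc_algebra[OF fN_cont fN_holo z] by (simp add: K_def)
  qed
  show ?thesis
    unfolding outer_def using main meas\<phi> iln
    by (intro exI[of _ 1] exI[of _ \<phi>]) (auto simp: \<phi>_def fN_def)
qed

lemma fN_continues: "\<zeta> \<in> unit_circle - E \<Longrightarrow> continues_analytically_at (poisson (fN 0)) \<zeta>"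
  unfolding continues_analytically_at_def
proof (intro exI conjI ballI)
  assume "\<zeta> \<in> unit_circle - E"
  then show "\<zeta> \<in> V" using disc_subset_V by auto
  show "(\<lambda>z. exp (- TT 0 z)) holomorphic_on V" by (intro holomorphic_intros TT_holo)
  fix z assume "z \<in> V \<inter> unit_disc"
  then show "exp (- TT 0 z) = poisson (fN 0) z"
    using poisson_disc_algebra[OF fN_cont fN_holo, of z 0] by (simp add: fN_ball)
qed (rule open_V)

end

section \<open>Analytic functions on the circle and their coefficients\<close>

definition hardy :: "(complex \<Rightarrow> complex) \<Rightarrow> bool" where
  "hardy u \<longleftrightarrow> integrable circle_measure u \<and> (\<forall>n<0. fourier_coeff u n = 0)"

definition cf :: "(complex \<Rightarrow> complex) \<Rightarrow> nat \<Rightarrow> complex" where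
  "cf u n = fourier_coeff u (int n)"

lemma L2_circle_integrable:
  assumes "f \<in> L2_circle"
  shows "integrable circle_measure f"
proof -
  have f: "f \<in> borel_measurable circle_measure" "integrable circle_measure (\<lambda>\<zeta>. (cmod (f \<zeta>))\<^sup>2)"
    using assms by (auto simp: L2_circle_def)
  have "integrable circle_measure (\<lambda>\<zeta>. cmod (f \<zeta>))"
    by (rule circle.square_integrable_imp_integrable[OF _ f(2)]) (use f(1) in measurable)
  then show ?thesis using f(1) by (simp add: integrable_norm_iff)
qed

lemma continuous_L2_circle: "continuous_on unit_circle f \<Longrightarrow> f \<in> L2_circle"
  by (simp add: L2_circle_def borel_measurable_circle integrable_circle continuous_intros)

lemma infsum_int_of_nat:
  fixes g :: "int \<Rightarrow> real"
  assumes "\<And>n. 0 \<le> g n" "\<And>n. n < 0 \<Longrightarrow> g n = 0"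
  shows "g summable_on UNIV \<longleftrightarrow> summable (\<lambda>n. g (int n))"
    and "summable (\<lambda>n. g (int n)) \<Longrightarrow> infsum g UNIV = (\<Sum>n. g (int n))"
proof -
  have neg: "g n = 0" if "n \<notin> range int" for n
  proof -
    have "n < 0" using that by (metis nonneg_int_cases not_le rangeI)
    then show ?thesis by (rule assms)
  qed
  have "g summable_on UNIV \<longleftrightarrow> g summable_on range int"
    by (rule summable_on_cong_neutral) (use neg in auto)
  then have 1: "g summable_on UNIV \<longleftrightarrow> (\<lambda>n. g (int n)) summable_on UNIV"
    by (simp add: summable_on_reindex o_def)
  show s: "g summable_on UNIV \<longleftrightarrow> summable (\<lambda>n. g (int n))"
    unfolding 1 by (rule summable_on_UNIV_nonneg_real_iff) (rule assms(1))
  assume "summable (\<lambda>n. g (int n))"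
  then have "(\<lambda>n. g (int n)) summable_on UNIV" using 1 s by simp
  then have "(\<lambda>n. g (int n)) sums infsum (\<lambda>n. g (int n)) UNIV"
    by (intro has_sum_imp_sums has_sum_infsum)
  moreover have "infsum g UNIV = infsum g (range int)"
    by (rule infsum_cong_neutral) (use neg in auto)
  ultimately show "infsum g UNIV = (\<Sum>n. g (int n))"
    by (simp add: infsum_reindex o_def sums_iff)
qed

lemma hardy_add: "hardy u \<Longrightarrow> hardy v \<Longrightarrow> hardy (\<lambda>\<zeta>. u \<zeta> + v \<zeta>) \<and> cf (\<lambda>\<zeta>. u \<zeta> + v \<zeta>) = (\<lambda>n. cf u n + cf v n)"
  by (auto simp: hardy_def cf_def fourier_coeff_add fun_eq_iff)

lemma hardy_diff: "hardy u \<Longrightarrow> hardy v \<Longrightarrow> hardy (\<lambda>\<zeta>. u \<zeta> - v \<zeta>) \<and> cf (\<lambda>\<zeta>. u \<zeta> - v \<zeta>) = (\<lambda>n. cf u n - cf v n)"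
  by (auto simp: hardy_def cf_def fourier_coeff_diff fun_eq_iff)

lemma hardy_cmult: "hardy u \<Longrightarrow> hardy (\<lambda>\<zeta>. a * u \<zeta>) \<and> cf (\<lambda>\<zeta>. a * u \<zeta>) = (\<lambda>n. a * cf u n)"
  by (auto simp: hardy_def cf_def fourier_coeff_cmult fun_eq_iff)

lemma hardy_shift: "hardy u \<Longrightarrow> hardy (\<lambda>\<zeta>. \<zeta> * u \<zeta>) \<and> cf (\<lambda>\<zeta>. \<zeta> * u \<zeta>) = case_nat 0 (cf u)"
  by (auto simp: hardy_def cf_def fourier_coeff_shift fun_eq_iff
      intro!: integrable_circle_mult continuous_intros split: nat.split)

lemma hardy_disc_algebra:
  assumes "continuous_on (cball 0 1) f" "f holomorphic_on ball 0 1"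
  shows "hardy f" "cf f = taylor f"
  using fourier_coeff_disc_algebra[OF assms] integrable_circle[OF continuous_on_subset[OF assms(1)]]
  by (auto simp: hardy_def cf_def fun_eq_iff)

lemma hardy_poly: "hardy (poly p)" "cf (poly p) = coeff p"
proof -
  have p: "continuous_on (cball 0 1) (poly p)" "poly p holomorphic_on ball 0 1"
    by (intro holomorphic_on_imp_continuous_on holomorphic_poly)+
  from hardy_disc_algebra[OF this] show "hardy (poly p)" "cf (poly p) = coeff p"
    by (simp_all add: fun_eq_iff taylor_poly)
qed

section \<open>The weighted spaces in terms of Taylor coefficients\<close>

context pos_weight
begin

lemma l2A_iff:
  assumes "f \<in> L2_circle"
  shows "f \<in> l2A \<Omega> \<longleftrightarrow> hardy f \<and> wsummable \<Omega> (cf f)"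
proof -
  have "(\<lambda>n. (cmod (fourier_coeff f n))\<^sup>2 * \<Omega> (nat \<bar>n\<bar>)) summable_on UNIV \<longleftrightarrow> wsummable \<Omega> (cf f)"
    if "\<forall>n<0. fourier_coeff f n = 0"
    using infsum_int_of_nat(1)[of "\<lambda>n. (cmod (fourier_coeff f n))\<^sup>2 * \<Omega> (nat \<bar>n\<bar>)"] that
    by (simp add: wsummable_def cf_def mult.commute)
  then show ?thesis
    using assms L2_circle_integrable[OF assms] by (auto simp: l2A_def l2_def hardy_def)
qed

lemma l2A_L2: "f \<in> l2A \<Omega> \<Longrightarrow> f \<in> L2_circle"
  by (simp add: l2A_def l2_def)

lemma l2A_hardy: "f \<in> l2A \<Omega> \<Longrightarrow> hardy f" "f \<in> l2A \<Omega> \<Longrightarrow> wsummable \<Omega> (cf f)"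
  using l2A_iff l2A_L2 by blast+

lemma l2_norm_eq:
  assumes "hardy f" "wsummable \<Omega> (cf f)"
  shows "l2_norm \<Omega> f = sqrt (wnorm2 \<Omega> (cf f))"
  using infsum_int_of_nat(2)[of "\<lambda>n. (cmod (fourier_coeff f n))\<^sup>2 * \<Omega> (nat \<bar>n\<bar>)"] assms
  by (simp add: l2_norm_def wnorm2_def hardy_def wsummable_def cf_def mult.commute)

end

context doubling_weight
begin

text \<open>Induction along \<open>pCons\<close>: multiplication by \<open>a + z * p\<close>
  combines the induction hypothesis with \<open>wsummable_shift\<close>. The constant depends on the
  polynomial alone, which matters when \<open>u\<close> is chosen afterwards.\<close>

lemma poly_mult_bounded:
  "\<exists>K\<ge>0. \<forall>u. hardy u \<and> wsummable \<Omega> (cf u) \<longrightarrow>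
     hardy (\<lambda>\<zeta>. poly p \<zeta> * u \<zeta>) \<and> wsummable \<Omega> (cf (\<lambda>\<zeta>. poly p \<zeta> * u \<zeta>)) \<and>
     wnorm2 \<Omega> (cf (\<lambda>\<zeta>. poly p \<zeta> * u \<zeta>)) \<le> K * wnorm2 \<Omega> (cf u)"
proof (induction p)
  case 0
  have "hardy (\<lambda>\<zeta>. 0)" "cf (\<lambda>\<zeta>. 0) = (\<lambda>n. 0)"
  proof -
    have z: "poly 0 = (\<lambda>\<zeta>::complex. 0)" by auto
    show "hardy (\<lambda>\<zeta>. 0)" "cf (\<lambda>\<zeta>. 0) = (\<lambda>n. 0)"
      using hardy_poly[of 0] unfolding z by (auto simp: fun_eq_iff)
  qed
  then show ?case by (intro exI[of _ 0]) (auto simp: wsummable_def wnorm2_def)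
next
  case (pCons a p)
  then obtain K where K: "K \<ge> 0" and h: "\<And>u. hardy u \<Longrightarrow> wsummable \<Omega> (cf u) \<Longrightarrow>
     hardy (\<lambda>\<zeta>. poly p \<zeta> * u \<zeta>) \<and> wsummable \<Omega> (cf (\<lambda>\<zeta>. poly p \<zeta> * u \<zeta>)) \<and>
     wnorm2 \<Omega> (cf (\<lambda>\<zeta>. poly p \<zeta> * u \<zeta>)) \<le> K * wnorm2 \<Omega> (cf u)" by blast
  have sc: "0 \<le> shift_const" using C_ge_1 by (simp add: shift_const_def)
  show ?case
  proof (intro exI[of _ "2 * (cmod a)\<^sup>2 + 2 * (shift_const * K)"] conjI allI impI)
    show "0 \<le> 2 * (cmod a)\<^sup>2 + 2 * (shift_const * K)" using K sc by simp
    fix u assume u: "hardy u \<and> wsummable \<Omega> (cf u)"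
    define v where "v = (\<lambda>\<zeta>. poly p \<zeta> * u \<zeta>)"
    have v: "hardy v" "wsummable \<Omega> (cf v)" "wnorm2 \<Omega> (cf v) \<le> K * wnorm2 \<Omega> (cf u)"
      using h u unfolding v_def by auto
    have eq: "(\<lambda>\<zeta>. poly (pCons a p) \<zeta> * u \<zeta>) = (\<lambda>\<zeta>. a * u \<zeta> + \<zeta> * v \<zeta>)"
      by (simp add: v_def algebra_simps fun_eq_iff)
    note au = hardy_cmult[OF conjunct1[OF u], of a] and zv = hardy_shift[OF v(1)]
    note sum = hardy_add[OF conjunct1[OF au] conjunct1[OF zv]]
    have cfe: "cf (\<lambda>\<zeta>. a * u \<zeta> + \<zeta> * v \<zeta>) = (\<lambda>n. a * cf u n + case_nat 0 (cf v) n)"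
      using sum au zv by simp
    note ws = wsummable_add[OF wsummable_cmult(1)[OF conjunct2[OF u], of a] wsummable_shift(1)[OF v(2)]]
    show "hardy (\<lambda>\<zeta>. poly (pCons a p) \<zeta> * u \<zeta>)" unfolding eq using sum by simp
    show "wsummable \<Omega> (cf (\<lambda>\<zeta>. poly (pCons a p) \<zeta> * u \<zeta>))" unfolding eq cfe by (rule ws(1))
    have "wnorm2 \<Omega> (case_nat 0 (cf v)) \<le> shift_const * wnorm2 \<Omega> (cf v)" by (rule wsummable_shift(2)[OF v(2)])
    also have "\<dots> \<le> shift_const * (K * wnorm2 \<Omega> (cf u))" using v(3) sc by (rule mult_left_mono)
    finally show "wnorm2 \<Omega> (cf (\<lambda>\<zeta>. poly (pCons a p) \<zeta> * u \<zeta>)) \<le> (2 * (cmod a)\<^sup>2 + 2 * (shift_const * K)) * wnorm2 \<Omega> (cf u)"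
      unfolding eq cfe using ws(2) wsummable_cmult(2)[OF conjunct2[OF u], of a] by (simp add: algebra_simps)
  qed
qed

lemma truncation:
  assumes "wsummable \<Omega> c" "\<epsilon> > 0"
  obtains q where "wsummable \<Omega> (\<lambda>n. coeff q n - c n)" "wnorm2 \<Omega> (\<lambda>n. coeff q n - c n) < \<epsilon>"
proof -
  have "eventually (\<lambda>N. wnorm2 \<Omega> (\<lambda>n. if n < N then 0 else c n) < \<epsilon>) sequentially"
    by (rule order_tendstoD(2)[OF wnorm2_tail_tendsto[OF assms(1)] assms(2)])
  then obtain N where N: "wnorm2 \<Omega> (\<lambda>n. if n < N then 0 else c n) < \<epsilon>"
    by (auto simp: eventually_sequentially)
  define q where "q = (\<Sum>n<N. monom (c n) n)"
  have q: "coeff q n = (if n < N then c n else 0)" for n by (simp add: q_def coeff_sum)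
  have t: "wsummable \<Omega> (\<lambda>n. if n < N then 0 else c n)" by (rule wsummable_le(1)[OF assms(1)]) auto
  have "wsummable \<Omega> (\<lambda>n. coeff q n - c n)" "wnorm2 \<Omega> (\<lambda>n. coeff q n - c n) \<le> wnorm2 \<Omega> (\<lambda>n. if n < N then 0 else c n)"
    by (rule wsummable_le[OF t]; simp add: q)+
  then show ?thesis using that N by force
qed

text \<open>Taylor sections of a continuous \<open>f\<close> need not converge uniformly, so
  \<open>f\<close> is first dilated by \<open>r\<close> and then truncated at \<open>M\<close>. For
  the norm, \<open>r\<close> is adapted to the first \<open>N\<close> coefficients, and the others
  change by at most their own size. The coefficient at 0 is untouched by both operations.\<close>

lemma disc_algebra_approximation:
  assumes cont: "continuous_on unit_circle f" and f: "f \<in> l2A \<Omega>" and \<epsilon>: "\<epsilon> > 0"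
  obtains p where "\<And>\<zeta>. \<zeta> \<in> unit_circle \<Longrightarrow> cmod (poly p \<zeta> - f \<zeta>) < \<epsilon>"
    "wsummable \<Omega> (\<lambda>n. coeff p n - cf f n)" "wnorm2 \<Omega> (\<lambda>n. coeff p n - cf f n) < \<epsilon>" "coeff p 0 = cf f 0"
proof -
  define c where "c = cf f"
  have ws: "wsummable \<Omega> c" and hf: "hardy f" using l2A_hardy[OF f] by (auto simp: c_def)
  have "eventually (\<lambda>N. wnorm2 \<Omega> (\<lambda>n. if n < N then 0 else c n) < \<epsilon> / 4) sequentially"
    using \<epsilon> by (intro order_tendstoD(2)[OF wnorm2_tail_tendsto[OF ws]]) simp
  \<comment> \<open>\<open>N > 0\<close> guarantees, through \<open>N \<le> M\<close>, that the
    coefficient at 0 survives the truncation.\<close>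
  then obtain N where N: "wnorm2 \<Omega> (\<lambda>n. if n < N then 0 else c n) < \<epsilon> / 4" "N > 0"
    unfolding eventually_sequentially by (metis le_add1 less_Suc_eq_0_disj add_Suc_right not_less_eq_eq le0 nat_le_linear le_SucI)
  have lim: "((\<lambda>r. \<Sum>n<N. \<Omega> n * (cmod (of_real r ^ n * c n - c n))\<^sup>2) \<longlongrightarrow> (\<Sum>n<N. \<Omega> n * (cmod (of_real 1 ^ n * c n - c n))\<^sup>2)) (at_left (1::real))"
    by (intro tendsto_intros)
  have "eventually (\<lambda>r. (\<Sum>n<N. \<Omega> n * (cmod (of_real r ^ n * c n - c n))\<^sup>2) < \<epsilon> / 4) (at_left (1::real))"
    by (rule order_tendstoD(2)[OF lim]) (use \<epsilon> in simp)
  moreover have "eventually (\<lambda>r. \<forall>\<zeta>\<in>unit_circle. cmod (poisson f (of_real r * \<zeta>) - f \<zeta>) < \<epsilon> / 2) (at_left 1)"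
    using \<epsilon> by (intro poisson_radial_uniform cont) simp
  moreover have "eventually (\<lambda>r. r \<in> {0<..<1}) (at_left (1::real))"
    by (intro eventually_at_left_real) auto
  ultimately have "eventually (\<lambda>r. (\<Sum>n<N. \<Omega> n * (cmod (of_real r ^ n * c n - c n))\<^sup>2) < \<epsilon> / 4 \<and>
     (\<forall>\<zeta>\<in>unit_circle. cmod (poisson f (of_real r * \<zeta>) - f \<zeta>) < \<epsilon> / 2) \<and> r \<in> {0<..<1}) (at_left 1)"
    by eventually_elim auto
  then obtain r :: real where r: "(\<Sum>n<N. \<Omega> n * (cmod (of_real r ^ n * c n - c n))\<^sup>2) < \<epsilon> / 4"
     "\<And>\<zeta>. \<zeta> \<in> unit_circle \<Longrightarrow> cmod (poisson f (of_real r * \<zeta>) - f \<zeta>) < \<epsilon> / 2" "0 < r" "r < 1"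
    using eventually_happens'[OF trivial_limit_at_left_real] by fastforce
  \<comment> \<open>Convergence of the power series at a point \<open>s\<close> between
    \<open>r\<close> and 1 yields absolute convergence at \<open>r\<close>.\<close>
  define s where "s = (1 + r) / 2"
  have s: "r < s" "s < 1" "0 < s" using r by (auto simp: s_def)
  have "(\<lambda>n. of_real s ^ n * fourier_coeff f (int n)) sums poisson f (of_real s)"
    using hf s by (intro poisson_analytic_sums) (auto simp: hardy_def)
  then have "summable (\<lambda>n. c n * of_real s ^ n)" by (simp add: c_def cf_def sums_iff mult.commute)
  then have "summable (\<lambda>n. norm (c n * of_real r ^ n))"
    using s r by (intro powser_insidea) auto
  then have sn: "summable (\<lambda>n. cmod (c n) * r ^ n)" using r by (simp add: norm_mult norm_power)
  have "(\<lambda>M. (\<Sum>n. cmod (c n) * r ^ n) - (\<Sum>n<M. cmod (c n) * r ^ n)) \<longlonglongrightarrow> (\<Sum>n. cmod (c n) * r ^ n) - (\<Sum>n. cmod (c n) * r ^ n)"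
    by (intro tendsto_intros summable_LIMSEQ sn)
  then have "eventually (\<lambda>M. (\<Sum>n. cmod (c n) * r ^ n) - (\<Sum>n<M. cmod (c n) * r ^ n) < \<epsilon> / 2) sequentially"
    using \<epsilon> by (intro order_tendstoD(2)) auto
  then obtain M where M: "N \<le> M" "(\<Sum>n. cmod (c n) * r ^ n) - (\<Sum>n<M. cmod (c n) * r ^ n) < \<epsilon> / 2"
    unfolding eventually_sequentially by (metis nat_le_linear)
  define p where "p = (\<Sum>n<M. monom (of_real r ^ n * c n) n)"
  have p: "coeff p n = (if n < M then of_real r ^ n * c n else 0)" for n by (simp add: p_def coeff_sum)
  have pz: "poly p z = (\<Sum>n<M. c n * (of_real r * z) ^ n)" for z
    by (simp add: p_def poly_sum poly_monom power_mult_distrib mult_ac)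
  show ?thesis
  proof (rule that[of p])
    fix \<zeta> :: complex assume \<zeta>: "\<zeta> \<in> unit_circle"
    have z: "cmod (of_real r * \<zeta>) = r" using \<zeta> r by (simp add: norm_mult)
    have sm: "(\<lambda>n. c n * (of_real r * \<zeta>) ^ n) sums poisson f (of_real r * \<zeta>)"
      using poisson_analytic_sums[of f "of_real r * \<zeta>"] hf z r by (simp add: hardy_def c_def cf_def mult.commute)
    have nn: "norm (c n * (of_real r * \<zeta>) ^ n) = cmod (c n) * r ^ n" for n
      using z by (simp add: norm_mult norm_power)
    have "poisson f (of_real r * \<zeta>) - poly p \<zeta> = (\<Sum>n. c (n + M) * (of_real r * \<zeta>) ^ (n + M))"
      using suminf_minus_initial_segment[OF sums_summable[OF sm], of M] sm by (simp add: pz sums_iff)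
    also have "cmod \<dots> \<le> (\<Sum>n. norm (c (n + M) * (of_real r * \<zeta>) ^ (n + M)))"
      by (intro summable_norm) (simp only: nn, rule summable_ignore_initial_segment[OF sn])
    also have "\<dots> = (\<Sum>n. cmod (c n) * r ^ n) - (\<Sum>n<M. cmod (c n) * r ^ n)"
      unfolding nn by (rule suminf_minus_initial_segment[OF sn])
    also have "\<dots> < \<epsilon> / 2" by (rule M)
    finally have "cmod (poisson f (of_real r * \<zeta>) - poly p \<zeta>) < \<epsilon> / 2" .
    with r(2)[OF \<zeta>] have "cmod ((poisson f (of_real r * \<zeta>) - f \<zeta>) - (poisson f (of_real r * \<zeta>) - poly p \<zeta>)) < \<epsilon>"
      by (intro order_le_less_trans[OF norm_triangle_ineq4]) simp
    then show "cmod (poly p \<zeta> - f \<zeta>) < \<epsilon>" by simp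
  next
    define d1 where "d1 n = (if n < N then coeff p n - c n else 0)" for n
    define d2 where "d2 n = (if n < N then 0 else coeff p n - c n)" for n
    have d: "(\<lambda>n. coeff p n - cf f n) = (\<lambda>n. d1 n + d2 n)" by (auto simp: d1_def d2_def c_def)
    have w1: "wsummable \<Omega> d1" by (rule wsummable_finite) (auto intro: finite_subset[of _ "{..<N}"] simp: d1_def)
    have "wnorm2 \<Omega> d1 = (\<Sum>n<N. \<Omega> n * (cmod (d1 n))\<^sup>2)"
      unfolding wnorm2_def by (rule suminf_finite) (auto simp: d1_def)
    also have "\<dots> = (\<Sum>n<N. \<Omega> n * (cmod (of_real r ^ n * c n - c n))\<^sup>2)"
      using M by (intro sum.cong) (auto simp: d1_def p)
    finally have n1: "wnorm2 \<Omega> d1 < \<epsilon> / 4" using r(1) by simp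
    have t: "wsummable \<Omega> (\<lambda>n. if n < N then 0 else c n)" by (rule wsummable_le(1)[OF ws]) auto
    have le: "cmod (d2 n) \<le> cmod (if n < N then 0 else c n)" for n
    proof -
      have "cmod (of_real r ^ n * c n - c n) \<le> cmod (c n)"
      proof -
        have "of_real r ^ n * c n - c n = of_real (r ^ n - 1) * c n" by (simp add: algebra_simps)
        then have "cmod (of_real r ^ n * c n - c n) = \<bar>r ^ n - 1\<bar> * cmod (c n)" by (simp only: norm_mult norm_of_real)
        also have "\<dots> \<le> 1 * cmod (c n)" using r power_le_one[of r n] by (intro mult_right_mono) auto
        finally show ?thesis by simp
      qed
      then show ?thesis by (simp add: d2_def p)
    qed
    note w2 = wsummable_le[OF t le]
    note sum = wsummable_add[OF w1 w2(1)]
    show "wsummable \<Omega> (\<lambda>n. coeff p n - cf f n)" unfolding d by (rule sum(1))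
    show "wnorm2 \<Omega> (\<lambda>n. coeff p n - cf f n) < \<epsilon>" unfolding d using sum(2) n1 w2(2) N(1) by linarith
    show "coeff p 0 = cf f 0" using M N by (simp add: p c_def)
  qed
qed

end

section \<open>Uniform approximation by polynomials on a zero set\<close>

definition poly_approx :: "complex set \<Rightarrow> (complex \<Rightarrow> complex) \<Rightarrow> bool" where
  "poly_approx E g \<longleftrightarrow> (\<forall>\<epsilon>>0. \<exists>q. \<forall>\<zeta>\<in>E. cmod (poly q \<zeta> - g \<zeta>) < \<epsilon>)"

lemma poly_approx_poly: "poly_approx E (poly q)"
  by (auto simp: poly_approx_def intro!: exI[of _ q])

lemma poly_approx_limit:
  assumes "\<And>\<epsilon>. \<epsilon> > 0 \<Longrightarrow> \<exists>h. poly_approx E h \<and> (\<forall>\<zeta>\<in>E. cmod (h \<zeta> - g \<zeta>) < \<epsilon>)"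
  shows "poly_approx E g"
  unfolding poly_approx_def
proof (intro allI impI)
  fix \<epsilon> :: real assume "\<epsilon> > 0"
  then obtain h where h: "poly_approx E h" "\<forall>\<zeta>\<in>E. cmod (h \<zeta> - g \<zeta>) < \<epsilon> / 2" using assms[of "\<epsilon> / 2"] by auto
  then obtain q where q: "\<forall>\<zeta>\<in>E. cmod (poly q \<zeta> - h \<zeta>) < \<epsilon> / 2"
    using \<open>\<epsilon> > 0\<close> unfolding poly_approx_def by (meson half_gt_zero)
  have "cmod (poly q \<zeta> - g \<zeta>) < \<epsilon>" if "\<zeta> \<in> E" for \<zeta>
    using norm_triangle_lt[of "poly q \<zeta> - h \<zeta>" "h \<zeta> - g \<zeta>" \<epsilon>] h(2) q that by force
  then show "\<exists>q. \<forall>\<zeta>\<in>E. cmod (poly q \<zeta> - g \<zeta>) < \<epsilon>" by blast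
qed

lemma poly_approx_add:
  assumes "poly_approx E g" "poly_approx E h"
  shows "poly_approx E (\<lambda>\<zeta>. g \<zeta> + h \<zeta>)"
  unfolding poly_approx_def
proof (intro allI impI)
  fix \<epsilon> :: real assume "\<epsilon> > 0"
  then obtain p q where pq: "\<forall>\<zeta>\<in>E. cmod (poly p \<zeta> - g \<zeta>) < \<epsilon> / 2" "\<forall>\<zeta>\<in>E. cmod (poly q \<zeta> - h \<zeta>) < \<epsilon> / 2"
    using assms unfolding poly_approx_def by (meson half_gt_zero)
  have "cmod (poly (p + q) \<zeta> - (g \<zeta> + h \<zeta>)) < \<epsilon>" if "\<zeta> \<in> E" for \<zeta>
  proof -
    have eq: "poly (p + q) \<zeta> - (g \<zeta> + h \<zeta>) = (poly p \<zeta> - g \<zeta>) + (poly q \<zeta> - h \<zeta>)" by simp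
    have "cmod (poly p \<zeta> - g \<zeta>) < \<epsilon> / 2" "cmod (poly q \<zeta> - h \<zeta>) < \<epsilon> / 2" using pq that by auto
    then show ?thesis unfolding eq by (intro norm_triangle_lt) linarith
  qed
  then show "\<exists>q. \<forall>\<zeta>\<in>E. cmod (poly q \<zeta> - (g \<zeta> + h \<zeta>)) < \<epsilon>" by blast
qed

lemma poly_approx_bounded:
  assumes "compact E" "poly_approx E g"
  obtains B where "B > 0" "\<And>\<zeta>. \<zeta> \<in> E \<Longrightarrow> cmod (g \<zeta>) \<le> B"
proof -
  obtain q where q: "\<forall>\<zeta>\<in>E. cmod (poly q \<zeta> - g \<zeta>) < 1" using assms(2) unfolding poly_approx_def by (meson zero_less_one)
  have "compact (poly q ` E)" by (intro compact_continuous_image continuous_intros assms(1))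
  then have "bounded (poly q ` E)" by (rule compact_imp_bounded)
  then obtain B where B: "B > 0" "\<forall>y\<in>poly q ` E. cmod y \<le> B"
    unfolding bounded_pos by blast
  have "cmod (g \<zeta>) \<le> B + 1" if "\<zeta> \<in> E" for \<zeta>
  proof -
    have "cmod (poly q \<zeta>) \<le> B" using B that by simp
    then show ?thesis using norm_triangle_ineq2[of "g \<zeta>" "poly q \<zeta>"] q that by (force simp: norm_minus_commute)
  qed
  then show ?thesis using that[of "B + 1"] B by simp
qed

lemma poly_approx_mult:
  assumes E: "compact E" and g: "poly_approx E g" and h: "poly_approx E h"
  shows "poly_approx E (\<lambda>\<zeta>. g \<zeta> * h \<zeta>)"
  unfolding poly_approx_def
proof (intro allI impI)
  fix \<epsilon> :: real assume e: "\<epsilon> > 0"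
  obtain A where A: "A > 0" "\<And>\<zeta>. \<zeta> \<in> E \<Longrightarrow> cmod (h \<zeta>) \<le> A" using poly_approx_bounded[OF E h] by blast
  obtain B where B: "B > 0" "\<And>\<zeta>. \<zeta> \<in> E \<Longrightarrow> cmod (g \<zeta>) \<le> B" using poly_approx_bounded[OF E g] by blast
  define \<delta> where "\<delta> = min 1 (\<epsilon> / (A + B + 1))"
  have d: "0 < \<delta>" "\<delta> \<le> 1" "\<delta> * (A + B + 1) \<le> \<epsilon>"
  proof -
    have "\<delta> * (A + B + 1) \<le> \<epsilon> / (A + B + 1) * (A + B + 1)" using A B by (intro mult_right_mono) (auto simp: \<delta>_def)
    also have "\<dots> = \<epsilon>" using A B by simp
    finally show "\<delta> * (A + B + 1) \<le> \<epsilon>" .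
    show "0 < \<delta>" "\<delta> \<le> 1" using A B e unfolding \<delta>_def by (auto intro: divide_pos_pos)
  qed
  obtain p q where pq: "\<forall>\<zeta>\<in>E. cmod (poly p \<zeta> - g \<zeta>) < \<delta>" "\<forall>\<zeta>\<in>E. cmod (poly q \<zeta> - h \<zeta>) < \<delta>"
    using g h d unfolding poly_approx_def by meson
  have "cmod (poly (p * q) \<zeta> - g \<zeta> * h \<zeta>) < \<epsilon>" if z: "\<zeta> \<in> E" for \<zeta>
  proof -
    let ?a = "poly p \<zeta> - g \<zeta>" and ?b = "poly q \<zeta> - h \<zeta>"
    have ab: "cmod ?a < \<delta>" "cmod ?b < \<delta>" using pq z by auto
    have "poly (p * q) \<zeta> - g \<zeta> * h \<zeta> = ?a * ?b + ?a * h \<zeta> + g \<zeta> * ?b" by (simp add: algebra_simps)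
    then have "cmod (poly (p * q) \<zeta> - g \<zeta> * h \<zeta>) \<le> cmod ?a * cmod ?b + cmod ?a * cmod (h \<zeta>) + cmod (g \<zeta>) * cmod ?b"
      by (metis (no_types, lifting) norm_mult norm_triangle_ineq norm_triangle_le add_mono order_refl)
    also have "\<dots> \<le> cmod ?a * 1 + cmod ?a * A + B * cmod ?b"
      using A(2)[OF z] B(2)[OF z] A(1) B(1) ab d by (intro add_mono mult_mono) auto
    also have "\<dots> < \<delta> * 1 + \<delta> * A + B * \<delta>"
      using ab A(1) B(1) by (intro add_strict_mono mult_strict_right_mono mult_strict_left_mono) auto
    also have "\<dots> \<le> \<epsilon>" using d by (simp add: algebra_simps)
    finally show ?thesis .
  qed
  then show "\<exists>q. \<forall>\<zeta>\<in>E. cmod (poly q \<zeta> - g \<zeta> * h \<zeta>) < \<epsilon>" by blast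
qed

text \<open>Real polynomial functions on the plane are polynomials in \<open>z\<close> and
  \<open>cnj z\<close>. Once \<open>cnj\<close> is a uniform limit of analytic polynomials, so are
  they, and Stone-Weierstrass does the rest.\<close>

lemma poly_approx_cnj_imp_all:
  assumes E: "compact E" and c: "poly_approx E cnj" and g: "continuous_on E g"
  shows "poly_approx E g"
proof -
  have const: "poly_approx E (\<lambda>_. a)" for a
    using poly_approx_poly[of E "[:a:]"] by (simp add: poly_approx_def)
  have id: "poly_approx E (\<lambda>z. z)"
    using poly_approx_poly[of E "[:0, 1:]"] by (simp add: poly_approx_def)
  have real: "poly_approx E (\<lambda>z. of_real (f z))" if "real_polynomial_function f" for f :: "complex \<Rightarrow> real"
    using that
  proof induction
    case (linear f)
    then interpret bounded_linear f .
    \<comment> \<open>A real-linear functional is determined by its values at 1 and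
      \<open>\<i>\<close>; real and imaginary parts are expressed by \<open>z\<close> and
      \<open>cnj z\<close>.\<close>
    have lin: "complex_of_real (f z) = of_real (f 1) * ((z + cnj z) / 2) + of_real (f \<i>) * ((z - cnj z) / (2 * \<i>))" for z
    proof -
      have "z = Re z *\<^sub>R 1 + Im z *\<^sub>R \<i>" by (simp add: complex_eq_iff)
      then have "f z = Re z * f 1 + Im z * f \<i>" by (metis add scaleR real_scaleR_def)
      moreover have "(z + cnj z) / 2 = of_real (Re z)" "(z - cnj z) / (2 * \<i>) = of_real (Im z)"
        by (simp_all add: complex_eq_iff complex_add_cnj complex_diff_cnj)
      ultimately show ?thesis by simp
    qed
    have alg: "a * ((z + c) / 2) + b * ((z - c) / (2 * \<i>)) = (a / 2 + b / (2 * \<i>)) * z + (a / 2 - b / (2 * \<i>)) * c"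
      for a b c z :: complex by (simp add: field_simps)
    have eq: "(\<lambda>z. complex_of_real (f z)) = (\<lambda>z. (of_real (f 1) / 2 + of_real (f \<i>) / (2 * \<i>)) * z
        + (of_real (f 1) / 2 - of_real (f \<i>) / (2 * \<i>)) * cnj z)"
      unfolding alg[symmetric] by (rule ext) (rule lin)
    show ?case
      unfolding eq by (intro poly_approx_add poly_approx_mult E const id c)
  next
    case (const a)
    show ?case by (rule \<open>\<And>a. poly_approx E (\<lambda>_. a)\<close>)
  next
    case (add f g)
    then show ?case by (simp add: poly_approx_add)
  next
    case (mult f g)
    then show ?case by (simp add: poly_approx_mult[OF E])
  qed
  show ?thesis
  proof (rule poly_approx_limit)
    fix \<epsilon> :: real assume "\<epsilon> > 0"
    then obtain h where h: "polynomial_function h" "\<forall>x\<in>E. cmod (g x - h x) < \<epsilon>"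
      using Stone_Weierstrass_polynomial_function[OF E g] by blast
    have "real_polynomial_function (\<lambda>z. Re (h z))" "real_polynomial_function (\<lambda>z. Im (h z))"
      using h(1) bounded_linear_Re bounded_linear_Im unfolding polynomial_function_def o_def by blast+
    then have "poly_approx E (\<lambda>z. of_real (Re (h z)) + \<i> * of_real (Im (h z)))"
      by (intro poly_approx_add poly_approx_mult[OF E] const real)
    then have "poly_approx E h" by (simp flip: complex_eq)
    then show "\<exists>h. poly_approx E h \<and> (\<forall>\<zeta>\<in>E. cmod (h \<zeta> - g \<zeta>) < \<epsilon>)"
      using h(2) by (auto simp: norm_minus_commute)
  qed
qed

text \<open>Writing \<open>p = c + z q\<close> with \<open>p\<close> small on \<open>E\<close>, the polynomial \<open>- q / c\<close> is close to \<open>1 / z = cnj z\<close> there.\<close>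

lemma zero_set_poly_dense:
  assumes E: "compact E" "E \<subseteq> unit_circle" and c: "c \<noteq> 0"
    and approx: "\<And>\<epsilon>. \<epsilon> > 0 \<Longrightarrow> \<exists>p. coeff p 0 = c \<and> (\<forall>\<zeta>\<in>E. cmod (poly p \<zeta>) < \<epsilon>)"
    and g: "continuous_on E g"
  shows "poly_approx E g"
proof (rule poly_approx_cnj_imp_all[OF E(1) _ g])
  show "poly_approx E cnj"
    unfolding poly_approx_def
  proof (intro allI impI)
    fix \<epsilon> :: real assume "\<epsilon> > 0"
    then obtain p where p: "coeff p 0 = c" "\<forall>\<zeta>\<in>E. cmod (poly p \<zeta>) < \<epsilon> * cmod c"
      using approx[of "\<epsilon> * cmod c"] c by auto
    obtain q where q: "p = pCons c q" using p(1) by (cases p) auto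
    have "cmod (poly (smult (- 1 / c) q) \<zeta> - cnj \<zeta>) < \<epsilon>" if z: "\<zeta> \<in> E" for \<zeta>
    proof -
      have z1: "cmod \<zeta> = 1" "\<zeta> * cnj \<zeta> = 1" using z E by (auto simp flip: complex_norm_square)
      have "poly p \<zeta> * cnj \<zeta> = c * cnj \<zeta> + (\<zeta> * cnj \<zeta>) * poly q \<zeta>"
        by (simp add: q algebra_simps)
      then have "poly p \<zeta> * cnj \<zeta> = (- c) * (poly (smult (- 1 / c) q) \<zeta> - cnj \<zeta>)"
        using c z1 by (simp add: algebra_simps)
      then have "cmod (poly p \<zeta>) * cmod (cnj \<zeta>) = cmod (- c) * cmod (poly (smult (- 1 / c) q) \<zeta> - cnj \<zeta>)"
        by (metis norm_mult)
      then have eq: "cmod (poly p \<zeta>) = cmod c * cmod (poly (smult (- 1 / c) q) \<zeta> - cnj \<zeta>)"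
        using z1 by (simp only: complex_mod_cnj norm_minus_cancel mult_1_right)
      have "cmod (poly p \<zeta>) < cmod c * \<epsilon>" using p(2) z by (simp add: mult.commute)
      then show ?thesis unfolding eq using mult_less_cancel_left_pos[of "cmod c"] c by simp
    qed
    then show "\<exists>q. \<forall>\<zeta>\<in>E. cmod (poly q \<zeta> - cnj \<zeta>) < \<epsilon>" by blast
  qed
qed

lemma linear_span_monomials:
  "linear_span {(\<lambda>z. f z * z ^ n) | n::nat. True} = {\<lambda>z. f z * poly p z | p. True}"
proof -
  interpret M: module "\<lambda>(a::complex) (f :: complex \<Rightarrow> complex) z. a * f z" by (rule module_functions)
  let ?B = "{(\<lambda>z. f z * z ^ n) | n::nat. True}" and ?P = "{\<lambda>z. f z * poly p z | p. True}"
  have sub: "M.subspace ?P"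
    unfolding M.subspace_def
  proof (intro conjI ballI allI)
    show "0 \<in> ?P" by (auto intro!: exI[of _ 0])
    fix u v assume "u \<in> ?P" "v \<in> ?P"
    then obtain p q where "u = (\<lambda>z. f z * poly p z)" "v = (\<lambda>z. f z * poly q z)" by auto
    then show "u + v \<in> ?P" by (auto simp: fun_eq_iff algebra_simps intro!: exI[of _ "p + q"])
  next
    fix a u assume "u \<in> ?P"
    then obtain p where "u = (\<lambda>z. f z * poly p z)" by auto
    then show "(\<lambda>z. a * u z) \<in> ?P" by (auto simp: fun_eq_iff algebra_simps intro!: exI[of _ "smult a p"])
  qed
  have "?B \<subseteq> ?P"
  proof
    fix u assume "u \<in> ?B"
    then obtain n where "u = (\<lambda>z. f z * z ^ n)" by auto
    then show "u \<in> ?P" by (auto simp: poly_monom fun_eq_iff intro!: exI[of _ "monom 1 n"])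
  qed
  then have 1: "M.span ?B \<subseteq> ?P" by (rule M.span_minimal[OF _ sub])
  have sumf: "(\<Sum>i\<in>A. (\<lambda>z. a i * (f z * z ^ i))) = (\<lambda>z. \<Sum>i\<in>A. a i * (f z * z ^ i))" if "finite A" for A and a :: "nat \<Rightarrow> complex"
    using that by (induction A) (auto simp: fun_eq_iff)
  have "?P \<subseteq> M.span ?B"
  proof
    fix u assume "u \<in> ?P"
    then obtain p where u: "u = (\<lambda>z. f z * poly p z)" by auto
    have "(\<Sum>i\<le>degree p. (\<lambda>z. coeff p i * (f z * z ^ i))) \<in> M.span ?B"
      by (intro M.span_sum M.span_scale M.span_base) auto
    also have "(\<Sum>i\<le>degree p. (\<lambda>z. coeff p i * (f z * z ^ i))) = u"
      unfolding u sumf[OF finite_atMost] by (simp add: poly_altdef sum_distrib_left mult_ac)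
    finally show "u \<in> M.span ?B" .
  qed
  with 1 show ?thesis by (auto simp: linear_span_def)
qed

section \<open>Cyclicity, simultaneous approximation and capacity\<close>

context doubling_weight
begin

lemma l2A_poly: "poly p \<in> l2A \<Omega>"
proof -
  have "poly p \<in> L2_circle" by (intro continuous_L2_circle continuous_intros)
  moreover have "wsummable \<Omega> (coeff p)"
    by (rule wsummable_finite) (auto intro: finite_subset[OF _ finite_atMost[of "degree p"]] simp: le_degree)
  ultimately show ?thesis by (simp add: l2A_iff hardy_poly)
qed

lemma cyclic_imp_simultaneous_approximation:
  assumes E: "compact E" "E \<subseteq> unit_circle"
    and f: "f \<in> CA" "f \<in> l2A \<Omega>" and out: "outer (poisson f)" and f0: "\<forall>\<zeta>\<in>E. f \<zeta> = 0"
    and dense: "dense_in_l2A \<Omega> (linear_span {(\<lambda>z. f z * z ^ n) | n::nat. True})"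
    and h: "h \<in> l2A \<Omega>" and g: "continuous_on E g"
  shows "\<exists>Q :: nat \<Rightarrow> complex poly.
    (\<lambda>k. ennreal (l2_norm \<Omega> (\<lambda>\<zeta>. poly (Q k) \<zeta> - h \<zeta>)) + (SUP \<zeta>\<in>E. ennreal (cmod (poly (Q k) \<zeta> - g \<zeta>)))) \<longlonglongrightarrow> 0"
proof -
  have cont: "continuous_on unit_circle f" using f(1) by (simp add: CA_def)
  have hf: "hardy f" by (rule l2A_hardy(1)[OF f(2)])
  \<comment> \<open>An outer function has no zero in the disc, and its value at 0 is the coefficient
    at 0.\<close>
  have c0: "cf f 0 \<noteq> 0"
  proof -
    have "(\<lambda>n. 0 ^ n * fourier_coeff f (int n)) sums poisson f 0"
      using hf by (intro poisson_analytic_sums) (auto simp: hardy_def)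
    moreover have "(\<lambda>n. 0 ^ n * fourier_coeff f (int n)) sums (\<Sum>n\<in>{0}. 0 ^ n * fourier_coeff f (int n))"
      by (intro sums_finite) auto
    ultimately have "poisson f 0 = cf f 0" by (simp add: cf_def sums_unique2)
    moreover have "poisson f 0 \<noteq> 0"
    proof -
      obtain c \<phi> where "cmod c = 1" and
        "\<forall>z\<in>unit_disc. poisson f z = c * exp (LINT \<zeta>|circle_measure. (\<zeta> + z) / (\<zeta> - z) * of_real (ln (\<phi> \<zeta>)))"
        using out unfolding outer_def by blast
      then show ?thesis by force
    qed
    ultimately show ?thesis by simp
  qed
  have pd: "poly_approx E u" if "continuous_on E u" for u
  proof (rule zero_set_poly_dense[OF E c0 _ that])
    fix \<epsilon> :: real assume e: "\<epsilon> > 0"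
    obtain p where p: "\<And>\<zeta>. \<zeta> \<in> unit_circle \<Longrightarrow> cmod (poly p \<zeta> - f \<zeta>) < \<epsilon>" "coeff p 0 = cf f 0"
      using disc_algebra_approximation[OF cont f(2) e] by metis
    have "cmod (poly p \<zeta>) < \<epsilon>" if "\<zeta> \<in> E" for \<zeta>
      using p(1)[of \<zeta>] f0 that E by auto
    then show "\<exists>p. coeff p 0 = cf f 0 \<and> (\<forall>\<zeta>\<in>E. cmod (poly p \<zeta>) < \<epsilon>)" using p(2) by blast
  qed
  have step: "\<exists>Q. l2_norm \<Omega> (\<lambda>\<zeta>. poly Q \<zeta> - h \<zeta>) < \<epsilon> \<and> (\<forall>\<zeta>\<in>E. cmod (poly Q \<zeta> - g \<zeta>) < \<epsilon>)" if e: "\<epsilon> > 0" for \<epsilon>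
  proof -
    obtain q where q: "\<forall>\<zeta>\<in>E. cmod (poly q \<zeta> - g \<zeta>) < \<epsilon> / 2"
      using pd[OF g] e unfolding poly_approx_def by (meson half_gt_zero)
    \<comment> \<open>Correcting by \<open>q\<close> reduces the pair \<open>(h, g)\<close> to
      \<open>(h - q, 0)\<close>, up to an error below \<open>\<epsilon> / 2\<close> on
      \<open>E\<close>.\<close>
    define h' where "h' \<zeta> = h \<zeta> - poly q \<zeta>" for \<zeta>
    have hh: "hardy h" "wsummable \<Omega> (cf h)" using l2A_hardy[OF h] by auto
    have pw: "wsummable \<Omega> (coeff p)" for p using l2A_hardy(2)[OF l2A_poly[of p]] by (simp add: hardy_poly)
    have h': "hardy h'" "cf h' = (\<lambda>n. cf h n - coeff q n)"
      using hardy_diff[OF hh(1) hardy_poly(1)[of q]] by (auto simp: h'_def[abs_def] hardy_poly)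
    have wh': "wsummable \<Omega> (cf h')" unfolding h'(2) by (rule wsummable_diff(1)[OF hh(2) pw])
    have "h' \<in> L2_circle"
    proof -
      have hL: "h \<in> borel_measurable circle_measure" "integrable circle_measure (\<lambda>\<zeta>. (cmod (h \<zeta>))\<^sup>2)"
        using l2A_L2[OF h] by (auto simp: L2_circle_def)
      have qL: "poly q \<in> borel_measurable circle_measure" "integrable circle_measure (\<lambda>\<zeta>. (cmod (poly q \<zeta>))\<^sup>2)"
        by (intro borel_measurable_circle integrable_circle continuous_intros)+
      have [measurable]: "h' \<in> borel_measurable circle_measure"
        unfolding h'_def using hL(1) qL(1) by measurable
      have "integrable circle_measure (\<lambda>\<zeta>. (cmod (h' \<zeta>))\<^sup>2)"
      proof (rule Bochner_Integration.integrable_bound)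
        show "integrable circle_measure (\<lambda>\<zeta>. 2 * (cmod (h \<zeta>))\<^sup>2 + 2 * (cmod (poly q \<zeta>))\<^sup>2)"
          using hL qL by simp
        have "(cmod (h' \<zeta>))\<^sup>2 \<le> 2 * (cmod (h \<zeta>))\<^sup>2 + 2 * (cmod (poly q \<zeta>))\<^sup>2" for \<zeta>
          using norm_add_squared_le[of "h \<zeta>" "- poly q \<zeta>"] by (simp add: h'_def)
        then show "AE \<zeta> in circle_measure. norm ((cmod (h' \<zeta>))\<^sup>2) \<le> norm (2 * (cmod (h \<zeta>))\<^sup>2 + 2 * (cmod (poly q \<zeta>))\<^sup>2)"
          by (intro AE_I2) simp
      qed measurable
      then show ?thesis by (simp add: L2_circle_def)
    qed
    then have h'A: "h' \<in> l2A \<Omega>" using h'(1) wh' by (simp add: l2A_iff)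
    \<comment> \<open>The first entry leaves room on \<open>E\<close> for the error of
      \<open>q\<close>. The second gives a squared norm below
      \<open>2 * (\<epsilon>\<^sup>2 / 8) + 2 * (\<epsilon>\<^sup>2 / 8)\<close>, which is less than
      \<open>\<epsilon>\<^sup>2\<close>.\<close>
    define \<eta> where "\<eta> = min (\<epsilon> / 2) (\<epsilon>\<^sup>2 / 8)"
    have \<eta>: "\<eta> > 0" "\<eta> \<le> \<epsilon> / 2" "\<eta> \<le> \<epsilon>\<^sup>2 / 8" using e by (auto simp: \<eta>_def)
    obtain P where P: "l2_norm \<Omega> (\<lambda>\<zeta>. f \<zeta> * poly P \<zeta> - h' \<zeta>) < sqrt (\<epsilon>\<^sup>2 / 8)" and PA: "(\<lambda>\<zeta>. f \<zeta> * poly P \<zeta>) \<in> l2A \<Omega>"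
    proof -
      have "sqrt (\<epsilon>\<^sup>2 / 8) > 0" using e by simp
      then obtain s where "s \<in> linear_span {(\<lambda>z. f z * z ^ n) | n::nat. True}" "l2_norm \<Omega> (\<lambda>\<zeta>. s \<zeta> - h' \<zeta>) < sqrt (\<epsilon>\<^sup>2 / 8)"
        using dense h'A unfolding dense_in_l2A_def by blast
      then show ?thesis
        using that dense unfolding dense_in_l2A_def linear_span_monomials by auto
    qed
    define u where "u \<zeta> = f \<zeta> * poly P \<zeta>" for \<zeta>
    have uA: "u \<in> l2A \<Omega>" using PA by (simp add: u_def[abs_def])
    have hu: "hardy u" "wsummable \<Omega> (cf u)" using l2A_hardy[OF uA] by auto
    have uc: "continuous_on unit_circle u" unfolding u_def by (intro continuous_intros cont)
    obtain p where p: "\<And>\<zeta>. \<zeta> \<in> unit_circle \<Longrightarrow> cmod (poly p \<zeta> - u \<zeta>) < \<eta>"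
      "wsummable \<Omega> (\<lambda>n. coeff p n - cf u n)" "wnorm2 \<Omega> (\<lambda>n. coeff p n - cf u n) < \<eta>"
      using disc_algebra_approximation[OF uc uA \<eta>(1)] by metis
    have d1: "hardy (\<lambda>\<zeta>. u \<zeta> - h' \<zeta>)" "cf (\<lambda>\<zeta>. u \<zeta> - h' \<zeta>) = (\<lambda>n. cf u n - cf h' n)"
      using hardy_diff[OF hu(1) h'(1)] by auto
    have w1: "wsummable \<Omega> (\<lambda>n. cf u n - cf h' n)" by (rule wsummable_diff(1)[OF hu(2) wh'])
    have n1: "wnorm2 \<Omega> (\<lambda>n. cf u n - cf h' n) < \<epsilon>\<^sup>2 / 8"
      using P l2_norm_eq[OF d1(1)] w1 by (simp add: d1(2) u_def[symmetric])
    note sum = wsummable_add[OF p(2) w1]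
    have n2: "wnorm2 \<Omega> (\<lambda>n. coeff (p + q) n - cf h n) < \<epsilon>\<^sup>2"
    proof -
      have "(\<lambda>n. coeff (p + q) n - cf h n) = (\<lambda>n. (coeff p n - cf u n) + (cf u n - cf h' n))"
        by (auto simp: h'(2) fun_eq_iff)
      then have "wnorm2 \<Omega> (\<lambda>n. coeff (p + q) n - cf h n) \<le> 2 * wnorm2 \<Omega> (\<lambda>n. coeff p n - cf u n) + 2 * wnorm2 \<Omega> (\<lambda>n. cf u n - cf h' n)"
        using sum(2) by simp
      also have "\<dots> < \<epsilon>\<^sup>2" using n1 p(3) \<eta>(3) zero_less_power[OF e, of 2] by linarith
      finally show ?thesis .
    qed
    have d2: "hardy (\<lambda>\<zeta>. poly (p + q) \<zeta> - h \<zeta>)" "cf (\<lambda>\<zeta>. poly (p + q) \<zeta> - h \<zeta>) = (\<lambda>n. coeff (p + q) n - cf h n)"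
      using hardy_diff[OF hardy_poly(1)[of "p + q"] hh(1)] unfolding hardy_poly(2) by blast+
    have "l2_norm \<Omega> (\<lambda>\<zeta>. poly (p + q) \<zeta> - h \<zeta>) = sqrt (wnorm2 \<Omega> (\<lambda>n. coeff (p + q) n - cf h n))"
      using l2_norm_eq[OF d2(1)] wsummable_diff(1)[OF pw hh(2), of "p + q"] by (simp only: d2(2))
    also have "\<dots> < \<epsilon>" using n2 e by (intro real_less_lsqrt) auto
    finally have A: "l2_norm \<Omega> (\<lambda>\<zeta>. poly (p + q) \<zeta> - h \<zeta>) < \<epsilon>" .
    have "cmod (poly (p + q) \<zeta> - g \<zeta>) < \<epsilon>" if z: "\<zeta> \<in> E" for \<zeta>
    proof -
      have "u \<zeta> = 0" using f0 z by (simp add: u_def)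
      then have "cmod (poly p \<zeta>) < \<epsilon> / 2" using p(1)[of \<zeta>] z E \<eta>(2) by auto
      moreover have "cmod (poly q \<zeta> - g \<zeta>) < \<epsilon> / 2" using q z by auto
      moreover have "poly (p + q) \<zeta> - g \<zeta> = poly p \<zeta> + (poly q \<zeta> - g \<zeta>)" by simp
      ultimately show ?thesis by (simp only:) (intro norm_triangle_lt, linarith)
    qed
    with A show ?thesis by blast
  qed
  define \<epsilon> where "\<epsilon> k = inverse (real (Suc k))" for k
  have "\<forall>k. \<exists>Q. l2_norm \<Omega> (\<lambda>\<zeta>. poly Q \<zeta> - h \<zeta>) < \<epsilon> k \<and> (\<forall>\<zeta>\<in>E. cmod (poly Q \<zeta> - g \<zeta>) < \<epsilon> k)"
    by (intro allI step) (simp add: \<epsilon>_def)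
  then obtain Q where Q: "\<And>k. l2_norm \<Omega> (\<lambda>\<zeta>. poly (Q k) \<zeta> - h \<zeta>) < \<epsilon> k" "\<And>k \<zeta>. \<zeta> \<in> E \<Longrightarrow> cmod (poly (Q k) \<zeta> - g \<zeta>) < \<epsilon> k"
    by metis
  have e0: "0 \<le> \<epsilon> k" for k by (simp add: \<epsilon>_def)
  have le: "ennreal (l2_norm \<Omega> (\<lambda>\<zeta>. poly (Q k) \<zeta> - h \<zeta>)) + (SUP \<zeta>\<in>E. ennreal (cmod (poly (Q k) \<zeta> - g \<zeta>))) \<le> ennreal (\<epsilon> k + \<epsilon> k)" for k
    unfolding ennreal_plus[OF e0 e0] using Q by (intro add_mono SUP_least ennreal_leI less_imp_le) auto
  have "\<epsilon> \<longlonglongrightarrow> 0" unfolding \<epsilon>_def by (rule LIMSEQ_inverse_real_of_nat)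
  then have "(\<lambda>k. \<epsilon> k + \<epsilon> k) \<longlonglongrightarrow> 0" using tendsto_add[of \<epsilon> 0 sequentially \<epsilon> 0] by simp
  then have "(\<lambda>k. ennreal (\<epsilon> k + \<epsilon> k)) \<longlonglongrightarrow> 0" using tendsto_ennrealI by fastforce
  then have "(\<lambda>k. ennreal (l2_norm \<Omega> (\<lambda>\<zeta>. poly (Q k) \<zeta> - h \<zeta>)) + (SUP \<zeta>\<in>E. ennreal (cmod (poly (Q k) \<zeta> - g \<zeta>)))) \<longlonglongrightarrow> 0"
    by (rule tendsto_sandwich[OF always_eventually always_eventually tendsto_const, rotated 2])
      (use le in \<open>blast intro: zero_le\<close>)+
  then show ?thesis by blast
qed

end

lemma simultaneous_approximation_imp_zero_capacity:
  assumes om: "\<And>n. om n > 0" and E: "compact E" "E \<subseteq> unit_circle"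
    and lim: "(\<lambda>k. ennreal (l2_norm (\<lambda>n. 1 / om n) (poly (Q k))) + (SUP \<zeta>\<in>E. ennreal (cmod (poly (Q k) \<zeta> - 1)))) \<longlonglongrightarrow> 0"
  shows "capacity om E = 0"
proof -
  interpret pos_weight "\<lambda>n. 1 / om n" by unfold_locales (simp add: om)
  have "energy om \<mu> = \<infinity>" if \<mu>: "prob_measure_on E \<mu>" for \<mu>
  proof (rule ccontr)
    assume "energy om \<mu> \<noteq> \<infinity>"
    then obtain e where e: "energy om \<mu> = ennreal e" "0 \<le> e"
      by (cases "energy om \<mu>") auto
    interpret \<mu>: prob_space \<mu> using \<mu> by (simp add: prob_measure_on_def)
    have sets: "sets \<mu> = sets (restrict_space borel unit_circle)" using \<mu> by (simp add: prob_measure_on_def)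
    have space: "space \<mu> = unit_circle" using sets_eq_imp_space_eq[OF sets] by simp
    have aeE: "AE \<zeta> in \<mu>. \<zeta> \<in> E"
    proof (rule AE_I)
      show "{\<zeta> \<in> space \<mu>. \<zeta> \<notin> E} \<subseteq> unit_circle - E" by (auto simp: space)
      show "emeasure \<mu> (unit_circle - E) = 0" using \<mu> by (simp add: prob_measure_on_def)
      have "unit_circle - E \<in> sets borel"
        by (intro sets.Diff borel_closed compact_imp_closed E compact_sphere)
      then show "unit_circle - E \<in> sets \<mu>" unfolding sets by (auto simp: sets_restrict_space_iff)
    qed
    have int: "integrable \<mu> u" if u: "continuous_on unit_circle u" for u :: "complex \<Rightarrow> complex"
    proof -
      obtain B where "\<And>z. z \<in> unit_circle \<Longrightarrow> norm (u z) \<le> B" using bounded_on_circle[OF u] by metis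
      moreover have "u \<in> borel_measurable \<mu>"
        using borel_measurable_continuous_on_restrict[OF u] by (simp cong: measurable_cong_sets add: sets)
      ultimately show ?thesis by (intro \<mu>.integrable_const_bound[where B = B] AE_I2) (auto simp: space)
    qed
    \<comment> \<open>The sign is chosen so that \<open>m n\<close> pairs with the monomial
      \<open>\<zeta> ^ n\<close>: polynomials see only one half of the frequencies in the
      energy.\<close>
    define m where "m n = fourier_measure \<mu> (- int n)" for n
    have mn: "m n = (LINT \<zeta>|\<mu>. \<zeta> ^ n)" for n by (simp add: m_def fourier_measure_def)
    have msum: "(\<Sum>n\<le>d. om n * (cmod (m n))\<^sup>2) \<le> e" for d
    proof -
      let ?g = "\<lambda>n. ennreal (om (nat \<bar>n\<bar>) * (cmod (fourier_measure \<mu> n))\<^sup>2)"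
      have "(\<Sum>n\<le>d. ennreal (om n * (cmod (m n))\<^sup>2)) = (\<Sum>n\<in>(\<lambda>n. - int n) ` {..d}. ?g n)"
        by (subst sum.reindex) (auto simp: inj_on_def m_def)
      also have "\<dots> \<le> energy om \<mu>"
        unfolding energy_def by (subst nonneg_infsum_complete) (auto intro!: SUP_upper)
      finally have "ennreal (\<Sum>n\<le>d. om n * (cmod (m n))\<^sup>2) \<le> ennreal e"
        using om by (simp add: e sum_ennreal less_imp_le)
      then show ?thesis using e by simp
    qed
    have CS: "cmod (LINT \<zeta>|\<mu>. poly p \<zeta>) \<le> l2_norm (\<lambda>n. 1 / om n) (poly p) * sqrt e" for p
    proof -
      have "(LINT \<zeta>|\<mu>. poly p \<zeta>) = (LINT \<zeta>|\<mu>. (\<Sum>n\<le>degree p. coeff p n * \<zeta> ^ n))"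
        by (simp add: poly_altdef)
      also have "\<dots> = (\<Sum>n\<le>degree p. coeff p n * m n)"
        unfolding mn by (subst Bochner_Integration.integral_sum) (auto intro!: int continuous_intros)
      finally have eq: "(LINT \<zeta>|\<mu>. poly p \<zeta>) = (\<Sum>n\<le>degree p. coeff p n * m n)" .
      have ws: "wsummable (\<lambda>n. 1 / om n) (coeff p)"
        by (rule wsummable_finite) (auto intro: finite_subset[OF _ finite_atMost[of "degree p"]] simp: le_degree)
      \<comment> \<open>Splitting the weight as \<open>sqrt (om n)\<close> against its inverse makes
        Cauchy-Schwarz pair the norm of \<open>p\<close> with the energy.\<close>
      define a where "a n = cmod (coeff p n) / sqrt (om n)" for n
      define b where "b n = sqrt (om n) * cmod (m n)" for n
      have a2: "(a n)\<^sup>2 = 1 / om n * (cmod (coeff p n))\<^sup>2" and b2: "(b n)\<^sup>2 = om n * (cmod (m n))\<^sup>2" for n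
        using om[of n] by (simp_all add: a_def b_def power_divide power_mult_distrib)
      have "cmod (LINT \<zeta>|\<mu>. poly p \<zeta>) \<le> (\<Sum>n\<le>degree p. cmod (coeff p n * m n))"
        unfolding eq by (rule norm_sum)
      also have "\<dots> = (\<Sum>n\<le>degree p. a n * b n)"
      proof (intro sum.cong refl)
        fix n
        have "sqrt (om n) \<noteq> 0" using om[of n] by simp
        then show "cmod (coeff p n * m n) = a n * b n" by (simp add: a_def b_def norm_mult)
      qed
      also have "\<dots> \<le> sqrt (\<Sum>n\<le>degree p. (a n)\<^sup>2) * sqrt (\<Sum>n\<le>degree p. (b n)\<^sup>2)"
        using Cauchy_Schwarz_ineq_sum[of a b "{..degree p}"]
        by (metis real_le_rsqrt real_sqrt_mult)
      also have "\<dots> \<le> sqrt (wnorm2 (\<lambda>n. 1 / om n) (coeff p)) * sqrt e"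
        unfolding a2 b2 using wsum_le_wnorm2[OF ws finite_atMost] msum e wnorm2_nonneg[OF ws]
        by (intro mult_mono real_sqrt_le_mono) (auto intro!: sum_nonneg mult_nonneg_nonneg less_imp_le[OF om])
      also have "sqrt (wnorm2 (\<lambda>n. 1 / om n) (coeff p)) = l2_norm (\<lambda>n. 1 / om n) (poly p)"
        using l2_norm_eq[OF hardy_poly(1)] ws by (simp add: hardy_poly)
      finally show ?thesis .
    qed
    \<comment> \<open>The integral of \<open>Q k\<close> will be at most
      \<open>\<eta> * sqrt e\<close> in modulus and within \<open>\<eta>\<close> of 1, which forces
      \<open>1 \<le> \<eta> * (1 + sqrt e)\<close>; this value makes the right side 1/2.\<close>
    define \<eta> where "\<eta> = 1 / (2 * (1 + sqrt e))"
    have se: "0 \<le> sqrt e" using e by simp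
    have \<eta>: "0 < \<eta>" "\<eta> * (1 + sqrt e) = 1 / 2"
    proof -
      have "0 < x \<Longrightarrow> 0 < 1 / (2 * x)" "0 < x \<Longrightarrow> 1 / (2 * x) * x = 1 / 2" for x :: real by simp_all
      moreover have "0 < 1 + sqrt e" using se by linarith
      ultimately show "0 < \<eta>" "\<eta> * (1 + sqrt e) = 1 / 2" unfolding \<eta>_def by blast+
    qed
    have "eventually (\<lambda>k. ennreal (l2_norm (\<lambda>n. 1 / om n) (poly (Q k))) + (SUP \<zeta>\<in>E. ennreal (cmod (poly (Q k) \<zeta> - 1))) < ennreal \<eta>) sequentially"
      using \<eta> by (intro order_tendstoD(2)[OF lim]) simp
    then obtain k where k: "ennreal (l2_norm (\<lambda>n. 1 / om n) (poly (Q k))) + (SUP \<zeta>\<in>E. ennreal (cmod (poly (Q k) \<zeta> - 1))) < ennreal \<eta>"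
      by (auto simp: eventually_sequentially)
    have "ennreal (l2_norm (\<lambda>n. 1 / om n) (poly (Q k))) < ennreal \<eta>"
      by (rule le_less_trans[OF _ k]) simp
    then have l: "l2_norm (\<lambda>n. 1 / om n) (poly (Q k)) \<le> \<eta>"
      using \<eta> by (metis ennreal_less_iff less_imp_le linorder_not_le ennreal_leI)
    have Qs: "cmod (poly (Q k) \<zeta> - 1) \<le> \<eta>" if "\<zeta> \<in> E" for \<zeta>
    proof -
      have "ennreal (cmod (poly (Q k) \<zeta> - 1)) \<le> (SUP \<zeta>\<in>E. ennreal (cmod (poly (Q k) \<zeta> - 1)))"
        using that by (rule SUP_upper)
      also have "\<dots> \<le> ennreal (l2_norm (\<lambda>n. 1 / om n) (poly (Q k))) + (SUP \<zeta>\<in>E. ennreal (cmod (poly (Q k) \<zeta> - 1)))" by simp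
      also have "\<dots> < ennreal \<eta>" by (rule k)
      finally show ?thesis by (simp add: ennreal_less_iff)
    qed
    have iQ: "integrable \<mu> (poly (Q k))" by (intro int continuous_intros)
    have "cmod ((LINT \<zeta>|\<mu>. poly (Q k) \<zeta>) - 1) = cmod (LINT \<zeta>|\<mu>. poly (Q k) \<zeta> - 1)"
      using iQ \<mu>.prob_space by simp
    also have "\<dots> \<le> (LINT \<zeta>|\<mu>. cmod (poly (Q k) \<zeta> - 1))" by (rule integral_norm_bound)
    also have "\<dots> \<le> (LINT \<zeta>|\<mu>. \<eta>)"
    proof (rule integral_mono_AE)
      show "integrable \<mu> (\<lambda>\<zeta>. cmod (poly (Q k) \<zeta> - 1))" using iQ by (intro integrable_norm Bochner_Integration.integrable_diff) auto
      show "AE \<zeta> in \<mu>. cmod (poly (Q k) \<zeta> - 1) \<le> \<eta>" using aeE by eventually_elim (rule Qs)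
    qed simp
    also have "\<dots> = \<eta>" using \<mu>.prob_space by simp
    finally have 1: "cmod ((LINT \<zeta>|\<mu>. poly (Q k) \<zeta>) - 1) \<le> \<eta>" .
    have 2: "cmod (LINT \<zeta>|\<mu>. poly (Q k) \<zeta>) \<le> \<eta> * sqrt e"
      using CS[of "Q k"] mult_right_mono[OF l se] by linarith
    have "cmod 1 \<le> cmod (LINT \<zeta>|\<mu>. poly (Q k) \<zeta>) + cmod ((LINT \<zeta>|\<mu>. poly (Q k) \<zeta>) - 1)"
      by (metis add_diff_cancel_left' diff_add_cancel norm_triangle_sub norm_minus_commute)
    then have "1 \<le> \<eta> * (1 + sqrt e)" using 1 2 by (simp add: algebra_simps)
    then show False using \<eta> by simp
  qed
  then show ?thesis
    unfolding capacity_def by (auto simp: SUP_eq_const bot_ennreal intro!: antisym SUP_least)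
qed

context exponential_construction
begin

lemma fN_l2A: "fN 0 \<in> l2A \<Omega>"
proof -
  have "fN 0 \<in> L2_circle" by (intro continuous_L2_circle continuous_on_subset[OF fN_cont]) auto
  then show ?thesis
    using hardy_disc_algebra[OF fN_cont fN_holo, of 0] fN_wsummable by (simp add: l2A_iff)
qed

text \<open>With \<open>s = fN 0 * p * q\<close> one has
  \<open>s - h = q * (fN 0 * p - 1) + (q - h)\<close>. The truncation \<open>q\<close> of
  \<open>h\<close> is fixed first, so its multiplier constant \<open>K\<close> is known when
  \<open>p\<close> is chosen to make \<open>fN 0 * p - 1\<close> small.\<close>

lemma fN_dense: "dense_in_l2A \<Omega> (linear_span {(\<lambda>z. fN 0 z * z ^ n) | n::nat. True})"
  unfolding dense_in_l2A_def linear_span_monomials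
proof (intro conjI ballI allI impI)
  have hf: "hardy (fN 0)" "cf (fN 0) = taylor (fN 0)" by (rule hardy_disc_algebra[OF fN_cont fN_holo])+
  have cont: "continuous_on unit_circle (fN 0)" by (rule continuous_on_subset[OF fN_cont]) auto
  have pc: "hardy (\<lambda>z. fN 0 z * poly p z) \<and> wsummable \<Omega> (cf (\<lambda>z. fN 0 z * poly p z))" for p
  proof -
    have "hardy (\<lambda>z. poly p z * fN 0 z) \<and> wsummable \<Omega> (cf (\<lambda>z. poly p z * fN 0 z))"
      using poly_mult_bounded[of p] hf fN_wsummable[of 0] by auto
    then show ?thesis by (simp only: mult.commute)
  qed
  show "{\<lambda>z. fN 0 z * poly p z |p. True} \<subseteq> l2A \<Omega>"
  proof
    fix u assume "u \<in> {\<lambda>z. fN 0 z * poly p z |p. True}"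
    then obtain p where u: "u = (\<lambda>z. fN 0 z * poly p z)" by auto
    have "u \<in> L2_circle" unfolding u by (intro continuous_L2_circle continuous_intros cont)
    then show "u \<in> l2A \<Omega>" using pc[of p] by (simp add: l2A_iff u)
  qed
  fix h :: "complex \<Rightarrow> complex" and \<epsilon> :: real
  assume h: "h \<in> l2A \<Omega>" and e: "\<epsilon> > 0"
  have hh: "hardy h" "wsummable \<Omega> (cf h)" using l2A_hardy[OF h] by auto
  obtain q where q: "wsummable \<Omega> (\<lambda>n. coeff q n - cf h n)" "wnorm2 \<Omega> (\<lambda>n. coeff q n - cf h n) < \<epsilon>\<^sup>2 / 4"
    using truncation[OF hh(2), of "\<epsilon>\<^sup>2 / 4"] e by auto
  obtain K where K: "K \<ge> 0" and Kb: "\<And>u. hardy u \<Longrightarrow> wsummable \<Omega> (cf u) \<Longrightarrow>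
     hardy (\<lambda>\<zeta>. poly q \<zeta> * u \<zeta>) \<and> wsummable \<Omega> (cf (\<lambda>\<zeta>. poly q \<zeta> * u \<zeta>)) \<and>
     wnorm2 \<Omega> (cf (\<lambda>\<zeta>. poly q \<zeta> * u \<zeta>)) \<le> K * wnorm2 \<Omega> (cf u)"
    using poly_mult_bounded[of q] by blast
  \<comment> \<open>\<open>K + 1\<close> rather than \<open>K\<close> in the denominator, as
    \<open>K\<close> may be 0.\<close>
  define \<delta> where "\<delta> = \<epsilon>\<^sup>2 / (4 * (K + 1))"
  have \<delta>: "\<delta> > 0" "K * \<delta> \<le> \<epsilon>\<^sup>2 / 4"
  proof -
    show "\<delta> > 0" using e K by (simp add: \<delta>_def)
    have "K * \<delta> \<le> (K + 1) * \<delta>" using \<open>\<delta> > 0\<close> by (simp add: distrib_right)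
    also have "\<dots> = \<epsilon>\<^sup>2 / 4"
    proof -
      have "x * (y / (4 * x)) = y / 4" if "x \<noteq> 0" for x y :: real using that by simp
      moreover have "K + 1 \<noteq> 0" using K by linarith
      ultimately show ?thesis unfolding \<delta>_def by blast
    qed
    finally show "K * \<delta> \<le> \<epsilon>\<^sup>2 / 4" .
  qed
  obtain p where p: "wsummable \<Omega> (taylor (\<lambda>z. fN 0 z * poly p z - 1))" "wnorm2 \<Omega> (taylor (\<lambda>z. fN 0 z * poly p z - 1)) < \<delta>"
    using approximate_one[OF \<delta>(1)] by blast
  define v where "v z = fN 0 z * poly p z - 1" for z
  have v: "hardy v" "cf v = taylor v"
    unfolding v_def
    by (rule hardy_disc_algebra; intro continuous_intros fN_cont holomorphic_on_diff holomorphic_on_mult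
        holomorphic_on_const fN_holo holomorphic_poly)+
  have vw: "wsummable \<Omega> (cf v)" "wnorm2 \<Omega> (cf v) < \<delta>" unfolding v(2) using p by (simp_all add: v_def[abs_def])
  note qv = Kb[OF v(1) vw(1)]
  have "K * wnorm2 \<Omega> (cf v) \<le> K * \<delta>" using vw K by (intro mult_left_mono) auto
  then have n1: "wnorm2 \<Omega> (cf (\<lambda>\<zeta>. poly q \<zeta> * v \<zeta>)) \<le> \<epsilon>\<^sup>2 / 4" using qv \<delta> by linarith
  define s where "s z = fN 0 z * poly (p * q) z" for z
  have "(\<lambda>\<zeta>. s \<zeta> - h \<zeta>) = (\<lambda>\<zeta>. poly q \<zeta> * v \<zeta> + (poly q \<zeta> - h \<zeta>))"
    by (simp add: s_def v_def fun_eq_iff algebra_simps)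
  moreover have qh: "hardy (\<lambda>\<zeta>. poly q \<zeta> - h \<zeta>)" "cf (\<lambda>\<zeta>. poly q \<zeta> - h \<zeta>) = (\<lambda>n. coeff q n - cf h n)"
    using hardy_diff[OF hardy_poly(1)[of q] hh(1)] unfolding hardy_poly(2) by blast+
  ultimately have sh: "hardy (\<lambda>\<zeta>. s \<zeta> - h \<zeta>)" "cf (\<lambda>\<zeta>. s \<zeta> - h \<zeta>) = (\<lambda>n. cf (\<lambda>\<zeta>. poly q \<zeta> * v \<zeta>) n + (coeff q n - cf h n))"
    using hardy_add[OF conjunct1[OF qv] qh(1)] by auto
  note sum = wsummable_add[OF conjunct1[OF conjunct2[OF qv]] q(1)]
  have "l2_norm \<Omega> (\<lambda>\<zeta>. s \<zeta> - h \<zeta>) = sqrt (wnorm2 \<Omega> (cf (\<lambda>\<zeta>. s \<zeta> - h \<zeta>)))"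
    by (rule l2_norm_eq[OF sh(1)]) (simp only: sh(2) sum(1))
  also have "\<dots> < \<epsilon>"
  proof (rule real_less_lsqrt)
    show "wnorm2 \<Omega> (cf (\<lambda>\<zeta>. s \<zeta> - h \<zeta>)) < \<epsilon>\<^sup>2" unfolding sh(2) using sum(2) n1 q(2) by linarith
  qed (use e in auto)
  finally have "l2_norm \<Omega> (\<lambda>\<zeta>. s \<zeta> - h \<zeta>) < \<epsilon>" .
  moreover have "s \<in> {\<lambda>z. fN 0 z * poly p z |p. True}"
    unfolding s_def[abs_def] by blast
  ultimately show "\<exists>s\<in>{\<lambda>z. fN 0 z * poly p z |p. True}. l2_norm \<Omega> (\<lambda>\<zeta>. s \<zeta> - h \<zeta>) < \<epsilon>" by (rule bexI)
qed

end

theorem theorem2p3: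
  fixes W :: "real \<Rightarrow> real" and om Om :: "nat \<Rightarrow> real" and E :: "complex set"
  assumes "weight W" and "cond_C1 W" and "cond_C2 W" and "cond_C3 W"
    and "\<And>n. om n = moment_seq W n"
    and "\<And>n. Om n = 1 / om n"
    and "compact E" and "E \<subseteq> unit_circle"
  shows
    "(capacity om E = 0 \<longleftrightarrow>
        (\<exists>f \<in> CA \<inter> l2A Om. outer (poisson f) \<and> (\<forall>\<zeta>\<in>E. f \<zeta> = 0) \<and>
           dense_in_l2A Om (linear_span {(\<lambda>z. f z * z ^ n) | n::nat. True}))) \<and>
     (capacity om E = 0 \<longleftrightarrow>
        (\<exists>f \<in> CA \<inter> l2A Om. outer (poisson f) \<and> (\<forall>\<zeta>\<in>E. f \<zeta> = 0) \<and>
           dense_in_l2A Om (linear_span {(\<lambda>z. f z * z ^ n) | n::nat. True}) \<and>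
           (\<forall>\<zeta>\<in>unit_circle - E. continues_analytically_at (poisson f) \<zeta>))) \<and>
     (capacity om E = 0 \<longleftrightarrow>
        (\<forall>h \<in> l2A Om. \<forall>g. continuous_on E g \<longrightarrow>
           (\<exists>Q :: nat \<Rightarrow> complex poly.
              (\<lambda>k. ennreal (l2_norm Om (\<lambda>\<zeta>. poly (Q k) \<zeta> - h \<zeta>)) +
                   (SUP \<zeta>\<in>E. ennreal (cmod (poly (Q k) \<zeta> - g \<zeta>)))) \<longlonglongrightarrow> 0)))"
    (is "(?cap \<longleftrightarrow> ?weak) \<and> (?cap \<longleftrightarrow> ?strong) \<and> (?cap \<longleftrightarrow> ?approx)")
proof -
  define w where "w r = indicator {0..<1} r * W (1 - r)" for r
  interpret moment_weight w
    unfolding w_def[abs_def] by (rule moment_weight_reflect(1)[OF assms(1)])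
  have mm: "om = mom"
    using moment_weight_reflect(3)[OF assms(1)] assms(5) by (simp add: fun_eq_iff w_def[abs_def])
  have om_pos: "om n > 0" for n using moment_seq_pos[OF assms(1,3)] assms(5) by simp
  interpret positive_moments w
    by unfold_locales (use om_pos mm in auto)
  have Om: "Om = (\<lambda>n. 1 / mom n)" using assms(6) mm by auto
  obtain C where C: "0 < C" "C < 4" "\<And>n. mom n \<le> C * mom (2 * n)"
    using moment_seq_double[OF assms(1,2,4)] assms(5) mm by metis
  interpret doubling_weight "\<lambda>n. 1 / mom n" C
  proof
    show "0 < 1 / mom n" for n using mom_pos by simp
    show "1 / mom m \<le> 1 / mom n" if "m \<le> n" for m n
      using mom_antimono[OF that] mom_pos by (intro divide_left_mono) auto
    show "1 / mom (2 * n) \<le> C * (1 / mom n)" for n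
      using C(3)[of n] mom_pos[of n] mom_pos[of "2 * n"] by (simp add: field_simps)
    show "C < 4" by (rule C)
  qed
  have 1: ?strong if cap: ?cap
  proof -
    have cap': "capacity mom E = 0" using cap mm by simp
    \<comment> \<open>The conclusions of \<open>zero_capacity_functions\<close> for one
      \<open>k\<close> are packed into a predicate, so that the whole sequence \<open>Fs\<close> can
      be chosen at once.\<close>
    define good_fun where "good_fun k F \<longleftrightarrow> (\<exists>R>1. F holomorphic_on ball 0 R) \<and> (\<forall>z. cmod z \<le> 1 \<longrightarrow> 0 \<le> Re (F z)) \<and>
      (\<forall>z\<in>E. 1 \<le> Re (F z)) \<and> Im (F 0) = 0 \<and> wsummable (\<lambda>n. 1 / mom n) (taylor F) \<and>
      wnorm2 (\<lambda>n. 1 / mom n) (taylor F) \<le> (1 / 4) ^ Suc k \<and>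
      (\<forall>\<zeta> d. cmod \<zeta> \<le> 1 \<longrightarrow> 0 < d \<longrightarrow> d \<le> 1 \<longrightarrow> (\<forall>y\<in>E. d \<le> dist \<zeta> y) \<longrightarrow>
        F holomorphic_on ball \<zeta> (d / 4) \<and> (\<forall>z\<in>ball \<zeta> (d / 4). cmod (F z) \<le> (1 / 4) ^ Suc k / d))" for k F
    have "\<exists>F. good_fun k F" for k
    proof -
      have "(1 / 4 :: real) ^ Suc k > 0" by simp
      from zero_capacity_functions[OF assms(7,8) cap' this] show ?thesis
        unfolding good_fun_def by metis
    qed
    then obtain Fs where Fs: "\<And>k. good_fun k (Fs k)" by metis
    interpret exponential_construction "\<lambda>n. 1 / mom n" C E Fs
      by unfold_locales (use Fs assms(7,8) in \<open>auto simp: good_fun_def\<close>)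
    show ?thesis
      unfolding Om
    proof (intro bexI[of _ "fN 0"] conjI ballI)
      show "outer (poisson (fN 0))" by (rule fN_outer)
      show "fN 0 \<zeta> = 0" if "\<zeta> \<in> E" for \<zeta> using that by (simp add: fN_def)
      show "dense_in_l2A (\<lambda>n. 1 / mom n) (linear_span {(\<lambda>z. fN 0 z * z ^ n) | n::nat. True})" by (rule fN_dense)
      show "continues_analytically_at (poisson (fN 0)) \<zeta>" if "\<zeta> \<in> unit_circle - E" for \<zeta>
        by (rule fN_continues[OF that])
      show "fN 0 \<in> CA \<inter> l2A (\<lambda>n. 1 / mom n)"
        using fN_l2A disc_algebra_CA[OF fN_cont fN_holo] by blast
    qed
  qed
  have 2: ?weak if ?strong using that by blast
  have 3: ?approx if ?weak
    using that cyclic_imp_simultaneous_approximation[OF assms(7,8)] unfolding Om by blast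
  \<comment> \<open>The single instance \<open>h = 0\<close>, \<open>g = 1\<close> is
    enough.\<close>
  have 4: ?cap if a: ?approx
  proof -
    have "poly 0 = (\<lambda>_. 0 :: complex)" by auto
    then have z: "(\<lambda>_. 0) \<in> l2A Om" using l2A_poly[of 0] unfolding Om by simp
    have "continuous_on E (\<lambda>_. 1 :: complex)" by (rule continuous_on_const)
    then obtain Q :: "nat \<Rightarrow> complex poly" where
      "(\<lambda>k. ennreal (l2_norm Om (\<lambda>\<zeta>. poly (Q k) \<zeta> - 0)) + (SUP \<zeta>\<in>E. ennreal (cmod (poly (Q k) \<zeta> - 1)))) \<longlonglongrightarrow> 0"
      using bspec[OF a z, THEN spec, of "\<lambda>_. 1"] by blast
    then show ?thesis
      unfolding Om mm diff_zero using mom_pos assms(7,8)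
      by (intro simultaneous_approximation_imp_zero_capacity[where Q = Q]) auto
  qed
  \<comment> \<open>The implications form the cycle \<open>?cap\<close>, \<open>?strong\<close>,
    \<open>?weak\<close>, \<open>?approx\<close>, \<open>?cap\<close>.\<close>
  show ?thesis using 1 2 3 4 by argo
qed

end
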